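(* Let $A \sim \mathbb{A}(n,p)$, where $p = p(n)$ satisfies $p = \omega(1/n)$ and $p \le 1/2$. Then with probability $1 - o(1)$ as $n \to\infty$, for all $k$, all minimal dependencies of $k$ columns of $A$ are in $\mathcal{T}_k$; that is, for every $k \ge 1$ and every $S \subseteq [n]$ with $|S| = k$, if the submatrix $A_S$ is a minimal linear dependency then $A_S \in \mathcal{T}_k$.
   Context: $\mathbb{A}(n,p)$ is the distribution of the random symmetric matrix in $\{0,1\}^{n\times n}$ with zero diagonal whose entries above the diagonal are i.i.d. Bernoulli($p$). $A_S$ denotes the submatrix of $A$ consisting of the columns indexed by $S$. A matrix $M \in \mathbb{R}^{m\times k}$ is a minimal linear dependency (minimal dependency) if (1) there exists $x\in\mathbb{R}^k$ with $Mx = 0$ and $\operatorname{supp}(x) = [k]$, and (2) $\operatorname{rank}(M) = k-1$. $\mathcal{T}_k$ (tree dependencies) is the set of matrices $M \in \bigcup_m \{0,1\}^{m\times k}$ with exactly $2k-2$ ones such that the non-zero rows of $M$ form the edge-vertex incidence matrix (rows indexed by edges, columns indexed by vertices) of a tree on $k$ vertices. *)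

theory Defs
  imports
    "HOL-Probability.Probability"
    "HOL-Library.Landau_Symbols"
    "Jordan_Normal_Form.DL_Rank_Submatrix"
begin

text \<open>
  Rows and columns are indexed from 0, so the index set $[n]$ is \<open>{..<n}\<close>.
  The coins of the pairs \<open>i < j < n\<close> are independent; the default value
  \<open>False\<close> of \<open>Pi_pmf\<close> concerns only pairs outside this index set, which are never read.
\<close>

definition random_sym_mat :: "nat \<Rightarrow> real \<Rightarrow> real mat pmf" where
  "random_sym_mat n p =
     map_pmf
       (\<lambda>f. mat n n (\<lambda>(i, j). if i = j then 0 else of_bool (f (min i j, max i j))))
       (Pi_pmf {(i, j). i < j \<and> j < n} False (\<lambda>_. bernoulli_pmf p))"

definition col_submatrix :: "'a mat \<Rightarrow> nat set \<Rightarrow> 'a mat" where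
  "col_submatrix A S = submatrix A UNIV S"

text \<open>
  The rank condition \<open>rank M = k - 1\<close> is written without truncated subtraction, so that a
  matrix without columns is not a minimal dependency.
\<close>

definition minimal_dependency :: "real mat \<Rightarrow> bool" where
  "minimal_dependency M \<longleftrightarrow>
     (\<exists>x \<in> carrier_vec (dim_col M). M *\<^sub>v x = 0\<^sub>v (dim_row M) \<and> (\<forall>j < dim_col M. x $ j \<noteq> 0)) \<and>
     vec_space.rank (dim_row M) M + 1 = dim_col M"

text \<open>
  Finite simple graphs are given by a vertex set and a set of two-element edges. (The predicate
  \<open>tree\<close> of the AFP entry Graph\_Theory only excludes directed cycles, so it is not the
  undirected notion needed here.)
\<close>

definition simple_graph :: "'a set \<Rightarrow> 'a set set \<Rightarrow> bool" where
  "simple_graph V E \<longleftrightarrow> finite V \<and> (\<forall>e \<in> E. e \<subseteq> V \<and> card e = 2)"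

definition connected_graph :: "'a set \<Rightarrow> 'a set set \<Rightarrow> bool" where
  "connected_graph V E \<longleftrightarrow> V \<noteq> {} \<and> (\<forall>u \<in> V. \<forall>v \<in> V. (u, v) \<in> {(x, y). {x, y} \<in> E}\<^sup>*)"

definition graph_cycle :: "'a set set \<Rightarrow> 'a list \<Rightarrow> bool" where
  "graph_cycle E c \<longleftrightarrow>
     length c \<ge> 3 \<and> distinct c \<and>
     (\<forall>i < length c. {c ! i, c ! (Suc i mod length c)} \<in> E)"

definition is_tree :: "'a set \<Rightarrow> 'a set set \<Rightarrow> bool" where
  "is_tree V E \<longleftrightarrow> simple_graph V E \<and> connected_graph V E \<and> (\<nexists>c. graph_cycle E c)"

text \<open>
  The vertices are the column indices of \<open>M\<close>; the bijection \<open>e\<close> says that every edge is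
  represented by exactly one non-zero row.
\<close>

definition nonzero_rows_incidence :: "real mat \<Rightarrow> nat set set \<Rightarrow> bool" where
  "nonzero_rows_incidence M E \<longleftrightarrow>
     (\<exists>e. bij_betw e {i. i < dim_row M \<and> row M i \<noteq> 0\<^sub>v (dim_col M)} E \<and>
          (\<forall>i < dim_row M. row M i \<noteq> 0\<^sub>v (dim_col M) \<longrightarrow>
             (\<forall>j < dim_col M. M $$ (i, j) = (if j \<in> e i then 1 else 0))))"

definition tree_dependencies :: "nat \<Rightarrow> real mat set" where
  "tree_dependencies k =
     {M. dim_col M = k \<and> elements_mat M \<subseteq> {0, 1} \<and>
         card {(i, j). i < dim_row M \<and> j < dim_col M \<and> M $$ (i, j) = 1} = 2 * k - 2 \<and>
         (\<exists>E. is_tree {..<k} E \<and> nonzero_rows_incidence M E)}"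

end

theory Submission
  imports Defs
begin

text \<open>
  Let \<open>d = n p\<close>, which tends to infinity. A minimal dependency on \<open>k\<close> columns that is not a tree has no row
  with exactly one entry and has at least \<open>k\<close> non-zero rows, or \<open>k - 1\<close> of them and at least \<open>2 k - 1\<close> entries.
  For \<open>k p \<le> K\<close> a first moment computation with terms \<open>(C d\<^sup>2 e\<^bsup>-c d\<^esup>)\<^bsup>k\<^esup>\<close> excludes this. For \<open>K \<le> k p\<close> and
  \<open>4 k \<le> n\<close>, at most \<open>k\<close> rows determine all solutions of a linear system supported on \<open>S\<close>, and each
  of the remaining independent rows outside \<open>S\<close> is satisfied with small probability by a
  Littlewood--Offord bound.

  Since a kernel vector with \<open>4 k > n\<close> uses more than a quarter of the vertices, it remains to show
  that a fixed vertex \<open>v\<close> rarely lies in the support of a kernel vector. If it does, its column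
  \<open>a\<close> is \<open>A' w\<close> with \<open>w \<bullet> a = 0\<close>, where \<open>A'\<close> is the matrix without \<open>v\<close>. Resampling \<open>a\<close> on a small
  set \<open>U\<close> and on its complement decouples this quadratic condition into a linear one: every solution of
  \<open>A' w = u\<close>, with \<open>u\<close> the difference of the two copies of \<open>a\<close> on \<open>U\<close>, is orthogonal to the difference
  of the copies off \<open>U\<close>. This avoids inverting \<open>A'\<close>, which is typically singular. A solution of
  minimal support is rarely sparse, by the two estimates above applied with the two copies as extra
  columns, and for a solution that is not sparse Littlewood--Offord applies.
\<close>

section \<open>Independent biased coins\<close>

text \<open>When \<open>n p\<close> grows slowly, zero columns and pairs of equal columns with a
  single entry typically exist, so full rank is out of reach and the argument has to recognise trees
  among the dependencies. The ranges of \<open>k\<close> are forced by two mechanisms. While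
  \<open>k p\<close> is bounded, a row meets the \<open>k\<close> columns exactly once with
  probability comparable to \<open>k p\<close>, and such a row excludes a kernel vector without zero
  entries. Once \<open>k p\<close> is large this event is rare as well, and only anti-concentration
  of the weighted row sum is left. That argument needs rows outside the support and outside the
  determining rows; near \<open>k = n / 2\<close> none may remain. Larger supports are therefore
  tested at one vertex, and Markov's inequality leads back to supports. The condition at a vertex is
  quadratic in its column. Each of the two resamplings that polarise it squares the probability,
  which is the origin of the fourth powers. All estimates hold beyond a threshold for
  \<open>n p\<close> that is uniform in the vertex set and the density, so they can be applied after
  the removal of a vertex, and the limit is taken only at the end.\<close>

abbreviation coins :: "real \<Rightarrow> 'a set \<Rightarrow> ('a \<Rightarrow> bool) pmf" where
  "coins p I \<equiv> Pi_pmf I False (\<lambda>_. bernoulli_pmf p)"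

lemma prob_bind_pmf:
  "measure_pmf.prob (bind_pmf M f) E = measure_pmf.expectation M (\<lambda>x. measure_pmf.prob (f x) E)"
  unfolding measure_pmf_bind
  by (subst measure_pmf.measure_bind[where N = "count_space UNIV"]) (auto simp: measure_subprob)

lemma prob_pair_pmf:
  "measure_pmf.prob (pair_pmf M N) E = measure_pmf.expectation M (\<lambda>x. measure_pmf.prob N {y. (x, y) \<in> E})"
proof -
  have "pair_pmf M N = bind_pmf M (\<lambda>x. map_pmf (Pair x) N)"
    by (simp add: pair_pmf_def map_pmf_def)
  thus ?thesis by (simp add: prob_bind_pmf vimage_def)
qed

lemma integrable_prob_pmf [simp]:
  "integrable (measure_pmf M) (\<lambda>x. measure_pmf.prob (N x) (E x))"
  by (rule measure_pmf.integrable_const_bound[of _ 1]) auto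

lemma prob_pair_pmf_le:
  assumes "\<And>x. x \<in> set_pmf M \<Longrightarrow> measure_pmf.prob N {y. (x, y) \<in> E} \<le> b"
  shows "measure_pmf.prob (pair_pmf M N) E \<le> b"
proof -
  have "measure_pmf.prob (pair_pmf M N) E \<le> measure_pmf.expectation M (\<lambda>_. b)"
    unfolding prob_pair_pmf using assms by (intro integral_mono_AE) (auto simp: AE_measure_pmf_iff)
  thus ?thesis by simp
qed

lemma prob_pair_pmf_swap:
  "measure_pmf.prob (pair_pmf M N) E = measure_pmf.prob (pair_pmf N M) {(y, x). (x, y) \<in> E}"
  by (subst pair_commute_pmf) (simp add: vimage_def case_prod_unfold)

lemma coins_Un:
  assumes "finite I" "finite J" "I \<inter> J = {}"
  shows "coins p (I \<union> J) = map_pmf (\<lambda>(g, h). override_on g h J) (pair_pmf (coins p I) (coins p J))"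
proof -
  have "coins p (J \<union> I) = map_pmf (\<lambda>(f, g) x. if x \<in> J then f x else g x) (pair_pmf (coins p J) (coins p I))"
    using assms by (intro Pi_pmf_union) auto
  thus ?thesis
    by (subst pair_commute_pmf) (simp add: Un_commute override_on_def case_prod_unfold map_pmf_comp)
qed

lemma prob_coins_conj_le:
  assumes "finite I" "J \<subseteq> I"
    and D: "\<And>f h. D (override_on f h J) = D f"
    and E: "\<And>f. measure_pmf.prob (coins p J) {h. E (override_on f h J)} \<le> \<eta>"
  shows "measure_pmf.prob (coins p I) {f. D f \<and> E f} \<le> measure_pmf.prob (coins p I) {f. D f} * \<eta>"
proof -
  have fin: "finite J" using assms finite_subset by blast
  have I: "coins p I = map_pmf (\<lambda>(g, h). override_on g h J) (pair_pmf (coins p (I - J)) (coins p J))"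
    using coins_Un[of "I - J" J p] fin assms by (simp add: Un_absorb2 Diff_disjoint Int_commute)
  let ?M = "coins p (I - J)"
  have "measure_pmf.prob (coins p I) {f. D f \<and> E f}
      = measure_pmf.expectation ?M (\<lambda>g. measure_pmf.prob (coins p J) {h. D g \<and> E (override_on g h J)})"
    by (simp add: I prob_pair_pmf D)
  also have "\<dots> \<le> measure_pmf.expectation ?M (\<lambda>g. measure_pmf.prob (coins p J) {h. D g} * \<eta>)"
    using E by (intro integral_mono) auto
  also have "\<dots> = measure_pmf.expectation ?M (\<lambda>g. measure_pmf.prob (coins p J) {h. D g}) * \<eta>"
    by simp
  also have "measure_pmf.expectation ?M (\<lambda>g. measure_pmf.prob (coins p J) {h. D g})
      = measure_pmf.prob (coins p I) {f. D f}"
    by (simp add: I prob_pair_pmf D)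
  finally show ?thesis .
qed

text \<open>One block is peeled off at a time, and the conditions already imposed do not read it.
  The events \<open>E i\<close> may share coins outside the blocks with each other and with
  \<open>D\<close>; in one application those coins select the vector that every block then
  tests.\<close>

lemma prob_coins_blocks_le:
  assumes "finite I" "finite R" "\<And>i. i \<in> R \<Longrightarrow> J i \<subseteq> I" "0 \<le> \<eta>"
    and disj: "\<And>i j. i \<in> R \<Longrightarrow> j \<in> R \<Longrightarrow> i \<noteq> j \<Longrightarrow> J i \<inter> J j = {}"
    and D: "\<And>i f h. i \<in> R \<Longrightarrow> D (override_on f h (J i)) = D f"
    and E: "\<And>i j f h. i \<in> R \<Longrightarrow> j \<in> R \<Longrightarrow> i \<noteq> j \<Longrightarrow> E i (override_on f h (J j)) = E i f"
    and le: "\<And>i f. i \<in> R \<Longrightarrow> measure_pmf.prob (coins p (J i)) {h. E i (override_on f h (J i))} \<le> \<eta>"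
  shows "measure_pmf.prob (coins p I) {f. D f \<and> (\<forall>i\<in>R. E i f)}
           \<le> measure_pmf.prob (coins p I) {f. D f} * \<eta> ^ card R"
proof -
  have "measure_pmf.prob (coins p I) {f. D f \<and> (\<forall>i\<in>R'. E i f)}
           \<le> measure_pmf.prob (coins p I) {f. D f} * \<eta> ^ card R'" if "finite R'" "R' \<subseteq> R" for R'
    using that
  proof (induction R')
    case (insert i R')
    have "measure_pmf.prob (coins p I) {f. (D f \<and> (\<forall>i\<in>R'. E i f)) \<and> E i f}
        \<le> measure_pmf.prob (coins p I) {f. D f \<and> (\<forall>i\<in>R'. E i f)} * \<eta>"
    proof (rule prob_coins_conj_le)
      fix f h
      have "E j (override_on f h (J i)) = E j f" if "j \<in> R'" for j
        using that insert by (intro E) auto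
      thus "(D (override_on f h (J i)) \<and> (\<forall>j\<in>R'. E j (override_on f h (J i)))) =
            (D f \<and> (\<forall>j\<in>R'. E j f))" using D insert by auto
    qed (use insert assms in auto)
    also have "\<dots> \<le> measure_pmf.prob (coins p I) {f. D f} * \<eta> ^ card R' * \<eta>"
      using insert assms by (intro mult_right_mono) auto
    finally show ?case using insert by (simp add: conj_ac mult_ac)
  qed simp
  from this[OF \<open>finite R\<close>] show ?thesis by simp
qed

lemma prob_coins_all:
  assumes "finite I" "F \<subseteq> I" "0 \<le> p" "p \<le> 1"
  shows "measure_pmf.prob (coins p I) {f. \<forall>e\<in>F. f e} = p ^ card F"
proof -
  have "{f. \<forall>e\<in>F. f e} = Pi I (\<lambda>e. if e \<in> F then {True} else UNIV)"
    using assms by (auto simp: Pi_def)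
  hence "measure_pmf.prob (coins p I) {f. \<forall>e\<in>F. f e}
      = (\<Prod>e\<in>I. measure_pmf.prob (bernoulli_pmf p) (if e \<in> F then {True} else UNIV))"
    using assms by (simp add: measure_Pi_pmf_Pi)
  also have "\<dots> = (\<Prod>e\<in>I. if e \<in> F then p else 1)"
    using assms by (intro prod.cong) (auto simp: measure_pmf_single)
  also have "\<dots> = (\<Prod>e\<in>F. p)"
    using assms by (subst prod.inter_restrict[symmetric]) (auto simp: Int_absorb1)
  finally show ?thesis by simp
qed

lemma prob_coins_eq:
  assumes "finite I" "T \<subseteq> I" "0 \<le> p" "p \<le> 1"
  shows "measure_pmf.prob (coins p I) {f. \<forall>e\<in>I. f e \<longleftrightarrow> e \<in> T} = p ^ card T * (1 - p) ^ (card I - card T)"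
proof -
  have fT: "finite T" using assms finite_subset by blast
  have "{f. \<forall>e\<in>I. f e \<longleftrightarrow> e \<in> T} = Pi I (\<lambda>e. {e \<in> T})"
    by (auto simp: Pi_def)
  hence "measure_pmf.prob (coins p I) {f. \<forall>e\<in>I. f e \<longleftrightarrow> e \<in> T}
      = (\<Prod>e\<in>I. measure_pmf.prob (bernoulli_pmf p) {e \<in> T})"
    using assms by (simp add: measure_Pi_pmf_Pi)
  also have "\<dots> = (\<Prod>e\<in>I. if e \<in> T then p else 1 - p)"
    using assms by (intro prod.cong) (auto simp: measure_pmf_single)
  also have "\<dots> = (\<Prod>e\<in>T. p) * (\<Prod>e\<in>I - T. 1 - p)"
    using assms fT by (subst prod.If_cases) (auto simp: Int_absorb1 Diff_eq)
  finally show ?thesis using assms fT by (simp add: card_Diff_subset)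
qed

text \<open>The events that a given \<open>j\<close> is the only success are disjoint and equally
  likely. Counting only \<open>j\<close> in \<open>J\<close> suits rows that surely contain the
  pairs with \<open>S\<close> but perhaps not those with the extra columns.\<close>

lemma prob_exactly_one_ge:
  fixes p :: real
  assumes "finite I" "J \<subseteq> I" "0 \<le> p" "p \<le> 1"
  shows "real (card J) * (p * (1 - p) ^ (card I - 1)) \<le> measure_pmf.prob (coins p I) {f. card {e\<in>I. f e} = 1}"
proof -
  let ?X = "\<lambda>j. {f. \<forall>e\<in>I. f e \<longleftrightarrow> e \<in> {j}}"
  have fin: "finite J" using assms finite_subset by blast
  have dis: "disjoint_family_on ?X J"
  proof (unfold disjoint_family_on_def, intro ballI impI, rule ccontr)
    fix i j assume ij: "i \<in> J" "j \<in> J" "i \<noteq> j" and "?X i \<inter> ?X j \<noteq> {}"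
    then obtain f where f: "\<forall>e\<in>I. f e \<longleftrightarrow> e \<in> {i}" "\<forall>e\<in>I. f e \<longleftrightarrow> e \<in> {j}" by blast
    have "i \<in> I" using ij assms by auto
    with f have "i = j" by auto
    thus False using ij by simp
  qed
  have eq: "measure_pmf.prob (coins p I) (?X j) = p * (1 - p) ^ (card I - 1)" if "j \<in> J" for j
    using prob_coins_eq[of I "{j}" p] assms that by auto
  have "real (card J) * (p * (1 - p) ^ (card I - 1)) = (\<Sum>j\<in>J. measure_pmf.prob (coins p I) (?X j))"
    using eq by (simp add: mult.assoc)
  also have "\<dots> = measure_pmf.prob (coins p I) (\<Union>j\<in>J. ?X j)"
    using fin dis by (subst measure_pmf.finite_measure_finite_Union) auto
  also have "\<dots> \<le> measure_pmf.prob (coins p I) {f. card {e\<in>I. f e} = 1}"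
  proof (rule measure_pmf.finite_measure_mono, rule subsetI)
    fix f assume "f \<in> (\<Union>j\<in>J. ?X j)"
    then obtain j where "j \<in> J" "\<forall>e\<in>I. f e \<longleftrightarrow> e \<in> {j}" by blast
    hence "{e\<in>I. f e} = {j}" using assms by auto
    thus "f \<in> {f. card {e\<in>I. f e} = 1}" by simp
  qed simp
  finally show ?thesis .
qed

section \<open>Independent copies and decoupling\<close>

lemma square_expectation_le:
  fixes f :: "'a \<Rightarrow> real"
  assumes "\<And>x. 0 \<le> f x" "\<And>x. f x \<le> 1"
  shows "(measure_pmf.expectation M f)\<^sup>2 \<le> measure_pmf.expectation M (\<lambda>x. (f x)\<^sup>2)"
proof -
  have "integrable (measure_pmf M) f"
    using assms by (intro measure_pmf.integrable_const_bound[of _ 1]) auto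
  moreover have "integrable (measure_pmf M) (\<lambda>x. (f x)\<^sup>2)"
    using assms by (intro measure_pmf.integrable_const_bound[of _ 1]) (auto simp: power_le_one)
  ultimately have "measure_pmf.variance M f = measure_pmf.expectation M (\<lambda>x. (f x)\<^sup>2) - (measure_pmf.expectation M f)\<^sup>2"
    by (rule measure_pmf.variance_eq)
  moreover have "0 \<le> measure_pmf.variance M f" by (rule measure_pmf.variance_positive)
  ultimately show ?thesis by simp
qed

text \<open>Given \<open>x\<close> the two copies are independent, so the right-hand side is the
  mean of a squared conditional probability, which dominates the square of the mean.\<close>

lemma prob_duplicate:
  "(measure_pmf.prob (pair_pmf M N) {(x, y). E x y})\<^sup>2
     \<le> measure_pmf.prob (pair_pmf M (pair_pmf N N)) {(x, y, y'). E x y \<and> E x y'}"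
proof -
  have "(measure_pmf.prob (pair_pmf M N) {(x, y). E x y})\<^sup>2
      = (measure_pmf.expectation M (\<lambda>x. measure_pmf.prob N {y. E x y}))\<^sup>2"
    by (simp add: prob_pair_pmf)
  also have "\<dots> \<le> measure_pmf.expectation M (\<lambda>x. (measure_pmf.prob N {y. E x y})\<^sup>2)"
    by (rule square_expectation_le) auto
  also have "\<dots> = measure_pmf.expectation M (\<lambda>x. measure_pmf.prob (pair_pmf N N) {(y, y'). E x y \<and> E x y'})"
  proof (rule Bochner_Integration.integral_cong[OF refl])
    fix x
    have "measure_pmf.prob N {y'. E x y \<and> E x y'} = indicator {y. E x y} y * measure_pmf.prob N {y. E x y}" for y
      by (auto simp: indicator_def)
    thus "(measure_pmf.prob N {y. E x y})\<^sup>2 = measure_pmf.prob (pair_pmf N N) {(y, y'). E x y \<and> E x y'}"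
      by (simp add: prob_pair_pmf power2_eq_square)
  qed
  also have "\<dots> = measure_pmf.prob (pair_pmf M (pair_pmf N N)) {(x, y, y'). E x y \<and> E x y'}"
    by (simp add: prob_pair_pmf case_prod_unfold)
  finally show ?thesis .
qed

lemma prob_duplicate':
  "(measure_pmf.prob (pair_pmf M (pair_pmf X Y)) {(z, x, y). E z x y})\<^sup>2
     \<le> measure_pmf.prob (pair_pmf (pair_pmf M (pair_pmf X X)) Y) {((z, x, x'), y). E z x y \<and> E z x' y}"
proof -
  have 1: "pair_pmf M (pair_pmf X Y) = map_pmf (\<lambda>((z, y), x). (z, x, y)) (pair_pmf (pair_pmf M Y) X)"
    unfolding pair_pmf_def map_pmf_def bind_assoc_pmf bind_return_pmf
    by (subst (2) bind_commute_pmf) simp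
  have 2: "pair_pmf (pair_pmf M (pair_pmf X X)) Y
      = map_pmf (\<lambda>((z, y), x, x'). ((z, x, x'), y)) (pair_pmf (pair_pmf M Y) (pair_pmf X X))"
    unfolding pair_pmf_def map_pmf_def bind_assoc_pmf bind_return_pmf
    apply simp
    apply (subst bind_commute_pmf[of Y])
    apply (subst bind_commute_pmf[of Y])
    apply simp
    done
  show ?thesis
    using prob_duplicate[of "pair_pmf M Y" X "\<lambda>(z, y) x. E z x y"]
    unfolding 1 2 by (simp add: vimage_def case_prod_unfold)
qed

text \<open>Duplicating first \<open>x\<close> and then \<open>y\<close> squares the probability
  twice. All four corners of a parallelogram then satisfy \<open>E\<close> for the same
  \<open>g\<close>, which is what polarising a quadratic condition requires.\<close>

lemma prob_decouple:
  "(measure_pmf.prob (pair_pmf M (pair_pmf X Y)) {(g, x, y). E g x y}) ^ 4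
     \<le> measure_pmf.prob (pair_pmf (pair_pmf M (pair_pmf X X)) (pair_pmf Y Y))
          {((g, x, x'), (y, y')). E g x y \<and> E g x' y \<and> E g x y' \<and> E g x' y'}"
proof -
  let ?p = "measure_pmf.prob (pair_pmf M (pair_pmf X Y)) {(g, x, y). E g x y}"
  let ?E = "\<lambda>(g, x, x') y. E g x y \<and> E g x' y"
  have "(?p\<^sup>2)\<^sup>2 \<le> (measure_pmf.prob (pair_pmf (pair_pmf M (pair_pmf X X)) Y) {(z, y). ?E z y})\<^sup>2"
    using prob_duplicate'[of M X Y E] by (intro power_mono) (auto simp: case_prod_unfold)
  also have "\<dots> \<le> measure_pmf.prob (pair_pmf (pair_pmf M (pair_pmf X X)) (pair_pmf Y Y))
          {(z, y, y'). ?E z y \<and> ?E z y'}"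
    by (rule prob_duplicate)
  finally show ?thesis
    by (simp add: case_prod_unfold conj_ac)
qed

section \<open>The Littlewood--Offord inequality\<close>

text \<open>Induction on the ground set: the members avoiding a point \<open>i\<close> form an
  antichain on the remaining points, and averaging over \<open>i\<close> reproduces the weight of
  every proper subset exactly. The full set has no point to avoid, but an antichain containing it
  has no other member.\<close>

lemma lubell_yamamoto_meshalkin:
  assumes "finite I" "F \<subseteq> Pow I" "\<And>A B. A \<in> F \<Longrightarrow> B \<in> F \<Longrightarrow> A \<subseteq> B \<Longrightarrow> A = B"
  shows "(\<Sum>A\<in>F. 1 / real (card I choose card A)) \<le> 1"
  using assms
proof (induction "card I" arbitrary: I F)
  case 0
  hence "F \<subseteq> {{}}" "card I = 0" by auto
  hence "F = {} \<or> F = {{}}" by auto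
  thus ?case using \<open>card I = 0\<close> by (elim disjE) simp_all
next
  case (Suc n)
  have finF: "finite F" using Suc.prems(1,2) by (meson finite_Pow_iff finite_subset)
  show ?case
  proof (cases "I \<in> F")
    case True
    hence "F = {I}" using Suc.prems by blast
    thus ?thesis by simp
  next
    case False
    have sub: "A \<subset> I" if "A \<in> F" for A using that False Suc.prems by auto
    have ident: "1 / real (Suc n choose card A) = (\<Sum>i\<in>I - A. 1 / real (n choose card A)) / Suc n"
      if "A \<in> F" for A
    proof -
      have lt: "card A < Suc n" using sub[OF that] Suc by (metis psubset_card_mono)
      have "real (Suc n - card A) * real (Suc n choose card A) = real (Suc n) * real (n choose card A)"
        using binomial_absorb_comp[of "Suc n" "card A"] by (metis diff_Suc_1 of_nat_mult)
      moreover have "card (I - A) = Suc n - card A"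
        using sub[OF that] Suc by (subst card_Diff_subset) (auto intro: finite_subset)
      moreover have "(Suc n choose card A) > 0" "(n choose card A) > 0" using lt by auto
      ultimately show ?thesis using lt by (simp add: field_simps del: of_nat_Suc binomial_Suc_Suc)
    qed
    have "(\<Sum>A\<in>F. 1 / real (card I choose card A))
        = (\<Sum>A\<in>F. \<Sum>i\<in>I - A. 1 / real (n choose card A)) / Suc n"
      using ident Suc by (simp add: sum_divide_distrib)
    also have "(\<Sum>A\<in>F. \<Sum>i\<in>I - A. 1 / real (n choose card A))
        = (\<Sum>A\<in>F. \<Sum>i | i \<in> I \<and> i \<notin> A. 1 / real (n choose card A))"
      by (intro sum.cong) auto
    also have "\<dots> = (\<Sum>i\<in>I. \<Sum>A | A \<in> F \<and> i \<notin> A. 1 / real (n choose card A))"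
      using finF Suc by (intro sum.swap_restrict) auto
    also have "\<dots> \<le> (\<Sum>i\<in>I. 1)"
    proof (intro sum_mono)
      fix i assume i: "i \<in> I"
      hence c: "n = card (I - {i})" using Suc by simp
      have "(\<Sum>A\<in>{A \<in> F. i \<notin> A}. 1 / real (card (I - {i}) choose card A)) \<le> 1"
      proof (rule Suc.hyps(1)[OF c])
        show "{A \<in> F. i \<notin> A} \<subseteq> Pow (I - {i})" using Suc.prems by auto
      qed (use Suc.prems in auto)
      thus "(\<Sum>A | A \<in> F \<and> i \<notin> A. 1 / real (n choose card A)) \<le> 1" by (simp add: c[symmetric])
    qed
    also have "\<dots> = Suc n" using Suc by simp
    finally show ?thesis by (simp add: divide_right_mono del: of_nat_Suc)
  qed
qed

section \<open>Point probabilities of the binomial distribution\<close>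

lemma binomial_term_step:
  assumes "j < k"
  shows "real (k choose Suc j) * p ^ Suc j * q ^ (k - Suc j) * (real (Suc j) * q)
       = real (k choose j) * p ^ j * q ^ (k - j) * (real (k - j) * p)"
proof -
  have "real (Suc j) * real (k choose Suc j) = real (k - j) * real (k choose j)"
    using binomial_absorption[of j k] binomial_absorb_comp[of k j] by (metis of_nat_mult)
  moreover have "q ^ (k - j) = q * q ^ (k - Suc j)"
    using assms by (metis Suc_diff_Suc power_Suc)
  ultimately show ?thesis by (simp add: algebra_simps del: of_nat_Suc binomial_Suc_Suc)
qed

text \<open>From an index \<open>j\<close> below the mean, the next \<open>h\<close> terms lose at most a factor \<open>1 - 1 / (2 h)\<close> each.\<close>

lemma binomial_term_le_below_mean:
  fixes p q :: real
  assumes pq: "0 < p" "0 < q" "p + q = 1" and h: "1 \<le> h" "2 * real h ^ 2 \<le> k * p * q"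
    and j: "real j \<le> k * p"
  shows "real (k choose j) * p ^ j * q ^ (k - j) \<le> 2 / (real h + 1)"
proof -
  define b where "b j = real (k choose j) * p ^ j * q ^ (k - j)" for j
  have b0: "0 \<le> b j" for j unfolding b_def using pq by auto
  have q: "q = 1 - p" using pq by simp
  have "real k * p * q \<le> real k * q"
    using pq by (intro mult_right_mono mult_left_le) auto
  hence "2 * real h ^ 2 \<le> k * q" using h by linarith
  moreover have "real h \<le> real h ^ 2" using h by (simp add: power2_eq_square)
  ultimately have "real h \<le> k * q" by linarith
  moreover have "k * p + k * q = k" unfolding q by (simp add: algebra_simps)
  ultimately have "real (j + h) \<le> k" using j by simp
  hence jk: "j + h \<le> k" by (simp only: of_nat_le_iff)
  \<comment> \<open>The hypothesis on \<open>h\<close> keeps it below the standard deviation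
    \<open>sqrt (k p q)\<close>; over that range the ratio \<open>(k - i) p / ((i + 1) q)\<close> of
    consecutive terms stays close to one.\<close>
  have step: "(1 - 1 / (2 * real h)) * b (j + s) \<le> b (j + Suc s)" if s: "s < h" for s
  proof -
    have "(1 - 1 / (2 * real h)) * (real (j + s + 1) * q) \<le> real (k - (j + s)) * p"
    proof -
      let ?Y = "real (j + s + 1) * q" and ?X = "real k * p * q" and ?a = "real s + 1"
      have a: "?a \<le> h" using s by simp
      let ?Z = "?X + ?a * q"
      have "?Y \<le> (k * p + ?a) * q" using j pq by (intro mult_right_mono) auto
      hence YZ: "?Y \<le> ?Z" by (simp add: algebra_simps)
      have "2 * real h ^ 2 \<le> ?Z" using h pq a by (simp add: add_increasing2)
      hence Zh: "real h \<le> ?Z / (2 * real h)" using h(1) by (simp add: field_simps power2_eq_square)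
      have "(1 - 1 / (2 * real h)) * ?Y \<le> (1 - 1 / (2 * real h)) * ?Z"
        using YZ h(1) by (intro mult_left_mono) auto
      also have "\<dots> = ?Z - ?Z / (2 * real h)" by (simp only: left_diff_distrib mult_1 times_divide_eq_left)
      also have "\<dots> \<le> ?Z - ?a" using Zh a by linarith
      also have "\<dots> = ?X - ?a * p" by (simp add: q algebra_simps)
      also have "\<dots> \<le> ?X - s * p" using pq by (simp add: algebra_simps)
      also have "\<dots> = (k - k * p - s) * p" by (simp add: q algebra_simps)
      also have "\<dots> \<le> (real k - real (j + s)) * p" using j pq by (intro mult_right_mono) auto
      also have "\<dots> = real (k - (j + s)) * p" using jk s by (simp add: of_nat_diff)
      finally show ?thesis .
    qed
    from mult_left_mono[OF this b0[of "j + s"]]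
    have "(1 - 1 / (2 * real h)) * (b (j + s) * (real (j + s + 1) * q)) \<le> b (j + s) * (real (k - (j + s)) * p)"
      by (simp only: mult_ac)
    also have "\<dots> = b (j + Suc s) * (real (j + s + 1) * q)"
      using binomial_term_step[of "j + s" k p q] jk s unfolding b_def by (subst eq_commute) simp
    finally have "((1 - 1 / (2 * real h)) * b (j + s)) * (real (j + s + 1) * q) \<le> b (j + Suc s) * (real (j + s + 1) * q)"
      by (simp add: mult_ac)
    moreover have "(real (j + s + 1) * q) > 0" using pq by simp
    ultimately show ?thesis using mult_le_cancel_right by fastforce
  qed
  \<comment> \<open>Bernoulli's inequality in inductive form: at most \<open>h\<close> relative
    losses of \<open>1 / (2 h)\<close> cost one half in total.\<close>
  have half: "b j / 2 \<le> b (j + s)" if "s \<le> h" for s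
  proof -
    have "(1 - s / (2 * real h)) * b j \<le> b (j + s)"
      using that
    proof (induction s)
      case (Suc s)
      have "(1 - Suc s / (2 * real h)) \<le> (1 - 1 / (2 * real h)) * (1 - s / (2 * real h))"
        using h by (simp add: field_simps power2_eq_square)
      from mult_right_mono[OF this b0[of j]]
      have "(1 - Suc s / (2 * real h)) * b j \<le> (1 - 1 / (2 * real h)) * ((1 - s / (2 * real h)) * b j)"
        by (simp only: mult.assoc)
      also have "\<dots> \<le> (1 - 1 / (2 * real h)) * b (j + s)"
        using Suc h by (intro mult_left_mono) auto
      also have "\<dots> \<le> b (j + Suc s)" using step Suc by simp
      finally show ?case .
    qed simp
    moreover have "1 / 2 \<le> 1 - s / (2 * real h)" using that h by (simp add: field_simps)
    ultimately show ?thesis using mult_right_mono[OF _ b0[of j], of "1/2" "1 - s / (2 * real h)"] by linarith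
  qed
  \<comment> \<open>The \<open>h + 1\<close> terms starting at \<open>j\<close> are each at least
    \<open>b j / 2\<close>, and all terms together have mass one.\<close>
  have "(real h + 1) * (b j / 2) = (\<Sum>s\<in>{..h}. b j / 2)" by simp
  also have "\<dots> \<le> (\<Sum>s\<in>{..h}. b (j + s))" using half by (intro sum_mono) auto
  also have "\<dots> = (\<Sum>i\<in>(+) j ` {..h}. b i)" by (subst sum.reindex) auto
  also have "\<dots> \<le> (\<Sum>i\<le>k. b i)" using jk b0 by (intro sum_mono2) auto
  also have "\<dots> = (p + q) ^ k" unfolding b_def by (simp add: binomial_ring)
  finally show ?thesis using pq unfolding b_def by (simp add: field_simps)
qed

text \<open>Exchanging successes and failures sends an index above the mean to \<open>k - j\<close>,
  below the mean \<open>k * q\<close>; the condition on \<open>h\<close> is symmetric in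
  \<open>p\<close> and \<open>q\<close>.\<close>

lemma binomial_term_le:
  fixes p q :: real
  assumes pq: "0 < p" "0 < q" "p + q = 1" and h: "1 \<le> h" "2 * real h ^ 2 \<le> k * p * q" and "j \<le> k"
  shows "real (k choose j) * p ^ j * q ^ (k - j) \<le> 2 / (real h + 1)"
proof (cases "real j \<le> k * p")
  case True
  thus ?thesis using binomial_term_le_below_mean assms by blast
next
  case False
  have q: "q = 1 - p" using pq by simp
  have "k * q = k - k * p" unfolding q by (simp add: algebra_simps)
  hence "real (k - j) \<le> k * q" using False assms by (simp add: of_nat_diff)
  from binomial_term_le_below_mean[OF pq(2,1) _ h(1) _ this] show ?thesis
    using assms binomial_symmetric[of j k] by (simp add: mult_ac add_ac)
qed

text \<open>A set of size \<open>j\<close> has as its probability the binomial term divided by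
  \<open>card I choose j\<close>, hence at most \<open>b / (card I choose j)\<close>. Over an
  antichain the reciprocals of these coefficients sum to at most one, so a bias of the coins enters
  only through \<open>b\<close>.\<close>

lemma prob_coins_antichain_le:
  fixes p :: real
  assumes "finite I" "F \<subseteq> Pow I" and anti: "\<And>A B. A \<in> F \<Longrightarrow> B \<in> F \<Longrightarrow> A \<subseteq> B \<Longrightarrow> A = B"
    and p: "0 \<le> p" "p \<le> 1"
    and b: "\<And>j. j \<le> card I \<Longrightarrow> real (card I choose j) * p ^ j * (1 - p) ^ (card I - j) \<le> b"
  shows "measure_pmf.prob (coins p I) {f. {i\<in>I. f i} \<in> F} \<le> b"
proof -
  let ?k = "card I"
  have finF: "finite F" using assms(1,2) by (meson finite_Pow_iff finite_subset)
  have b0: "0 \<le> b" using b[of 0] p by (simp add: order_trans[rotated])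
  have "{f. {i\<in>I. f i} \<in> F} = (\<Union>A\<in>F. {f. \<forall>i\<in>I. f i \<longleftrightarrow> i \<in> A})" (is "_ = (\<Union>A\<in>F. ?X A)")
  proof (intro equalityI subsetI)
    fix f assume "f \<in> {f. {i\<in>I. f i} \<in> F}"
    moreover have "f \<in> ?X {i\<in>I. f i}" by auto
    ultimately show "f \<in> (\<Union>A\<in>F. ?X A)" by blast
  next
    fix f assume "f \<in> (\<Union>A\<in>F. ?X A)"
    then obtain A where A: "A \<in> F" "\<forall>i\<in>I. f i \<longleftrightarrow> i \<in> A" by blast
    hence "{i\<in>I. f i} = A" using assms(2) by blast
    thus "f \<in> {f. {i\<in>I. f i} \<in> F}" using A by simp
  qed
  hence "measure_pmf.prob (coins p I) {f. {i\<in>I. f i} \<in> F} \<le> (\<Sum>A\<in>F. measure_pmf.prob (coins p I) (?X A))"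
    using finF measure_pmf.finite_measure_subadditive_finite[of F ?X "coins p I"] by simp
  also have "\<dots> = (\<Sum>A\<in>F. p ^ card A * (1 - p) ^ (?k - card A))"
    using assms(2) by (intro sum.cong prob_coins_eq assms) auto
  also have "\<dots> \<le> (\<Sum>A\<in>F. b * (1 / real (?k choose card A)))"
  proof (intro sum_mono)
    fix A assume "A \<in> F"
    hence "card A \<le> ?k" using assms by (intro card_mono) auto
    hence "real (?k choose card A) > 0" "real (?k choose card A) * p ^ card A * (1 - p) ^ (?k - card A) \<le> b"
      using b by auto
    thus "p ^ card A * (1 - p) ^ (?k - card A) \<le> b * (1 / real (?k choose card A))"
      by (simp add: field_simps)
  qed
  also have "\<dots> = b * (\<Sum>A\<in>F. 1 / real (?k choose card A))" by (simp add: sum_distrib_left)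
  also have "\<dots> \<le> b" using lubell_yamamoto_meshalkin[OF assms(1,2) anti] b0 by (simp add: mult_left_le)
  finally show ?thesis .
qed

text \<open>Two nested index sets with equal sums differ by a set of total weight zero, which is
  empty when all weights have the same sign.\<close>

lemma prob_coins_sum_eq_le_one_sign:
  fixes p :: real and w :: "'a \<Rightarrow> real"
  assumes "finite I" and w: "(\<forall>i\<in>I. 0 < w i) \<or> (\<forall>i\<in>I. w i < 0)"
    and p: "0 \<le> p" "p \<le> 1"
    and b: "\<And>j. j \<le> card I \<Longrightarrow> real (card I choose j) * p ^ j * (1 - p) ^ (card I - j) \<le> b"
  shows "measure_pmf.prob (coins p I) {f. (\<Sum>i\<in>I. if f i then w i else 0) = c} \<le> b"
proof -
  let ?F = "{A. A \<subseteq> I \<and> sum w A = c}"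
  have "(\<Sum>i\<in>I. if f i then w i else 0) = sum w {i\<in>I. f i}" for f
    using assms(1) by (simp add: sum.inter_filter)
  hence "{f. (\<Sum>i\<in>I. if f i then w i else 0) = c} = {f. {i\<in>I. f i} \<in> ?F}" by auto
  also have "measure_pmf.prob (coins p I) \<dots> \<le> b"
  proof (rule prob_coins_antichain_le)
    fix A B assume AB: "A \<in> ?F" "B \<in> ?F" "A \<subseteq> B"
    have fin: "finite B" using AB assms finite_subset by blast
    hence "sum w B = sum w (B - A) + sum w A" using AB(3) by (intro sum.subset_diff) auto
    hence 0: "sum w (B - A) = 0" using AB by simp
    show "A = B"
    proof (rule ccontr)
      assume "A \<noteq> B"
      hence ne: "B - A \<noteq> {}" using AB by blast
      have "sum w (B - A) > 0 \<or> sum (\<lambda>i. - w i) (B - A) > 0"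
      proof (cases "\<forall>i\<in>I. 0 < w i")
        case True
        hence "sum w (B - A) > 0" using AB fin ne by (intro sum_pos) auto
        thus ?thesis ..
      next
        case False
        hence "sum (\<lambda>i. - w i) (B - A) > 0" using AB fin ne w by (intro sum_pos) auto
        thus ?thesis ..
      qed
      thus False using 0 by (simp add: sum_negf)
    qed
  qed (use assms in auto)
  finally show ?thesis .
qed

text \<open>Weights of one sign make the level sets antichains, and one of the two signs carries at least half
  of the nonzero weights.\<close>

lemma littlewood_offord:
  assumes "0 < \<eta>"
  obtains K :: real where "0 < K"
    "\<And>(I :: 'a set) w c (p :: real). finite I \<Longrightarrow> 0 < p \<Longrightarrow> p \<le> 1 / 2 \<Longrightarrow> K \<le> real (card {i\<in>I. w i \<noteq> (0::real)}) * p \<Longrightarrow>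
       measure_pmf.prob (coins p I) {f. (\<Sum>i\<in>I. if f i then w i else 0) = c} \<le> \<eta>"
proof -
  obtain h0 :: nat where h0: "2 / \<eta> < h0" using reals_Archimedean2 by blast
  define h where "h = max 1 h0"
  have h: "1 \<le> h" "2 / \<eta> \<le> real h" using h0 unfolding h_def by auto
  have "2 \<le> real h * \<eta>" using h(2) assms by (simp add: field_simps)
  hence "2 \<le> (real h + 1) * \<eta>" using assms by (simp add: algebra_simps)
  hence h_eta: "2 / (real h + 1) \<le> \<eta>" by (simp add: field_simps)
  show ?thesis
  \<comment> \<open>One factor two pays for keeping the weights of one sign, one for
    \<open>1 - p \<ge> 1 / 2\<close>, and one is demanded by the binomial estimate.\<close>
  proof (rule that[of "8 * real h ^ 2"])
    show "0 < 8 * real h ^ 2" using h by simp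
  next
    fix I :: "'a set" and w :: "'a \<Rightarrow> real" and c p :: real
    assume I: "finite I" and p: "0 < p" "p \<le> 1 / 2" and K: "8 * real h ^ 2 \<le> card {i\<in>I. w i \<noteq> 0} * p"
    let ?P = "{i\<in>I. 0 < w i}" and ?N = "{i\<in>I. w i < 0}"
    have "{i\<in>I. w i \<noteq> 0} = ?P \<union> ?N" by auto
    hence le: "card {i\<in>I. w i \<noteq> 0} \<le> card ?P + card ?N" using card_Un_le[of ?P ?N] by simp
    define J where "J = (if card ?P \<le> card ?N then ?N else ?P)"
    have J: "J = ?P \<or> J = ?N" "card {i\<in>I. w i \<noteq> 0} \<le> 2 * card J"
      using le by (simp_all add: J_def)
    have JI: "J \<subseteq> I" "finite J" using J I by auto
    have "8 * real h ^ 2 \<le> (2 * real (card J)) * p"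
      using K J(2) p mult_right_mono[of "real (card {i\<in>I. w i \<noteq> 0})" "2 * real (card J)" p] by linarith
    moreover have "card J * p * (1 / 2) \<le> card J * p * (1 - p)" using p by (intro mult_left_mono) auto
    ultimately have kp: "2 * real h ^ 2 \<le> card J * p * (1 - p)" by linarith
    \<comment> \<open>Conditioning on the coins outside \<open>J\<close> merely shifts the target
      \<open>c\<close>. The trivial first event fits this to the conditioning lemma.\<close>
    have "measure_pmf.prob (coins p I) {f. True \<and> (\<Sum>i\<in>I. if f i then w i else 0) = c}
        \<le> measure_pmf.prob (coins p I) {f. True} * \<eta>"
    proof (rule prob_coins_conj_le[OF I JI(1)])
      fix f :: "'a \<Rightarrow> bool"
      have "(\<Sum>i\<in>I. if override_on f g J i then w i else 0)
          = (\<Sum>i\<in>J. if g i then w i else 0) + (\<Sum>i\<in>I - J. if f i then w i else 0)" for g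
        using I JI by (subst sum.subset_diff[of J I]) (auto simp: override_on_def intro!: sum.cong)
      hence "{g. (\<Sum>i\<in>I. if override_on f g J i then w i else 0) = c}
          = {g. (\<Sum>i\<in>J. if g i then w i else 0) = c - (\<Sum>i\<in>I - J. if f i then w i else 0)}" by auto
      also have "measure_pmf.prob (coins p J) \<dots> \<le> 2 / (real h + 1)"
        using JI J p kp h by (intro prob_coins_sum_eq_le_one_sign binomial_term_le) auto
      finally show "measure_pmf.prob (coins p J) {g. (\<Sum>i\<in>I. if override_on f g J i then w i else 0) = c} \<le> \<eta>"
        using h_eta by simp
    qed simp
    thus "measure_pmf.prob (coins p I) {f. (\<Sum>i\<in>I. if f i then w i else 0) = c} \<le> \<eta>" by simp
  qed
qed

section \<open>Minimal dependencies and trees\<close>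

text \<open>Gaussian elimination by columns: each step spends a pivot row \<open>i0\<close> and an
  unknown \<open>j0\<close>, so no more rows than unknowns are collected. An explicit set of rows,
  rather than a rank, is what a later union bound can range over.\<close>

lemma finite_rows_same_kernel:
  fixes a :: "'r \<Rightarrow> 'c \<Rightarrow> real"
  assumes "finite S"
  shows "\<exists>R\<subseteq>I. finite R \<and> card R \<le> card S \<and>
    (\<forall>w. (\<forall>i\<in>R. (\<Sum>j\<in>S. a i j * w j) = 0) \<longrightarrow> (\<forall>i\<in>I. (\<Sum>j\<in>S. a i j * w j) = 0))"
  using assms
proof (induction S arbitrary: a rule: finite_induct)
  case empty
  show ?case by (intro exI[of _ "{}"]) auto
next
  case (insert j0 S)
  show ?case
  proof (cases "\<forall>i\<in>I. a i j0 = 0")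
    case True
    obtain R where "R \<subseteq> I" "finite R" "card R \<le> card S"
      "\<forall>w. (\<forall>i\<in>R. (\<Sum>j\<in>S. a i j * w j) = 0) \<longrightarrow> (\<forall>i\<in>I. (\<Sum>j\<in>S. a i j * w j) = 0)"
      using insert.IH[of a] by blast
    thus ?thesis using insert.hyps True by (intro exI[of _ R]) (auto simp: subset_iff)
  next
    case False
    then obtain i0 where i0: "i0 \<in> I" "a i0 j0 \<noteq> 0" by blast
    define a' where "a' i j = a i j - a i j0 / a i0 j0 * a i0 j" for i j
    obtain R where R: "R \<subseteq> I" "finite R" "card R \<le> card S"
      "\<forall>w. (\<forall>i\<in>R. (\<Sum>j\<in>S. a' i j * w j) = 0) \<longrightarrow> (\<forall>i\<in>I. (\<Sum>j\<in>S. a' i j * w j) = 0)"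
      using insert.IH[of a'] by blast
    \<comment> \<open>On vectors that satisfy the pivot equation, eliminating \<open>j0\<close>
      changes no row sum.\<close>
    have key: "(\<Sum>j\<in>S. a' i j * w j) = (\<Sum>j\<in>insert j0 S. a i j * w j)"
      if "(\<Sum>j\<in>insert j0 S. a i0 j * w j) = 0" for w i
    proof -
      have *: "(\<Sum>j\<in>S. a i0 j * w j) = - a i0 j0 * w j0" using that insert.hyps by simp
      have "(\<Sum>j\<in>S. a' i j * w j) = (\<Sum>j\<in>S. a i j * w j) - a i j0 / a i0 j0 * (\<Sum>j\<in>S. a i0 j * w j)"
        by (simp add: a'_def left_diff_distrib sum_subtractf sum_distrib_left mult.assoc)
      thus ?thesis unfolding * using i0 insert.hyps by simp
    qed
    show ?thesis
    proof (intro exI[of _ "insert i0 R"] conjI allI impI)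
      show "card (insert i0 R) \<le> card (insert j0 S)"
        using R insert.hyps card_insert_le_m1[of "card (insert j0 S)" R i0] by (simp add: card_insert_if)
      fix w assume w: "\<forall>i\<in>insert i0 R. (\<Sum>j\<in>insert j0 S. a i j * w j) = 0"
      show "\<forall>i\<in>I. (\<Sum>j\<in>insert j0 S. a i j * w j) = 0"
      proof -
        have e: "(\<Sum>j\<in>insert j0 S. a i0 j * w j) = 0" using w by blast
        have "\<forall>i\<in>R. (\<Sum>j\<in>S. a' i j * w j) = 0" unfolding key[OF e] using w by blast
        hence "\<forall>i\<in>I. (\<Sum>j\<in>S. a' i j * w j) = 0" using R(4) by blast
        thus ?thesis unfolding key[OF e] .
      qed
    qed (use R i0 in auto)
  qed
qed

lemma nontrivial_kernel:
  fixes a :: "'r \<Rightarrow> 'c \<Rightarrow> real"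
  assumes "finite R" "finite S" "card R < card S"
  shows "\<exists>y. (\<exists>j\<in>S. y j \<noteq> 0) \<and> (\<forall>i\<in>R. (\<Sum>j\<in>S. a i j * y j) = 0)"
  using assms
proof (induction R arbitrary: S a rule: finite_induct)
  case empty
  hence "S \<noteq> {}" by auto
  thus ?case by (intro exI[of _ "\<lambda>_. 1"]) auto
next
  case (insert i0 R)
  show ?case
  proof (cases "\<forall>j\<in>S. a i0 j = 0")
    case True
    obtain y where "(\<exists>j\<in>S. y j \<noteq> 0) \<and> (\<forall>i\<in>R. (\<Sum>j\<in>S. a i j * y j) = 0)"
      using insert.IH[of S a] insert.prems insert.hyps by auto
    thus ?thesis using True by (intro exI[of _ y]) auto
  next
    case False
    then obtain j0 where j0: "j0 \<in> S" "a i0 j0 \<noteq> 0" by blast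
    let ?S = "S - {j0}"
    define a' where "a' i j = a i j - a i j0 / a i0 j0 * a i0 j" for i j
    have "card R < card ?S" using insert.prems insert.hyps j0 by simp
    from insert.IH[OF _ this, of a'] insert.prems
    obtain y where y: "\<exists>j\<in>?S. y j \<noteq> 0" "\<forall>i\<in>R. (\<Sum>j\<in>?S. a' i j * y j) = 0" by auto
    define z where "z = y(j0 := - (\<Sum>j\<in>?S. a i0 j * y j) / a i0 j0)"
    have z: "(\<Sum>j\<in>S. a i j * z j) = a i j0 * z j0 + (\<Sum>j\<in>?S. a i j * y j)" for i
      using insert.prems j0 by (subst sum.remove[of S j0]) (auto simp: z_def)
    have "(\<Sum>j\<in>?S. a' i j * y j) = (\<Sum>j\<in>?S. a i j * y j) - a i j0 / a i0 j0 * (\<Sum>j\<in>?S. a i0 j * y j)" for i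
      by (simp add: a'_def left_diff_distrib sum_subtractf sum_distrib_left mult.assoc)
    hence "\<forall>i\<in>insert i0 R. (\<Sum>j\<in>S. a i j * z j) = 0"
      using y j0 by (auto simp: z) (simp_all add: z_def)
    moreover have "\<exists>j\<in>S. z j \<noteq> 0" using y by (auto simp: z_def)
    ultimately show ?thesis by blast
  qed
qed

text \<open>Setting one unknown to zero costs one dimension. Where the kernel is spanned by a vector
  without zero entries, a nonzero solution with a zero entry is a contradiction.\<close>

lemma nontrivial_kernel_vanishing:
  fixes a :: "'r \<Rightarrow> 'c \<Rightarrow> real"
  assumes "finite R" "finite S" "card R + 1 < card S"
  shows "\<exists>y. (\<exists>j\<in>S. y j \<noteq> 0) \<and> y j0 = 0 \<and> (\<forall>i\<in>R. (\<Sum>j\<in>S. a i j * y j) = 0)"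
proof -
  have "card (S - {j0}) \<ge> card S - 1" using assms(2) by (simp add: card_Diff_singleton_if)
  hence "card R < card (S - {j0})" using assms(3) by simp
  then obtain y where y: "\<exists>j\<in>S - {j0}. y j \<noteq> 0" "\<forall>i\<in>R. (\<Sum>j\<in>S - {j0}. a i j * y j) = 0"
    using nontrivial_kernel[of R "S - {j0}" a] assms by blast
  have "(\<Sum>j\<in>S. a i j * (y(j0 := 0)) j) = (\<Sum>j\<in>S - {j0}. a i j * y j)" for i
    using assms(2) by (cases "j0 \<in> S") (auto simp: sum.remove intro!: sum.cong)
  thus ?thesis using y by (intro exI[of _ "y(j0 := 0)"]) auto
qed

text \<open>Rank \<open>k - 1\<close> means a kernel of dimension one, used in the form that every
  kernel vector is a multiple of \<open>x\<close>. A maximal independent set of columns leaves out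
  one index \<open>j0\<close>; a kernel vector vanishing at \<open>j0\<close> is zero, and
  subtracting the multiple of \<open>x\<close> that agrees at \<open>j0\<close> reduces to this
  case.\<close>

lemma minimal_dependency_kernel:
  assumes "minimal_dependency M"
  obtains x where "1 \<le> dim_col M" "\<And>j. j < dim_col M \<Longrightarrow> x j \<noteq> (0::real)"
    "\<And>i. i < dim_row M \<Longrightarrow> (\<Sum>j<dim_col M. M $$ (i, j) * x j) = 0"
    "\<And>y. (\<And>i. i < dim_row M \<Longrightarrow> (\<Sum>j<dim_col M. M $$ (i, j) * y j) = 0) \<Longrightarrow>
       \<exists>c. \<forall>j<dim_col M. y j = c * x j"
proof -
  let ?n = "dim_row M" and ?k = "dim_col M"
  interpret vec_space "TYPE(real)" ?n .
  obtain xv where xv: "xv \<in> carrier_vec ?k" "M *\<^sub>v xv = 0\<^sub>v ?n" "\<forall>j<?k. xv $ j \<noteq> 0"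
    and rk: "rank M + 1 = ?k"
    using assms unfolding minimal_dependency_def by auto
  have M: "M \<in> carrier_mat ?n ?k" by simp
  obtain U where U: "maximal U (\<lambda>T. T \<subseteq> set (cols M) \<and> lin_indpt T)"
    using maximal_exists[of "(\<lambda>T. T \<subseteq> set (cols M) \<and> lin_indpt T)" "card (set (cols M))" "{}"]
    by (meson List.finite_set card_mono empty_iff empty_subsetI finite_lin_indpt2 rev_finite_subset)
  have cU: "card U + 1 = ?k" using rank_card_indpt[OF M U] rk by simp
  have Uc: "U \<subseteq> set (cols M)" and Ui: "lin_indpt U" using U unfolding maximal_def by auto
  have finU: "finite U" using Uc finite_subset by blast
  have "\<forall>u\<in>U. \<exists>j<?k. col M j = u"
    using Uc by (metis cols_length cols_nth in_set_conv_nth subsetD)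
  \<comment> \<open>The rank speaks of a set of column vectors; \<open>g\<close> selects one index
    for each of them.\<close>
  then obtain g where g: "\<forall>u\<in>U. g u < ?k \<and> col M (g u) = u" by metis
  have inj: "inj_on g U" using g by (metis inj_onI)
  have "card ({..<?k} - g ` U) = 1"
    using g inj finU cU by (subst card_Diff_subset) (auto simp: card_image)
  then obtain j0 where j0: "{..<?k} - g ` U = {j0}" using card_1_singletonE by blast
  hence ks: "{..<?k} = insert j0 (g ` U)" "j0 \<notin> g ` U" "j0 < ?k" using g by auto
  have zero: "\<forall>j<?k. y j = 0" if y: "\<And>i. i < ?n \<Longrightarrow> (\<Sum>j<?k. M $$ (i, j) * y j) = 0" "y j0 = 0" for y
  proof -
    have Ucv: "U \<subseteq> carrier_vec ?n" using Uc cols_dim by blast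
    have "lincomb (\<lambda>u. y (g u)) U = 0\<^sub>v ?n"
    proof (rule eq_vecI)
      fix i assume "i < dim_vec (0\<^sub>v ?n :: real vec)"
      hence i: "i < ?n" by simp
      have "lincomb (\<lambda>u. y (g u)) U $ i = (\<Sum>u\<in>U. y (g u) * u $ i)"
        using lincomb_index[OF i Ucv] by simp
      also have "\<dots> = (\<Sum>u\<in>U. M $$ (i, g u) * y (g u))"
        using g i by (intro sum.cong) (auto simp: mult.commute, metis index_col mult.commute)
      also have "\<dots> = (\<Sum>j\<in>g ` U. M $$ (i, j) * y j)" using inj by (simp add: sum.reindex)
      also have "\<dots> = (\<Sum>j<?k. M $$ (i, j) * y j)" using ks finU y(2) by simp
      finally show "lincomb (\<lambda>u. y (g u)) U $ i = 0\<^sub>v ?n $ i" using y(1) i by simp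
    next
      show "dim_vec (lincomb (\<lambda>u. y (g u)) U) = dim_vec (0\<^sub>v ?n :: real vec)"
        using Ucv finU lincomb_dim by simp
    qed
    hence "(\<lambda>u. y (g u)) \<in> U \<rightarrow> {0}"
      using not_lindepD[OF Ui finU subset_refl, of "\<lambda>u. y (g u)"] by (auto simp: class_ring_simps)
    hence "\<forall>u\<in>U. y (g u) = 0" by auto
    thus ?thesis using ks y(2) by (metis imageE insertE lessThan_iff)
  qed
  show ?thesis
  proof (rule that[of "\<lambda>j. xv $ j"])
    show "1 \<le> ?k" using rk by simp
    show xv0: "(\<Sum>j<?k. M $$ (i, j) * xv $ j) = 0" if "i < ?n" for i
    proof -
      have "(M *\<^sub>v xv) $ i = (\<Sum>j<?k. M $$ (i, j) * xv $ j)"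
        using that xv(1) by (auto simp: scalar_prod_def atLeast0LessThan intro!: sum.cong)
      thus ?thesis using xv(2) that by simp
    qed
    fix y assume y: "\<And>i. i < ?n \<Longrightarrow> (\<Sum>j<?k. M $$ (i, j) * y j) = 0"
    let ?c = "y j0 / xv $ j0"
    have "\<forall>j<?k. y j - ?c * xv $ j = 0"
    proof (rule zero)
      show "y j0 - ?c * xv $ j0 = 0" using xv(3) ks by simp
      show "(\<Sum>j<?k. M $$ (i, j) * (y j - ?c * xv $ j)) = 0" if "i < ?n" for i
      proof -
        have "(\<Sum>j<?k. M $$ (i, j) * (y j - ?c * xv $ j))
            = (\<Sum>j<?k. M $$ (i, j) * y j) - ?c * (\<Sum>j<?k. M $$ (i, j) * xv $ j)"
          by (simp add: right_diff_distrib sum_subtractf sum_distrib_left mult_ac)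
        thus ?thesis using y xv0 that by simp
      qed
    qed
    thus "\<exists>c. \<forall>j<?k. y j = c * xv $ j" by (intro exI[of _ ?c]) auto
  qed (use xv in auto)
qed

text \<open>Every edge says that \<open>x\<close> takes opposite values at its ends. The number of
  equations equals the codimension of the solution space, so none is redundant; a repeated edge or
  the closing edge of a cycle would be, and a second component could be scaled on its own.\<close>

lemma tree_of_unique_kernel:
  fixes e :: "'r \<Rightarrow> nat set" and x :: "nat \<Rightarrow> real"
  assumes fin: "finite T" and T: "card T + 1 = k"
    and e: "\<And>i. i \<in> T \<Longrightarrow> e i \<subseteq> {..<k}" "\<And>i. i \<in> T \<Longrightarrow> card (e i) = 2"
    and x: "\<And>j. j < k \<Longrightarrow> x j \<noteq> 0" "\<And>i. i \<in> T \<Longrightarrow> (\<Sum>j\<in>e i. x j) = 0"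
    and uniq: "\<And>y. (\<And>i. i \<in> T \<Longrightarrow> (\<Sum>j\<in>e i. y j) = 0) \<Longrightarrow> \<exists>c. \<forall>j<k. y j = c * x j"
  shows "inj_on e T" "is_tree {..<k} (e ` T)"
proof -
  have k: "0 < k" using T by simp
  \<comment> \<open>Without \<open>i0\<close> only \<open>k - 2\<close> equations remain, so some
    nonzero solution vanishes at vertex 0. It is not a multiple of \<open>x\<close> and must violate
    the equation of \<open>i0\<close>.\<close>
  have irred: "\<exists>y::nat \<Rightarrow> real. (\<forall>i\<in>T - {i0}. (\<Sum>j\<in>e i. y j) = 0) \<and> (\<Sum>j\<in>e i0. y j) \<noteq> 0"
    if i0: "i0 \<in> T" for i0
  proof (rule ccontr)
    assume neg: "\<not> ?thesis"
    have s: "(\<Sum>j<k. of_bool (j \<in> e i) * y j) = (\<Sum>j\<in>e i. y j)" if "i \<in> T" for i and y :: "nat \<Rightarrow> real"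
    proof -
      have "(\<Sum>j\<in>e i. y j) = (\<Sum>j\<in>{..<k} \<inter> e i. y j)" using e(1)[OF that] by (simp add: Int_absorb1)
      also have "\<dots> = (\<Sum>j<k. if j \<in> e i then y j else 0)" by (rule sum.inter_restrict) simp
      also have "\<dots> = (\<Sum>j<k. of_bool (j \<in> e i) * y j)" by (intro sum.cong) auto
      finally show ?thesis by simp
    qed
    have "card T \<noteq> 0" using i0 fin by auto
    moreover have "card (T - {i0}) = card T - 1" using i0 fin by simp
    ultimately have "card (T - {i0}) + 1 < card {..<k}" using T by simp
    hence "\<exists>y::nat \<Rightarrow> real. (\<exists>j\<in>{..<k}. y j \<noteq> 0) \<and> y 0 = 0 \<and>
        (\<forall>i\<in>T - {i0}. (\<Sum>j\<in>{..<k}. of_bool (j \<in> e i) * y j) = 0)"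
      by (intro nontrivial_kernel_vanishing finite_Diff fin finite_lessThan)
    then obtain y :: "nat \<Rightarrow> real" where y: "\<exists>j\<in>{..<k}. y j \<noteq> 0" "y 0 = 0"
        "\<forall>i\<in>T - {i0}. (\<Sum>j\<in>{..<k}. of_bool (j \<in> e i) * y j) = 0"
      by (elim exE conjE)
    have *: "\<forall>i\<in>T - {i0}. (\<Sum>j\<in>e i. y j) = 0"
    proof
      fix i assume i: "i \<in> T - {i0}"
      hence "(\<Sum>j<k. of_bool (j \<in> e i) * y j) = 0" using y(3) by blast
      thus "(\<Sum>j\<in>e i. y j) = 0" using i by (subst (asm) s) auto
    qed
    hence "(\<Sum>j\<in>e i0. y j) = 0" using neg by blast
    with * have "\<And>i. i \<in> T \<Longrightarrow> (\<Sum>j\<in>e i. y j) = 0" by blast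
    then obtain c where c: "\<forall>j<k. y j = c * x j" using uniq by blast
    hence "c * x 0 = 0" using y(2) k by metis
    hence "c = 0" using x(1) k by simp
    thus False using y(1) c by simp
  qed
  show inj: "inj_on e T"
  proof (rule inj_onI, rule ccontr)
    fix i i' assume i: "i \<in> T" "i' \<in> T" "e i = e i'" "i \<noteq> i'"
    thus False using irred[OF i(1)] by (metis DiffI singletonD)
  qed
  have pair: "\<exists>u v. u \<noteq> v \<and> u < k \<and> v < k \<and> e i = {u, v}" if i: "i \<in> T" for i
  proof -
    obtain u v where "e i = {u, v}" "u \<noteq> v" using e(2)[OF i] unfolding card_2_iff by blast
    thus ?thesis using e(1)[OF i] by auto
  qed
  have edge_sum: "z u + z v = 0" if "i \<in> T" "e i = {u, v}" "(\<Sum>j\<in>e i. z j) = 0" for i u v and z :: "nat \<Rightarrow> real"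
  proof -
    have "u \<noteq> v" using e(2)[OF that(1)] that(2) by auto
    thus ?thesis using that by simp
  qed
  let ?E = "e ` T"
  have "simple_graph {..<k} ?E" using e unfolding simple_graph_def by auto
  moreover have "connected_graph {..<k} ?E"
    unfolding connected_graph_def
  proof (intro conjI ballI)
    show "{..<k} \<noteq> {}" using k by auto
    fix u v assume uv: "u \<in> {..<k}" "v \<in> {..<k}"
    let ?R = "{(x, y). {x, y} \<in> ?E}"
    \<comment> \<open>Cutting \<open>x\<close> down to the component of \<open>u\<close> preserves
      all equations. The result is a multiple of \<open>x\<close> that agrees with \<open>x\<close>
      at \<open>u\<close>, so the component is everything.\<close>
    define y where "y w = (if (u, w) \<in> ?R\<^sup>* then x w else 0)" for w
    have "(\<Sum>j\<in>e i. y j) = 0" if i: "i \<in> T" for i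
    proof -
      obtain a b where ab: "a \<noteq> b" "e i = {a, b}" using pair[OF i] by blast
      have "{a, b} \<in> ?E" using ab i by (metis imageI)
      hence "(a, b) \<in> ?R" "(b, a) \<in> ?R" by (auto simp: insert_commute)
      hence "(u, a) \<in> ?R\<^sup>* \<longleftrightarrow> (u, b) \<in> ?R\<^sup>*" by (meson rtrancl.rtrancl_into_rtrancl)
      moreover have "x a + x b = 0" using edge_sum[OF i ab(2) x(2)[OF i]] .
      ultimately show ?thesis using ab by (simp add: y_def)
    qed
    then obtain c where c: "\<forall>j<k. y j = c * x j" using uniq by blast
    have "y u = x u" by (simp add: y_def)
    hence "c = 1" using c uv x(1) by (metis lessThan_iff mult_cancel_right1)
    hence "y v \<noteq> 0" using c uv x(1) by simp
    thus "(u, v) \<in> ?R\<^sup>*" unfolding y_def by meson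
  qed
  moreover have "\<nexists>c. graph_cycle ?E c"
  proof
    assume "\<exists>c. graph_cycle ?E c"
    then obtain c where L: "length c \<ge> 3" and dc: "distinct c"
      and ce: "\<And>i. i < length c \<Longrightarrow> {c ! i, c ! (Suc i mod length c)} \<in> ?E"
      unfolding graph_cycle_def by blast
    let ?l = "length c - 1"
    have "Suc ?l = length c" using L by linarith
    hence "Suc ?l mod length c = 0" by simp
    hence "{c ! ?l, c ! 0} \<in> ?E" using ce[of ?l] L by simp
    then obtain i0 where i0: "i0 \<in> T" "e i0 = {c ! ?l, c ! 0}" by (metis imageE)
    obtain y where y: "\<forall>i\<in>T - {i0}. (\<Sum>j\<in>e i. y j) = 0" "(\<Sum>j\<in>e i0. y j) \<noteq> (0::real)"
      using irred[OF i0(1)] by blast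
    \<comment> \<open>Along the cycle both \<open>x\<close> and \<open>y\<close> alternate in sign,
      so they are proportional there; the closing edge holds for \<open>x\<close> and hence for
      \<open>y\<close>, against the choice of \<open>y\<close>.\<close>
    have yx: "y (c ! m) * x (c ! 0) = x (c ! m) * y (c ! 0)" if "m < length c" for m
      using that
    proof (induction m)
      case (Suc m)
      have "{c ! m, c ! Suc m} \<in> ?E" using ce[of m] Suc.prems by simp
      then obtain i where i: "i \<in> T" "e i = {c ! m, c ! Suc m}" by (metis imageE)
      have "{c ! m, c ! Suc m} \<noteq> {c ! ?l, c ! 0}"
      proof
        assume "{c ! m, c ! Suc m} = {c ! ?l, c ! 0}"
        hence "c ! m = c ! ?l \<or> c ! m = c ! 0 \<and> c ! Suc m = c ! ?l" by (auto simp: doubleton_eq_iff)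
        hence "m = ?l \<or> m = 0 \<and> Suc m = ?l"
        proof -
          have "0 < length c" "?l < length c" "m < length c" using L Suc.prems by linarith+
          thus ?thesis
            using \<open>c ! m = c ! ?l \<or> _\<close> dc Suc.prems nth_eq_iff_index_eq by metis
        qed
        thus False using Suc.prems L by auto
      qed
      hence "i \<in> T - {i0}" using i i0 by auto
      hence "y (c ! m) + y (c ! Suc m) = 0" "x (c ! m) + x (c ! Suc m) = 0"
        using edge_sum[OF i, of y] edge_sum[OF i, of x] y(1) x(2)[OF i(1)] by blast+
      hence *: "y (c ! Suc m) = - y (c ! m)" "x (c ! Suc m) = - x (c ! m)" by auto
      show ?case unfolding * using Suc by simp
    qed simp
    have "x (c ! ?l) + x (c ! 0) = 0" using edge_sum[OF i0 x(2)[OF i0(1)]] .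
    hence "x (c ! ?l) = - x (c ! 0)" by simp
    hence "y (c ! ?l) * x (c ! 0) = - x (c ! 0) * y (c ! 0)" using yx[of ?l] L by auto
    hence "(y (c ! ?l) + y (c ! 0)) * x (c ! 0) = 0" by (simp add: algebra_simps)
    moreover have "c ! 0 < k" using e(1)[OF i0(1)] i0(2) by auto
    ultimately have "y (c ! ?l) + y (c ! 0) = 0" using x(1) by simp
    moreover have "c ! ?l \<noteq> c ! 0" using e(2)[OF i0(1)] i0(2) by auto
    ultimately show False using y(2) i0(2) by simp
  qed
  ultimately show "is_tree {..<k} ?E" unfolding is_tree_def by blast
qed

text \<open>A row with one entry would force a zero of \<open>x\<close>, and a kernel of dimension
  one takes at least \<open>k - 1\<close> nonzero rows. Each of these has at least two entries, so
  at most \<open>2 k - 2\<close> entries in total leave only \<open>k - 1\<close> rows with two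
  entries each, which are edges.\<close>

lemma minimal_dependency_tree_or_dense:
  fixes M :: "real mat"
  defines "deg i \<equiv> card {j. j < dim_col M \<and> M $$ (i, j) = 1}"
  assumes dep: "minimal_dependency M" and bin: "elements_mat M \<subseteq> {0, 1}"
  shows "\<And>i. i < dim_row M \<Longrightarrow> deg i \<noteq> 1"
    and "dim_col M \<le> card {i. i < dim_row M \<and> deg i \<noteq> 0} + 1"
    and "M \<in> tree_dependencies (dim_col M) \<or> 2 * dim_col M \<le> (\<Sum>i<dim_row M. deg i) + 1"
proof -
  let ?n = "dim_row M" and ?k = "dim_col M"
  define e where "e i = {j. j < ?k \<and> M $$ (i, j) = 1}" for i
  have fe: "finite (e i)" for i unfolding e_def by simp
  have deg: "deg i = card (e i)" for i unfolding deg_def e_def ..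
  obtain x where k1: "1 \<le> ?k" and x: "\<And>j. j < ?k \<Longrightarrow> x j \<noteq> (0::real)"
    "\<And>i. i < ?n \<Longrightarrow> (\<Sum>j<?k. M $$ (i, j) * x j) = 0"
    and uniq: "\<And>y. (\<And>i. i < ?n \<Longrightarrow> (\<Sum>j<?k. M $$ (i, j) * y j) = 0) \<Longrightarrow> \<exists>c. \<forall>j<?k. y j = c * x j"
    using minimal_dependency_kernel[OF dep] by blast
  have ent: "M $$ (i, j) = of_bool (j \<in> e i)" if "i < ?n" "j < ?k" for i j
    using that bin unfolding e_def elements_mat_def by fastforce
  have row_sum: "(\<Sum>j<?k. M $$ (i, j) * y j) = (\<Sum>j\<in>e i. y j)" if "i < ?n" for i y
  proof -
    have "(\<Sum>j<?k. M $$ (i, j) * y j) = (\<Sum>j<?k. if j \<in> e i then y j else 0)"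
      using that ent by (intro sum.cong) auto
    also have "\<dots> = (\<Sum>j\<in>{..<?k} \<inter> e i. y j)" by (rule sum.inter_restrict[symmetric]) simp
    also have "{..<?k} \<inter> e i = e i" unfolding e_def by auto
    finally show ?thesis .
  qed
  show deg1: "deg i \<noteq> 1" if "i < ?n" for i
  proof
    assume "deg i = 1"
    then obtain j where j: "e i = {j}" unfolding deg using card_1_singletonE by blast
    hence "j < ?k" unfolding e_def by auto
    thus False using x(1) x(2)[OF that] row_sum[OF that, of x] j by simp
  qed
  define T where "T = {i. i < ?n \<and> deg i \<noteq> 0}"
  have fT: "finite T" and Tn: "T \<subseteq> {..<?n}" unfolding T_def by auto
  have outT: "e i = {}" if "i < ?n" "i \<notin> T" for i using that fe unfolding T_def deg by auto
  show cT: "?k \<le> card {i. i < ?n \<and> deg i \<noteq> 0} + 1"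
  proof (rule ccontr)
    assume "\<not> ?thesis"
    hence "card T + 1 < card {..<?k}" unfolding T_def by simp
    then obtain y where y: "\<exists>j\<in>{..<?k}. y j \<noteq> 0" "y 0 = 0" "\<forall>i\<in>T. (\<Sum>j<?k. M $$ (i, j) * y j) = 0"
      using nontrivial_kernel_vanishing[of T "{..<?k}" 0 "\<lambda>i j. M $$ (i, j)"] fT by blast
    have "(\<Sum>j<?k. M $$ (i, j) * y j) = 0" if "i < ?n" for i
      using y(3) outT[OF that] row_sum[OF that, of y] by (cases "i \<in> T") auto
    then obtain c where c: "\<forall>j<?k. y j = c * x j" using uniq by blast
    hence "c = 0" using y(2) k1 x(1)[of 0] by auto
    thus False using y(1) c by simp
  qed
  have sumT: "(\<Sum>i<?n. deg i) = (\<Sum>i\<in>T. deg i)"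
    using Tn outT by (intro sum.mono_neutral_right) (auto simp: deg)
  have deg2: "2 \<le> deg i" if "i \<in> T" for i
    using that deg1[of i] unfolding T_def by (cases "deg i") auto
  show "M \<in> tree_dependencies ?k \<or> 2 * ?k \<le> (\<Sum>i<?n. deg i) + 1"
  proof (cases "2 * ?k \<le> (\<Sum>i<?n. deg i) + 1")
    case False
    have "(\<Sum>i\<in>T. deg i) = (\<Sum>i\<in>T. deg i - 2) + (\<Sum>i\<in>T. 2)"
      unfolding sum.distrib[symmetric]
    proof (intro sum.cong refl)
      fix i assume "i \<in> T"
      thus "deg i = deg i - 2 + 2" using deg2[of i] by linarith
    qed
    hence tot: "(\<Sum>i\<in>T. deg i) = (\<Sum>i\<in>T. deg i - 2) + 2 * card T" by simp
    hence cT': "card T + 1 = ?k" and "(\<Sum>i\<in>T. deg i - 2) = 0"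
      using False cT unfolding sumT T_def[symmetric] by auto
    hence deg2': "card (e i) = 2" if "i \<in> T" for i
      using deg2[OF that] that fT unfolding deg by auto
    have eT: "e i \<subseteq> {..<?k}" for i unfolding e_def by auto
    have xT: "(\<Sum>j\<in>e i. x j) = 0" if "i \<in> T" for i
      using x(2)[of i] row_sum[of i x] that Tn by auto
    have uT: "\<exists>c. \<forall>j<?k. y j = c * x j" if y: "\<And>i. i \<in> T \<Longrightarrow> (\<Sum>j\<in>e i. y j) = 0" for y
    proof (rule uniq)
      fix i assume i: "i < ?n"
      show "(\<Sum>j<?k. M $$ (i, j) * y j) = 0"
        using y outT[OF i] row_sum[OF i, of y] by (cases "i \<in> T") auto
    qed
    have inj: "inj_on e T" and tree: "is_tree {..<?k} (e ` T)"
      using tree_of_unique_kernel[OF fT cT' eT deg2' x(1) xT uT] by auto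
    have rowT: "i < ?n \<and> row M i \<noteq> 0\<^sub>v ?k \<longleftrightarrow> i \<in> T" for i
    proof (cases "i < ?n")
      case i: True
      have "row M i = 0\<^sub>v ?k \<longleftrightarrow> (\<forall>j<?k. M $$ (i, j) = 0)"
        using i by (auto simp: vec_eq_iff)
      also have "\<dots> \<longleftrightarrow> e i = {}" using ent[OF i] eT[of i] by auto
      also have "\<dots> \<longleftrightarrow> i \<notin> T" using i fe unfolding T_def deg by auto
      finally show ?thesis using i by simp
    qed (use Tn in auto)
    have "nonzero_rows_incidence M (e ` T)"
      unfolding nonzero_rows_incidence_def
      using rowT inj ent by (intro exI[of _ e]) (auto simp: bij_betw_def)
    moreover have "card {(i, j). i < ?n \<and> j < ?k \<and> M $$ (i, j) = 1} = 2 * ?k - 2"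
    proof -
      have "{(i, j). i < ?n \<and> j < ?k \<and> M $$ (i, j) = 1} = (SIGMA i:{..<?n}. e i)"
        unfolding e_def by auto
      hence "card {(i, j). i < ?n \<and> j < ?k \<and> M $$ (i, j) = 1} = (\<Sum>i<?n. deg i)"
        using fe by (simp add: deg)
      also have "\<dots> = 2 * card T" unfolding sumT by (simp add: deg deg2')
      also have "\<dots> = 2 * ?k - 2" using cT' by simp
      finally show ?thesis .
    qed
    ultimately show ?thesis
      using bin tree unfolding tree_dependencies_def by blast
  qed simp
qed

section \<open>Solutions of intermediate support\<close>

definition pr :: "nat \<Rightarrow> nat \<Rightarrow> nat \<times> nat" where
  "pr i j = (min i j, max i j)"

definition vpairs :: "nat set \<Rightarrow> (nat \<times> nat) set" where
  "vpairs V = {(i, j). i \<in> V \<and> j \<in> V \<and> i < j}"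

definition adj :: "(nat \<times> nat \<Rightarrow> bool) \<Rightarrow> nat \<Rightarrow> nat \<Rightarrow> bool" where
  "adj f i j \<longleftrightarrow> i \<noteq> j \<and> f (pr i j)"

definition rowsum :: "(nat \<times> nat \<Rightarrow> bool) \<Rightarrow> nat set \<Rightarrow> (nat \<Rightarrow> real) \<Rightarrow> nat \<Rightarrow> real" where
  "rowsum f C w i = (\<Sum>j\<in>C. if adj f i j then w j else 0)"

lemma pr_eq_iff: "pr i j = pr k l \<longleftrightarrow> i = k \<and> j = l \<or> i = l \<and> j = k"
  by (auto simp: pr_def min_def max_def)

lemma pr_commute: "pr i j = pr j i"
  by (simp add: pr_eq_iff)

lemma adj_commute: "adj f i j = adj f j i"
  by (auto simp: adj_def pr_commute)

lemma pr_in_vpairs [simp]: "pr i j \<in> vpairs V \<longleftrightarrow> i \<in> V \<and> j \<in> V \<and> i \<noteq> j"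
  by (auto simp: pr_def vpairs_def min_def max_def)

lemma vpairs_mono: "V \<subseteq> W \<Longrightarrow> vpairs V \<subseteq> vpairs W"
  by (auto simp: vpairs_def)

lemma finite_vpairs [simp]: "finite V \<Longrightarrow> finite (vpairs V)"
  by (rule finite_subset[of _ "V \<times> V"]) (auto simp: vpairs_def)

lemma inj_on_pr [simp]: "inj_on (pr i) S"
  by (auto simp: inj_on_def pr_eq_iff)

lemma rowsum_mult: "rowsum f S w i = (\<Sum>j\<in>S. of_bool (adj f i j) * w j)"
  by (auto simp: rowsum_def intro!: sum.cong)

lemma rowsum_diff: "rowsum f S (\<lambda>j. w j - w' j) i = rowsum f S w i - rowsum f S w' i"
  by (simp add: rowsum_mult right_diff_distrib sum_subtractf)

text \<open>At most \<open>card S\<close> rows \<open>R\<close> with the same kernel as all rows already imply the other equations of the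
  system, and the rows outside \<open>S\<close> and \<open>R\<close> are independent of those in \<open>R\<close>, which fix the solution.
  The constant \<open>1 / 1024\<close> makes at least \<open>n / 2\<close> such rows beat the \<open>4 ^ n\<close> choices of \<open>(S, R)\<close>.\<close>

lemma prob_midsize_solution_le:
  fixes u :: "nat \<Rightarrow> real" and K p :: real
  assumes LO: "\<And>(I :: (nat \<times> nat) set) w c. finite I \<Longrightarrow> K \<le> real (card {i\<in>I. w i \<noteq> (0::real)}) * p \<Longrightarrow>
       measure_pmf.prob (coins p I) {f. (\<Sum>i\<in>I. if f i then w i else 0) = c} \<le> 1 / 1024"
    and V: "finite V"
  shows "measure_pmf.prob (coins p (vpairs V)) {f. \<exists>S w. S \<subseteq> V \<and> 4 * card S \<le> card V \<and>
      K \<le> card S * p \<and> (\<forall>j\<in>S. w j \<noteq> 0) \<and> (\<forall>i\<in>V. rowsum f S w i = u i)} \<le> (1 / 8) ^ card V"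
proof -
  define Wit where "Wit S R f w \<longleftrightarrow> (\<forall>j\<in>S. w j \<noteq> 0) \<and> (\<forall>i\<in>R. rowsum f S w i = u i)" for S R f w
  \<comment> \<open>The default keeps the vector nonzero on \<open>S\<close> for every
    \<open>f\<close>: the bound for a block must hold for all values of the other coins, including
    those without a witness.\<close>
  define W where "W S R f = (if \<exists>w. Wit S R f w then SOME w. Wit S R f w else (\<lambda>_. 1))" for S R f
  define \<E> where "\<E> S R = {f. (\<exists>w. Wit S R f w) \<and> (\<forall>i\<in>V - S - R. rowsum f S (W S R f) i = u i)}" for S R
  define Ix where "Ix = {(S, R). S \<subseteq> V \<and> 4 * card S \<le> card V \<and> K \<le> card S * p \<and> R \<subseteq> V \<and> card R \<le> card S}"
  have W: "Wit S R f (W S R f)" if "\<exists>w. Wit S R f w" for S R f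
    using that unfolding W_def by (metis someI_ex)
  have W0: "W S R f j \<noteq> 0" if "j \<in> S" for S R f j
    using W[of S R f] that unfolding Wit_def by (cases "\<exists>w. Wit S R f w") (auto simp: W_def Wit_def)
  have Ix_sub: "Ix \<subseteq> Pow V \<times> Pow V" unfolding Ix_def by auto
  have fIx: "finite Ix" using Ix_sub V by (meson finite_Pow_iff finite_SigmaI finite_subset)
  have "card Ix \<le> card (Pow V \<times> Pow V)" using Ix_sub V by (intro card_mono) auto
  also have "\<dots> = 2 ^ card V * 2 ^ card V" using V by (simp add: card_cartesian_product card_Pow)
  also have "\<dots> = 4 ^ card V" by (simp flip: power_mult_distrib)
  finally have cIx: "real (card Ix) \<le> 4 ^ card V"
    by (metis numeral_power_eq_of_nat_cancel_iff of_nat_le_iff of_nat_numeral of_nat_power)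
  have sub: "{f. \<exists>S w. S \<subseteq> V \<and> 4 * card S \<le> card V \<and> K \<le> card S * p \<and> (\<forall>j\<in>S. w j \<noteq> 0) \<and>
      (\<forall>i\<in>V. rowsum f S w i = u i)} \<subseteq> (\<Union>(S, R)\<in>Ix. \<E> S R)"
  proof
    fix f assume "f \<in> {f. \<exists>S w. S \<subseteq> V \<and> 4 * card S \<le> card V \<and> K \<le> card S * p \<and> (\<forall>j\<in>S. w j \<noteq> 0) \<and>
      (\<forall>i\<in>V. rowsum f S w i = u i)}"
    then obtain S w where S: "S \<subseteq> V" "4 * card S \<le> card V" "K \<le> card S * p" and w: "\<forall>j\<in>S. w j \<noteq> 0"
      "\<forall>i\<in>V. rowsum f S w i = u i" by blast
    have "finite S" using S V finite_subset by blast
    from finite_rows_same_kernel[OF this, of V "\<lambda>i j. of_bool (adj f i j)"]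
    obtain R where R: "R \<subseteq> V" "card R \<le> card S"
      and ker: "\<And>w. (\<forall>i\<in>R. rowsum f S w i = 0) \<Longrightarrow> (\<forall>i\<in>V. rowsum f S w i = 0)"
      unfolding rowsum_mult by blast
    have ex: "\<exists>w. Wit S R f w" using w R unfolding Wit_def by blast
    have "\<forall>i\<in>R. rowsum f S (W S R f) i = rowsum f S w i" using W[OF ex] w R unfolding Wit_def by auto
    hence "\<forall>i\<in>R. rowsum f S (\<lambda>j. W S R f j - w j) i = 0" by (simp add: rowsum_diff)
    from ker[OF this] have "\<forall>i\<in>V. rowsum f S (W S R f) i = rowsum f S w i" by (simp add: rowsum_diff)
    hence "f \<in> \<E> S R" using ex w unfolding \<E>_def by auto
    moreover have "(S, R) \<in> Ix" using S R unfolding Ix_def by auto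
    ultimately show "f \<in> (\<Union>(S, R)\<in>Ix. \<E> S R)" by blast
  qed
  have bound: "measure_pmf.prob (coins p (vpairs V)) (\<E> S R) \<le> (1 / 32) ^ card V" if SR: "(S, R) \<in> Ix" for S R
  proof -
    have S: "S \<subseteq> V" "finite S" "4 * card S \<le> card V" "K \<le> card S * p" and R: "R \<subseteq> V" "card R \<le> card S" "finite R"
      using SR V finite_subset unfolding Ix_def by auto
    \<comment> \<open>A pair joining \<open>i\<close> to \<open>S\<close> is read by row
      \<open>i\<close> alone: another row could reach it only through column \<open>i\<close>, which
      is not in \<open>S\<close>.\<close>
    have indep: "adj (override_on f h (pr i ` S)) i' j = adj f i' j"
      if "i \<notin> S" "i' \<noteq> i" "j \<in> S" for f h i i' j
      using that by (auto simp: adj_def override_on_def pr_eq_iff)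
    hence rs: "rowsum (override_on f h (pr i ` S)) S w i' = rowsum f S w i'"
      if "i \<notin> S" "i' \<noteq> i" for f h i i' w
      using that by (auto simp: rowsum_def intro!: sum.cong)
    have WitI: "Wit S R (override_on f h (pr i ` S)) = Wit S R f" if "i \<in> V - S - R" for f h i
    proof
      fix w
      have "rowsum (override_on f h (pr i ` S)) S w i' = rowsum f S w i'" if "i' \<in> R" for i'
        using that \<open>i \<in> V - S - R\<close> by (intro rs) auto
      thus "Wit S R (override_on f h (pr i ` S)) w = Wit S R f w" unfolding Wit_def by auto
    qed
    hence WI: "W S R (override_on f h (pr i ` S)) = W S R f" if "i \<in> V - S - R" for f h i
      unfolding W_def by (simp only: WitI[OF that])
    have "measure_pmf.prob (coins p (vpairs V)) {f. (\<exists>w. Wit S R f w) \<and> (\<forall>i\<in>V - S - R. rowsum f S (W S R f) i = u i)}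
        \<le> measure_pmf.prob (coins p (vpairs V)) {f. \<exists>w. Wit S R f w} * (1 / 1024) ^ card (V - S - R)"
    proof (rule prob_coins_blocks_le[where J = "\<lambda>i. pr i ` S"])
      fix i assume i: "i \<in> V - S - R"
      show "pr i ` S \<subseteq> vpairs V" using i S by auto
      fix f
      define \<omega> where "\<omega> = (\<lambda>e. W S R f (inv_into S (pr i) e))"
      have \<omega>: "\<omega> (pr i j) = W S R f j" if "j \<in> S" for j
        using that by (simp add: \<omega>_def inv_into_f_f[OF inj_on_pr])
      have "(\<Sum>e\<in>pr i ` S. if h e then \<omega> e else 0) = rowsum (override_on f h (pr i ` S)) S (W S R f) i" for h
        using i by (auto simp: sum.reindex rowsum_def adj_def override_on_def \<omega> intro!: sum.cong)
      hence "{h. rowsum (override_on f h (pr i ` S)) S (W S R (override_on f h (pr i ` S))) i = u i}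
          = {h. (\<Sum>e\<in>pr i ` S. if h e then \<omega> e else 0) = u i}" using WI[OF i] by simp
      moreover have "{e \<in> pr i ` S. \<omega> e \<noteq> 0} = pr i ` S" using \<omega> W0 by auto
      hence "card {e \<in> pr i ` S. \<omega> e \<noteq> 0} = card S" by (simp add: card_image)
      ultimately show "measure_pmf.prob (coins p (pr i ` S))
          {h. rowsum (override_on f h (pr i ` S)) S (W S R (override_on f h (pr i ` S))) i = u i} \<le> 1 / 1024"
        using LO[of "pr i ` S" \<omega> "u i"] S by simp
    next
      fix i j f h assume ij: "i \<in> V - S - R" "j \<in> V - S - R" "i \<noteq> j"
      show "pr i ` S \<inter> pr j ` S = {}" using ij by (auto simp: pr_eq_iff)
      show "(rowsum (override_on f h (pr j ` S)) S (W S R (override_on f h (pr j ` S))) i = u i) =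
            (rowsum f S (W S R f) i = u i)"
        using ij WI[OF ij(2)] rs[of j i] by simp
    next
      fix i f h assume "i \<in> V - S - R"
      thus "(\<exists>w. Wit S R (override_on f h (pr i ` S)) w) = (\<exists>w. Wit S R f w)" using WitI by simp
    qed (use V in auto)
    also have "\<dots> \<le> 1 * (1 / 1024) ^ card (V - S - R)" by (intro mult_right_mono) auto
    also have "\<dots> = ((1 / 32) ^ 2) ^ card (V - S - R)" by (simp add: power_divide)
    also have "\<dots> = (1 / 32) ^ (2 * card (V - S - R))" by (simp only: power_mult)
    also have "\<dots> \<le> (1 / 32) ^ card V"
    proof (rule power_decreasing)
      have "V \<subseteq> (V - S - R) \<union> (S \<union> R)" by auto
      hence "card V \<le> card ((V - S - R) \<union> (S \<union> R))" using V S R by (intro card_mono) auto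
      also have "\<dots> \<le> card (V - S - R) + (card S + card R)"
        by (meson card_Un_le add_left_mono order_trans)
      finally show "card V \<le> 2 * card (V - S - R)" using S R by simp
    qed auto
    finally show ?thesis unfolding \<E>_def .
  qed
  have "measure_pmf.prob (coins p (vpairs V)) {f. \<exists>S w. S \<subseteq> V \<and> 4 * card S \<le> card V \<and>
      K \<le> card S * p \<and> (\<forall>j\<in>S. w j \<noteq> 0) \<and> (\<forall>i\<in>V. rowsum f S w i = u i)}
      \<le> measure_pmf.prob (coins p (vpairs V)) (\<Union>(S, R)\<in>Ix. \<E> S R)"
    using sub by (intro measure_pmf.finite_measure_mono) auto
  also have "\<dots> \<le> (\<Sum>(S, R)\<in>Ix. measure_pmf.prob (coins p (vpairs V)) (\<E> S R))"
    using measure_pmf.finite_measure_subadditive_finite[of Ix "\<lambda>(S, R). \<E> S R" "coins p (vpairs V)"] fIx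
    by (simp add: case_prod_unfold)
  also have "\<dots> \<le> (\<Sum>_\<in>Ix. (1 / 32) ^ card V)" using bound by (intro sum_mono) auto
  also have "\<dots> = card Ix * (1 / 32) ^ card V" by simp
  also have "\<dots> \<le> 4 ^ card V * (1 / 32) ^ card V" using cIx by (intro mult_right_mono) auto
  also have "\<dots> = (1 / 8) ^ card V" by (simp flip: power_mult_distrib)
  finally show ?thesis .
qed

section \<open>Solutions of small support\<close>

text \<open>With \<open>k = card S\<close> and \<open>r = card N\<close>, the \<open>(n / k) ^ (k + r)\<close> choices of \<open>S\<close> and \<open>N\<close> are offset by
  \<open>k + r\<close> present pairs; a tree dependency has one pair fewer and does occur. The columns \<open>Z\<close>
  have no rows of their own: they are the two copies of a deleted column in the decoupling argument.\<close>

definition small_event :: "real \<Rightarrow> real \<Rightarrow> nat set \<Rightarrow> nat set \<Rightarrow> (nat \<times> nat) set \<Rightarrow> (nat \<times> nat \<Rightarrow> bool) \<Rightarrow> bool" where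
  "small_event K p V Z I f \<longleftrightarrow> (\<exists>S N F. S \<subseteq> V \<and> S \<noteq> {} \<and> real (card S) * p \<le> K \<and> N \<subseteq> V - S \<and> card N \<le> card S \<and>
     F \<subseteq> (\<lambda>(i, c). pr i c) ` ((S \<union> N) \<times> (S \<union> Z)) \<inter> I \<and> card F = card S + card N \<and> (\<forall>e\<in>F. f e) \<and>
     (\<forall>i\<in>V - S - N. card {c\<in>S \<union> Z. pr i c \<in> I \<and> f (pr i c)} \<noteq> 1))"

lemma power_div_fact_le_exp:
  fixes x :: real
  assumes "0 \<le> x"
  shows "x ^ m / fact m \<le> exp x"
proof -
  have s: "(\<lambda>n. x ^ n /\<^sub>R fact n) sums exp x" by (rule exp_converges)
  have "(\<Sum>n\<in>{m}. x ^ n /\<^sub>R fact n) \<le> (\<Sum>n. x ^ n /\<^sub>R fact n)"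
    using assms s by (intro sum_le_suminf) (auto simp: sums_iff)
  thus ?thesis using s by (simp add: sums_iff field_simps)
qed

text \<open>With \<open>k\<close> independent of \<open>m\<close>, the three binomial coefficients
  of the union bound, with lower indices \<open>k\<close>, \<open>r\<close> and
  \<open>k + r\<close>, share one base and lose \<open>exp k\<close> each.\<close>

lemma binomial_le_exp:
  fixes k :: real
  assumes "0 < k"
  shows "real (N choose m) \<le> (N / k) ^ m * exp k"
proof -
  have "real ((N choose m) * fact m) \<le> real (N ^ m)"
    using binomial_fact_pow[of N m] by (simp only: of_nat_le_iff)
  hence "real (N choose m) \<le> real N ^ m / fact m" by (simp add: field_simps)
  also have "\<dots> = (N / k) ^ m * (k ^ m / fact m)" using assms by (simp add: power_divide)
  also have "\<dots> \<le> (N / k) ^ m * exp k"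
    using assms by (intro mult_left_mono power_div_fact_le_exp) auto
  finally show ?thesis .
qed

text \<open>Each row outside \<open>S \<union> N\<close> is tested on its own block of pairs with
  \<open>S \<union> Z\<close>; the blocks are disjoint from each other and from \<open>F\<close>. A
  block has at most \<open>card S + 2\<close> pairs, whence the exponent \<open>card S + 1\<close>,
  and contains all pairs with \<open>S\<close>, whence the factor \<open>card S\<close>. Missing an
  event of probability \<open>q\<close> costs \<open>1 - q \<le> exp (- q)\<close>.\<close>

lemma prob_small_configuration_le:
  fixes p :: real
  assumes I: "finite I" "vpairs V \<subseteq> I" and Z: "V \<inter> Z = {}" "finite Z" "card Z \<le> 2"
    and S: "S \<subseteq> V" "finite V" and F: "F \<subseteq> (\<lambda>(i, c). pr i c) ` ((S \<union> N) \<times> (S \<union> Z)) \<inter> I"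
    and p: "0 \<le> p" "p \<le> 1"
  shows "measure_pmf.prob (coins p I) {f. (\<forall>e\<in>F. f e) \<and>
      (\<forall>i\<in>V - S - N. card {c\<in>S \<union> Z. pr i c \<in> I \<and> f (pr i c)} \<noteq> 1)}
    \<le> p ^ card F * exp (- (card S * p * (1 - p) ^ (card S + 1))) ^ card (V - S - N)"
proof -
  define J where "J i = pr i ` (S \<union> Z) \<inter> I" for i
  have fS: "finite S" using S finite_subset by blast
  have cJ: "card {c\<in>S \<union> Z. pr i c \<in> I \<and> g (pr i c)} = card {e\<in>J i. g e}" for g i
  proof -
    have "{e\<in>J i. g e} = pr i ` {c\<in>S \<union> Z. pr i c \<in> I \<and> g (pr i c)}" unfolding J_def by auto
    thus ?thesis by (simp add: card_image)
  qed
  have "measure_pmf.prob (coins p I) {f. (\<forall>e\<in>F. f e) \<and> (\<forall>i\<in>V - S - N. card {e\<in>J i. f e} \<noteq> 1)}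
      \<le> measure_pmf.prob (coins p I) {f. \<forall>e\<in>F. f e}
          * exp (- (card S * p * (1 - p) ^ (card S + 1))) ^ card (V - S - N)"
  proof (rule prob_coins_blocks_le[where J = J])
    fix i f assume i: "i \<in> V - S - N"
    have fJ: "finite (J i)" using I unfolding J_def by simp
    have "pr i ` S \<subseteq> vpairs V" using i S by auto
    hence sub: "pr i ` S \<subseteq> J i" using I unfolding J_def by blast
    have "card (J i) \<le> card (pr i ` (S \<union> Z))" unfolding J_def using fS Z by (intro card_mono) auto
    also have "\<dots> \<le> card S + 2" using card_Un_le[of S Z] Z by (simp add: card_image)
    finally have cJi: "card (J i) - 1 \<le> card S + 1" by simp
    have "card S * p * (1 - p) ^ (card S + 1) = card S * (p * (1 - p) ^ (card S + 1))" by simp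
    also have "\<dots> \<le> card S * (p * (1 - p) ^ (card (J i) - 1))"
      using p cJi by (intro mult_left_mono power_decreasing) auto
    also have "\<dots> = card (pr i ` S) * (p * (1 - p) ^ (card (J i) - 1))" by (simp add: card_image)
    also have "\<dots> \<le> measure_pmf.prob (coins p (J i)) {f. card {e\<in>J i. f e} = 1}"
      by (rule prob_exactly_one_ge[OF fJ sub p])
    finally have ge: "card S * p * (1 - p) ^ (card S + 1)
        \<le> measure_pmf.prob (coins p (J i)) {f. card {e\<in>J i. f e} = 1}" .
    have "{h. card {e\<in>J i. override_on f h (J i) e} \<noteq> 1} = space (coins p (J i)) - {h. card {e\<in>J i. h e} = 1}"
    proof -
      have "{e\<in>J i. override_on f h (J i) e} = {e\<in>J i. h e}" for h by (auto simp: override_on_def)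
      thus ?thesis by auto
    qed
    hence "measure_pmf.prob (coins p (J i)) {h. card {e\<in>J i. override_on f h (J i) e} \<noteq> 1}
        = 1 - measure_pmf.prob (coins p (J i)) {f. card {e\<in>J i. f e} = 1}"
      by (simp only:) (rule measure_pmf.prob_compl, simp)
    also have "\<dots> \<le> 1 + (- (card S * p * (1 - p) ^ (card S + 1)))" using ge by simp
    also have "\<dots> \<le> exp (- (card S * p * (1 - p) ^ (card S + 1)))" by (rule exp_ge_add_one_self)
    finally show "measure_pmf.prob (coins p (J i)) {h. card {e\<in>J i. override_on f h (J i) e} \<noteq> 1}
        \<le> exp (- (card S * p * (1 - p) ^ (card S + 1)))" .
  next
    fix i j f h assume ij: "i \<in> V - S - N" "j \<in> V - S - N" "i \<noteq> j"
    show disj: "J i \<inter> J j = {}" using ij Z unfolding J_def by (auto simp: pr_eq_iff)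
    have "{e\<in>J i. override_on f h (J j) e} = {e\<in>J i. f e}" using disj by (auto simp: override_on_def)
    thus "(card {e\<in>J i. override_on f h (J j) e} \<noteq> 1) = (card {e\<in>J i. f e} \<noteq> 1)" by simp
  next
    fix i f h assume i: "i \<in> V - S - N"
    have "e \<notin> J i" if "e \<in> F" for e
    proof
      assume "e \<in> J i"
      then obtain c' where c': "e = pr i c'" "c' \<in> S \<union> Z" unfolding J_def by blast
      have "e \<in> (\<lambda>(i, c). pr i c) ` ((S \<union> N) \<times> (S \<union> Z))" using F that by blast
      then obtain i' c where "e = pr i' c" "i' \<in> S \<union> N" "c \<in> S \<union> Z" by auto
      thus False using c' i Z by (auto simp: pr_eq_iff)
    qed
    thus "(\<forall>e\<in>F. override_on f h (J i) e) = (\<forall>e\<in>F. f e)" by (auto simp: override_on_def)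
  qed (use I S J_def in auto)
  also have "measure_pmf.prob (coins p I) {f. \<forall>e\<in>F. f e} = p ^ card F"
    using F I p by (intro prob_coins_all) auto
  finally show ?thesis unfolding cJ .
qed

text \<open>Each of the \<open>k + r\<close> present pairs contributes
  \<open>(n / k) * (6 * k) * p = 6 * n * p\<close>, and \<open>r \<le> k\<close> turns this into the
  square; the three coefficients cost \<open>exp 3\<close> per column. The bound
  \<open>6 * k ^ 2\<close> comes from \<open>2 * k * (k + 2)\<close> candidate pairs. The decay is
  due to at least \<open>n / 2\<close> tested rows.\<close>

lemma small_term_le:
  fixes p K :: real
  assumes k: "1 \<le> k" "r \<le> k" "4 * k \<le> n" and p: "0 < p" "p \<le> 1 / 2" and K: "k * p \<le> K"
    and d: "1 \<le> n * p" and Q: "Q \<le> 6 * k ^ 2" and m: "n - 2 * k \<le> m"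
  shows "real (n choose k) * real (n choose r) * real (Q choose (k + r)) *
      (p ^ (k + r) * exp (- (k * p * (1 - p) ^ (k + 1))) ^ m)
    \<le> (36 * exp 3 * (n * p) ^ 2 * exp (- (exp (- 2 * K - 1) / 2) * (n * p))) ^ k"
proof -
  let ?k = "real k" and ?d = "n * p" and ?c = "exp (- 2 * K - 1) / 2"
  have k0: "0 < ?k" using k by simp
  have "real (Q choose (k + r)) \<le> (Q / ?k) ^ (k + r) * exp ?k" by (rule binomial_le_exp[OF k0])
  also have "\<dots> \<le> (6 * ?k) ^ (k + r) * exp ?k"
  proof -
    have "real Q \<le> 6 * ?k ^ 2" using Q by (metis of_nat_le_iff of_nat_mult of_nat_numeral of_nat_power)
    hence "Q / ?k \<le> 6 * ?k" using k0 by (simp add: field_simps power2_eq_square)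
    thus ?thesis by (intro mult_right_mono power_mono) auto
  qed
  finally have "real (n choose k) * real (n choose r) * real (Q choose (k + r))
      \<le> ((n / ?k) ^ k * exp ?k) * ((n / ?k) ^ r * exp ?k) * ((6 * ?k) ^ (k + r) * exp ?k)"
    using binomial_le_exp[OF k0] by (intro mult_mono) auto
  also have "\<dots> = (exp ?k * exp ?k * exp ?k) * ((n / ?k) * (6 * ?k)) ^ (k + r)"
  proof -
    have "(a ^ k * E) * (a ^ r * E) * (b ^ (k + r) * E) = (E * E * E) * (a * b) ^ (k + r)" for a b E :: real
      by (simp add: power_mult_distrib power_add)
    thus ?thesis .
  qed
  also have "exp ?k * exp ?k * exp ?k = exp (3 * ?k)" by (simp flip: exp_add)
  also have "(n / ?k) * (6 * ?k) = 6 * real n" using k0 by simp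
  finally have "real (n choose k) * real (n choose r) * real (Q choose (k + r)) * p ^ (k + r)
      \<le> exp (3 * ?k) * (6 * real n) ^ (k + r) * p ^ (k + r)"
    using p by (intro mult_right_mono) auto
  also have "\<dots> = exp (3 * ?k) * (6 * ?d) ^ (k + r)" by (simp add: power_mult_distrib)
  also have "\<dots> \<le> exp (3 * ?k) * (6 * ?d) ^ (2 * k)"
    using d k by (intro mult_left_mono power_increasing) auto
  also have "\<dots> = (36 * exp 3 * ?d ^ 2) ^ k"
  proof -
    have "(6 * ?d) ^ (2 * k) = (36 * ?d ^ 2) ^ k" by (simp only: power_mult) (simp add: power_mult_distrib)
    moreover have "exp (3 * ?k) = exp 3 ^ k" by (simp add: exp_of_nat_mult[symmetric] mult.commute)
    ultimately show ?thesis by (simp only: power_mult_distrib[symmetric] mult_ac)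
  qed
  finally have 1: "real (n choose k) * real (n choose r) * real (Q choose (k + r)) * p ^ (k + r)
      \<le> (36 * exp 3 * ?d ^ 2) ^ k" .
  \<comment> \<open>From \<open>p \<le> 1 / 2\<close> follows
    \<open>1 - p \<ge> exp (- 2 * p)\<close>, so \<open>(1 - p) ^ (k + 1)\<close> is bounded below
    while \<open>k * p \<le> K\<close>; the extra factor accounts for the \<open>- 1\<close> in the
    exponent.\<close>
  have "- 2 * p \<le> - p - 2 * p ^ 2" using p by (simp add: power2_eq_square)
  also have "\<dots> \<le> ln (1 - p)" using ln_one_minus_pos_lower_bound[of p] p by simp
  finally have "exp (- 2 * p) \<le> exp (ln (1 - p))" by simp
  also have "exp (ln (1 - p)) = 1 - p" using p by simp
  finally have "exp (- 2 * p) \<le> 1 - p" .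
  hence "exp (- 2 * p) ^ (k + 1) \<le> (1 - p) ^ (k + 1)" by (intro power_mono) auto
  moreover have "exp (- 2 * K - 1) \<le> exp (- 2 * p) ^ (k + 1)"
  proof -
    have "exp (- 2 * p) ^ (k + 1) = exp (real (k + 1) * (- 2 * p))" by (rule exp_of_nat_mult[symmetric])
    moreover have "- 2 * K - 1 \<le> real (k + 1) * (- 2 * p)" using K p by (simp add: algebra_simps)
    ultimately show ?thesis by simp
  qed
  ultimately have c: "2 * ?c \<le> (1 - p) ^ (k + 1)" by simp
  have "real n / 2 \<le> m" using m k by simp
  hence "?k * p * (2 * ?c) * (real n / 2) \<le> ?k * p * (1 - p) ^ (k + 1) * m"
    using c p by (intro mult_mono) auto
  hence "exp (- (?k * p * (1 - p) ^ (k + 1)) * m) \<le> exp (?k * (- ?c * ?d))" by (simp add: mult_ac)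
  hence 2: "exp (- (?k * p * (1 - p) ^ (k + 1))) ^ m \<le> exp (- ?c * ?d) ^ k"
    by (simp add: exp_of_nat_mult[symmetric] mult_ac)
  have "real (n choose k) * real (n choose r) * real (Q choose (k + r)) *
      (p ^ (k + r) * exp (- (k * p * (1 - p) ^ (k + 1))) ^ m)
    = (real (n choose k) * real (n choose r) * real (Q choose (k + r)) * p ^ (k + r)) *
      exp (- (k * p * (1 - p) ^ (k + 1))) ^ m" by simp
  also have "\<dots> \<le> (36 * exp 3 * ?d ^ 2) ^ k * exp (- ?c * ?d) ^ k"
    using 1 2 by (intro mult_mono) auto
  finally show ?thesis by (simp add: power_mult_distrib)
qed

lemma sum_power_le_double:
  fixes x :: real
  assumes "0 \<le> x" "x \<le> 1 / 2"
  shows "(\<Sum>k=1..n. x ^ k) \<le> 2 * x"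
proof -
  have "(1 - x) * (\<Sum>k=1..n. x ^ k) = x - x ^ (n + 1)"
  proof (induction n)
    case (Suc n)
    have "(1 - x) * (\<Sum>k=1..Suc n. x ^ k) = (1 - x) * (\<Sum>k=1..n. x ^ k) + (1 - x) * x ^ Suc n"
      by (simp add: distrib_left)
    also have "\<dots> = x - x ^ (n + 1) + (1 - x) * x ^ Suc n" by (simp only: Suc)
    also have "\<dots> = x - x ^ (Suc n + 1)" by (simp add: algebra_simps)
    finally show ?case .
  qed simp
  also have "\<dots> \<le> x" using assms by simp
  finally have "(1 - x) * (\<Sum>k=1..n. x ^ k) \<le> x" .
  moreover have "1 / 2 * (\<Sum>k=1..n. x ^ k) \<le> (1 - x) * (\<Sum>k=1..n. x ^ k)"
    using assms by (intro mult_right_mono sum_nonneg) auto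
  ultimately show ?thesis by linarith
qed

text \<open>Union bound over the sizes and then over \<open>(S, N, F)\<close>. The
  \<open>k + 1\<close> values of \<open>r\<close> are absorbed by \<open>2 ^ k\<close>, leaving a
  geometric series of ratio \<open>2 * B \<le> 1 / 2\<close>. The condition on \<open>4 * K\<close>
  turns \<open>k * p \<le> K\<close> into \<open>4 * k \<le> card V\<close>.\<close>

lemma prob_small_event_le:
  fixes p K :: real
  assumes V: "finite V" and Z: "finite Z" "V \<inter> Z = {}" "card Z \<le> 2" and I: "finite I" "vpairs V \<subseteq> I"
    and p: "0 < p" "p \<le> 1 / 2" and d: "1 \<le> card V * p" "4 * K \<le> card V * p"
  defines "B \<equiv> 36 * exp 3 * (card V * p) ^ 2 * exp (- (exp (- 2 * K - 1) / 2) * (card V * p))"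
  assumes B: "B \<le> 1 / 4"
  shows "measure_pmf.prob (coins p I) {f. small_event K p V Z I f} \<le> 4 * B"
proof -
  let ?n = "card V" and ?P = "measure_pmf.prob (coins p I)"
  define Q where "Q S N = (\<lambda>(i, c). pr i c) ` ((S \<union> N) \<times> (S \<union> Z)) \<inter> I" for S N
  define X where "X = (\<lambda>(S, N, F). {f. (\<forall>e\<in>F. f e) \<and>
      (\<forall>i\<in>V - S - N. card {c\<in>S \<union> Z. pr i c \<in> I \<and> f (pr i c)} \<noteq> 1)})"
  define Ix where "Ix k r = (SIGMA S:{S. S \<subseteq> V \<and> card S = k}. SIGMA N:{N. N \<subseteq> V \<and> card N = r}.
      {F. F \<subseteq> Q S N \<and> card F = k + r})" for k r
  define Ks where "Ks = {k\<in>{1..?n}. k * p \<le> K}"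
  have fQ: "finite (Q S N)" for S N using I unfolding Q_def by simp
  have finIx: "finite (Ix k r)" for k r unfolding Ix_def using V fQ by auto
  have sub: "{f. small_event K p V Z I f} \<subseteq> (\<Union>k\<in>Ks. \<Union>r\<in>{..k}. \<Union>x\<in>Ix k r. X x)"
  proof
    fix f assume "f \<in> {f. small_event K p V Z I f}"
    then obtain S N F where *: "S \<subseteq> V" "S \<noteq> {}" "card S * p \<le> K" "N \<subseteq> V - S" "card N \<le> card S"
      "F \<subseteq> Q S N" "card F = card S + card N" "f \<in> X (S, N, F)"
      unfolding small_event_def Q_def X_def by auto
    have "finite S" using *(1) V by (rule finite_subset)
    hence "card S \<le> ?n" "card S \<noteq> 0" using *(1,2) card_mono[OF V *(1)] by auto
    hence "card S \<in> Ks" using * unfolding Ks_def by auto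
    moreover have "(S, N, F) \<in> Ix (card S) (card N)" using * unfolding Ix_def by auto
    ultimately show "f \<in> (\<Union>k\<in>Ks. \<Union>r\<in>{..k}. \<Union>x\<in>Ix k r. X x)" using *(5,8) by blast
  qed
  have tm: "?P (\<Union>x\<in>Ix k r. X x) \<le> B ^ k" if k: "k \<in> Ks" and r: "r \<le> k" for k r
  proof -
    let ?b = "p ^ (k + r) * exp (- (k * p * (1 - p) ^ (k + 1))) ^ (?n - 2 * k)"
    have "real k * p \<le> (?n / 4) * p" using k d unfolding Ks_def by auto
    hence "real k \<le> ?n / 4" using p by (simp only: mult_le_cancel_right_pos)
    hence k4: "4 * k \<le> ?n" by linarith
    have b: "?P (X x) \<le> ?b" if xI: "x \<in> Ix k r" for x
    proof -
      obtain S N F where x: "x = (S, N, F)" and S: "S \<subseteq> V" "card S = k" and N: "N \<subseteq> V" "card N = r"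
        and F: "F \<subseteq> Q S N" "card F = k + r" using xI unfolding Ix_def by auto
      have "?P (X x) \<le> p ^ (k + r) * exp (- (k * p * (1 - p) ^ (k + 1))) ^ card (V - S - N)"
        using prob_small_configuration_le[OF I Z(2,1,3) S(1) V F(1)[unfolded Q_def]] p S F unfolding x X_def by simp
      also have "\<dots> \<le> ?b"
      proof -
        have "?n - 2 * k \<le> card (V - S - N)"
          using S N r diff_card_le_card_Diff[of S V] diff_card_le_card_Diff[of N "V - S"] V finite_subset[of _ V] by force
        thus ?thesis using p by (intro mult_left_mono power_decreasing) auto
      qed
      finally show ?thesis .
    qed
    have q: "card (Q S N) \<le> 6 * k ^ 2" if "S \<subseteq> V" "card S = k" "N \<subseteq> V" "card N = r" for S N
    proof -
      have fin: "finite S" "finite N" using that V finite_subset by auto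
      have "card (Q S N) \<le> card ((\<lambda>(i, c). pr i c) ` ((S \<union> N) \<times> (S \<union> Z)))"
        unfolding Q_def using fin Z by (intro card_mono) auto
      also have "\<dots> \<le> card ((S \<union> N) \<times> (S \<union> Z))" using fin Z by (intro card_image_le) auto
      also have "\<dots> = card (S \<union> N) * card (S \<union> Z)" by (rule card_cartesian_product)
      also have "\<dots> \<le> (2 * k) * (k + 2)"
        using card_Un_le[of S N] card_Un_le[of S Z] that r Z by (intro mult_mono) auto
      also have "\<dots> \<le> (2 * k) * (3 * k)" using k unfolding Ks_def by (intro mult_left_mono) auto
      finally show ?thesis by (simp add: power2_eq_square)
    qed
    have "card (Ix k r) = (\<Sum>S | S \<subseteq> V \<and> card S = k. \<Sum>N | N \<subseteq> V \<and> card N = r. card (Q S N) choose (k + r))"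
      unfolding Ix_def using V fQ by (simp add: card_SigmaI n_subsets)
    also have "\<dots> \<le> (\<Sum>S | S \<subseteq> V \<and> card S = k. \<Sum>N | N \<subseteq> V \<and> card N = r. (6 * k ^ 2) choose (k + r))"
      using q by (intro sum_mono binomial_right_mono) auto
    also have "\<dots> = (?n choose k) * (?n choose r) * ((6 * k ^ 2) choose (k + r))"
      using V by (simp add: n_subsets)
    finally have cIx: "real (card (Ix k r)) \<le> real (?n choose k) * real (?n choose r) * real ((6 * k ^ 2) choose (k + r))"
      by (metis of_nat_le_iff of_nat_mult)
    have "?P (\<Union>x\<in>Ix k r. X x) \<le> (\<Sum>x\<in>Ix k r. ?P (X x))"
      using finIx by (intro measure_pmf.finite_measure_subadditive_finite) auto
    also have "\<dots> \<le> (\<Sum>x\<in>Ix k r. ?b)" using b by (intro sum_mono)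
    also have "\<dots> = card (Ix k r) * ?b" by simp
    also have "\<dots> \<le> real (?n choose k) * real (?n choose r) * real ((6 * k ^ 2) choose (k + r)) * ?b"
      using cIx p by (intro mult_right_mono) auto
    also have "\<dots> \<le> B ^ k"
      unfolding B_def using k r k4 p d by (intro small_term_le) (auto simp: Ks_def)
    finally show ?thesis .
  qed
  have B0: "0 \<le> B" unfolding B_def by simp
  have "?P {f. small_event K p V Z I f} \<le> ?P (\<Union>k\<in>Ks. \<Union>r\<in>{..k}. \<Union>x\<in>Ix k r. X x)"
    using sub by (intro measure_pmf.finite_measure_mono) auto
  also have "\<dots> \<le> (\<Sum>k\<in>Ks. ?P (\<Union>r\<in>{..k}. \<Union>x\<in>Ix k r. X x))"
    unfolding Ks_def by (intro measure_pmf.finite_measure_subadditive_finite) auto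
  also have "\<dots> \<le> (\<Sum>k\<in>Ks. (2 * B) ^ k)"
  proof (intro sum_mono)
    fix k assume k: "k \<in> Ks"
    have "?P (\<Union>r\<in>{..k}. \<Union>x\<in>Ix k r. X x) \<le> (\<Sum>r\<le>k. ?P (\<Union>x\<in>Ix k r. X x))"
      by (intro measure_pmf.finite_measure_subadditive_finite) auto
    also have "\<dots> \<le> (\<Sum>r\<le>k. B ^ k)" using tm[OF k] by (intro sum_mono) auto
    also have "\<dots> = real (k + 1) * B ^ k" by simp
    also have "\<dots> \<le> 2 ^ k * B ^ k"
    proof (intro mult_right_mono)
      have "k + 1 \<le> 2 ^ k" by (metis Suc_eq_plus1 Suc_leI less_exp)
      thus "real (k + 1) \<le> 2 ^ k" by (metis of_nat_le_iff of_nat_numeral of_nat_power)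
    qed (use B0 in auto)
    finally show "?P (\<Union>r\<in>{..k}. \<Union>x\<in>Ix k r. X x) \<le> (2 * B) ^ k" by (simp add: power_mult_distrib)
  qed
  also have "\<dots> \<le> (\<Sum>k=1..?n. (2 * B) ^ k)"
    unfolding Ks_def using B0 by (intro sum_mono2) auto
  also have "\<dots> \<le> 2 * (2 * B)" using B0 B by (intro sum_power_le_double) auto
  finally show ?thesis by simp
qed

lemma small_event_rare:
  fixes K \<epsilon> :: real
  assumes "0 < \<epsilon>"
  obtains D :: real where "\<And>V Z I (p::real). finite V \<Longrightarrow> finite Z \<Longrightarrow> V \<inter> Z = {} \<Longrightarrow> card Z \<le> 2 \<Longrightarrow> finite I \<Longrightarrow> vpairs V \<subseteq> I \<Longrightarrow>
      0 < p \<Longrightarrow> p \<le> 1 / 2 \<Longrightarrow> D \<le> real (card V) * p \<Longrightarrow> measure_pmf.prob (coins p I) {f. small_event K p V Z I f} \<le> \<epsilon>"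
proof -
  define c where "c = exp (- 2 * K - 1) / 2"
  have c: "0 < c" unfolding c_def by simp
  have "((\<lambda>x::real. x ^ 2 / exp x) \<longlongrightarrow> 0) at_top" by (rule tendsto_power_div_exp_0)
  moreover have "filterlim (\<lambda>x. c * x) at_top at_top"
    using c by (intro filterlim_tendsto_pos_mult_at_top[OF tendsto_const]) (auto intro: filterlim_ident)
  ultimately have "((\<lambda>x::real. (c * x) ^ 2 / exp (c * x)) \<longlongrightarrow> 0) at_top" by (rule filterlim_compose)
  hence "((\<lambda>x::real. (36 * exp 3 / c ^ 2) * ((c * x) ^ 2 / exp (c * x))) \<longlongrightarrow> 0) at_top"
    by (intro tendsto_mult_right_zero)
  hence "\<forall>\<^sub>F x in at_top. (36 * exp 3 / c ^ 2) * ((c * x) ^ 2 / exp (c * x)) < min (1 / 4) (\<epsilon> / 4)"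
    using assms by (intro order_tendstoD) auto
  then obtain D0 where D0: "\<And>x. D0 \<le> x \<Longrightarrow> (36 * exp 3 / c ^ 2) * ((c * x) ^ 2 / exp (c * x)) < min (1 / 4) (\<epsilon> / 4)"
    unfolding eventually_at_top_linorder by blast
  show ?thesis
  proof (rule that[of "max D0 (max 1 (4 * K))"])
    fix V Z :: "nat set" and I and p :: real
    assume *: "finite V" "finite Z" "V \<inter> Z = {}" "card Z \<le> 2" "finite I" "vpairs V \<subseteq> I" "0 < p" "p \<le> 1 / 2"
      and D: "max D0 (max 1 (4 * K)) \<le> card V * p"
    let ?B = "36 * exp 3 * (card V * p) ^ 2 * exp (- c * (card V * p))"
    have "?B = (36 * exp 3 / c ^ 2) * ((c * (card V * p)) ^ 2 / exp (c * (card V * p)))"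
      using c by (simp add: power_mult_distrib exp_minus field_simps)
    hence B: "?B < 1 / 4" "?B < \<epsilon> / 4" using D0[of "card V * p"] D by auto
    have "measure_pmf.prob (coins p I) {f. small_event K p V Z I f} \<le> 4 * ?B"
      unfolding c_def using * D B by (intro prob_small_event_le) (auto simp: c_def)
    thus "measure_pmf.prob (coins p I) {f. small_event K p V Z I f} \<le> \<epsilon>" using B by simp
  qed
qed

section \<open>Counting the present pairs of a dependency\<close>

lemma card_le_double_card_pr_image:
  assumes "finite X"
  shows "card X \<le> 2 * card ((\<lambda>(i, c). pr i c) ` X)"
proof -
  let ?h = "\<lambda>(i, c). pr i c"
  have "card X = (\<Sum>e\<in>?h ` X. \<Sum>x\<in>{x\<in>X. ?h x = e}. 1)"
    using sum.image_gen[OF assms, of "\<lambda>_. 1::nat" ?h] by simp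
  also have "\<dots> \<le> (\<Sum>e\<in>?h ` X. 2)"
  proof (intro sum_mono)
    fix e assume "e \<in> ?h ` X"
    then obtain a b where e: "e = pr a b" by auto
    have "{x\<in>X. ?h x = e} \<subseteq> {(a, b), (b, a)}" unfolding e by (auto simp: pr_eq_iff)
    hence "card {x\<in>X. ?h x = e} \<le> card {(a, b), (b, a)}" by (intro card_mono) auto
    also have "\<dots> \<le> 2" by (cases "a = b") auto
    finally show "(\<Sum>x\<in>{x\<in>X. ?h x = e}. 1) \<le> (2::nat)" by simp
  qed
  finally show ?thesis by simp
qed

text \<open>Rows outside \<open>S\<close> own their pairs, at least two each; only pairs inside
  \<open>S\<close> can be seen from both ends. So the nonzero rows outside \<open>S\<close>, trimmed
  to \<open>card S\<close> of them, serve as \<open>N\<close>. The two forms of \<open>many\<close>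
  reflect the two sources: minimal solutions of an inhomogeneous system have \<open>k\<close>
  nonzero rows, while dependencies guarantee \<open>k - 1\<close> and, if they are not trees,
  \<open>2 k - 1\<close> entries.\<close>

lemma small_eventI:
  fixes f :: "nat \<times> nat \<Rightarrow> bool" and p K :: real
  defines "A \<equiv> \<lambda>S Z I i. {c\<in>S \<union> Z. pr i c \<in> I \<and> f (pr i c)}"
  assumes V: "finite V" "finite Z" "V \<inter> Z = {}" and S: "S \<subseteq> V" "S \<noteq> {}" "card S * p \<le> K"
    and deg1: "\<And>i. i \<in> V \<Longrightarrow> card (A S Z I i) \<noteq> 1"
    and many: "card S \<le> card {i\<in>V. A S Z I i \<noteq> {}} \<or>
      card S \<le> card {i\<in>V. A S Z I i \<noteq> {}} + 1 \<and> 2 * card S \<le> (\<Sum>i\<in>V. card (A S Z I i)) + 1"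
  shows "small_event K p V Z I f"
proof -
  let ?h = "\<lambda>(i, c). pr i c" and ?k = "card S"
  define B where "B = A S Z I"
  define T where "T = {i\<in>V. B i \<noteq> {}}"
  define G where "G N = ?h ` (SIGMA i:N. B i)" for N
  have fS: "finite S" using S V finite_subset by blast
  have fB: "finite (B i)" for i using fS V unfolding B_def A_def by simp
  have BSZ: "B i \<subseteq> S \<union> Z" for i unfolding B_def A_def by auto
  have fT: "finite T" using V unfolding T_def by simp
  have TV: "T \<subseteq> V" unfolding T_def by auto
  have deg2: "2 \<le> card (B i)" if "i \<in> T" for i
  proof -
    have "card (B i) \<noteq> 1" "card (B i) \<noteq> 0" using that deg1[of i] fB unfolding T_def B_def by auto
    thus ?thesis by linarith
  qed
  have fin: "finite N" if "N \<subseteq> V" for N using that V finite_subset by blast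
  have GI: "G N \<subseteq> I" "\<forall>e\<in>G N. f e" for N unfolding G_def B_def A_def by auto
  have GQ: "G N \<subseteq> ?h ` (N \<times> (S \<union> Z))" for N unfolding G_def using BSZ by (intro image_mono) auto
  have cG: "card (G N) = (\<Sum>i\<in>N. card (B i))" if "N \<subseteq> V - S" for N
  proof -
    have "inj_on ?h (SIGMA i:N. B i)"
    proof (rule inj_onI)
      fix x y assume x: "x \<in> (SIGMA i:N. B i)" and y: "y \<in> (SIGMA i:N. B i)" and "?h x = ?h y"
      moreover obtain i c i' c' where xy: "x = (i, c)" "y = (i', c')" by (cases x, cases y) blast
      ultimately have "i = i' \<and> c = c' \<or> i = c' \<and> c = i'" by (simp add: pr_eq_iff)
      moreover have "i \<notin> S \<union> Z" "c' \<in> S \<union> Z" using x y xy that BSZ V(3) by auto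
      ultimately show "x = y" using xy by auto
    qed
    thus ?thesis unfolding G_def using fB fin[of N] that by (simp add: card_image card_SigmaI Diff_subset subset_trans)
  qed
  have main: "small_event K p V Z I f"
    if N: "N \<subseteq> V - S" "card N \<le> ?k" and G: "?k + card N \<le> card (G (S \<union> N))" for N
  proof -
    obtain F where F: "F \<subseteq> G (S \<union> N)" "card F = ?k + card N" using obtain_subset_with_card_n[OF G] by blast
    have "F \<subseteq> ?h ` ((S \<union> N) \<times> (S \<union> Z)) \<inter> I" "\<forall>e\<in>F. f e" using F GI GQ[of "S \<union> N"] by auto
    moreover have "\<forall>i\<in>V - S - N. card {c\<in>S \<union> Z. pr i c \<in> I \<and> f (pr i c)} \<noteq> 1"
      using deg1 unfolding A_def by auto
    ultimately show ?thesis
      unfolding small_event_def using S N F(2)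
      by (intro exI[of _ S] exI[of _ N] exI[of _ F] conjI)
  qed
  have Gmono: "G M \<subseteq> G N" if "M \<subseteq> N" for M N unfolding G_def using that by (intro image_mono Sigma_mono) auto
  have fG: "finite (G N)" if "N \<subseteq> V" for N unfolding G_def using fin[OF that] fB by auto
  show ?thesis
  proof (cases "?k \<le> card (T - S)")
    case True
    \<comment> \<open>Here \<open>k\<close> outer rows alone supply
      \<open>2 * k = k + card N\<close> pairs.\<close>
    obtain N where N: "N \<subseteq> T - S" "card N = ?k" by (rule obtain_subset_with_card_n[OF True]) (rule that)
    have NV: "N \<subseteq> V - S" using N TV by auto
    have "(\<Sum>i\<in>N. 2) \<le> (\<Sum>i\<in>N. card (B i))" using N deg2 by (intro sum_mono) auto
    also have "\<dots> = card (G N)" using cG[OF NV] by simp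
    also have "\<dots> \<le> card (G (S \<union> N))" using fG[of "S \<union> N"] Gmono[of N "S \<union> N"] NV S by (intro card_mono) auto
    finally show ?thesis using N NV by (intro main[of N]) auto
  next
    case False
    define N where "N = T - S"
    let ?r = "card N" and ?t = "card (T \<inter> S)" and ?o = "\<Sum>i\<in>N. card (B i)" and ?s = "\<Sum>i\<in>S. card (B i)"
    have NV: "N \<subseteq> V - S" using TV unfolding N_def by auto
    have "card T = ?t + ?r" unfolding N_def using fT by (metis card_Int_Diff)
    moreover have "2 * ?r \<le> ?o"
      using sum_mono[of N "\<lambda>_. 2" "\<lambda>i. card (B i)"] deg2 unfolding N_def by auto
    moreover have "2 * ?t \<le> ?s"
    proof -
      have "(\<Sum>i\<in>T \<inter> S. 2) \<le> (\<Sum>i\<in>T \<inter> S. card (B i))" using deg2 by (intro sum_mono) auto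
      also have "\<dots> \<le> ?s" using fS by (intro sum_mono2) auto
      finally show ?thesis by simp
    qed
    moreover have "?s \<le> 2 * card (G S)"
    proof -
      have "?s = card (SIGMA i:S. B i)" using fS fB by (simp add: card_SigmaI)
      also have "\<dots> \<le> 2 * card (G S)" unfolding G_def
        by (rule card_le_double_card_pr_image) (use fS fB in auto)
      finally show ?thesis .
    qed
    moreover have "(\<Sum>i\<in>V. card (B i)) = ?o + ?s"
    proof -
      have "(\<Sum>i\<in>V. card (B i)) = (\<Sum>i\<in>N \<union> S. card (B i))"
        using V S NV by (intro sum.mono_neutral_right) (auto simp: N_def T_def)
      also have "\<dots> = ?o + ?s" using fS fT by (intro sum.union_disjoint) (auto simp: N_def)
      finally show ?thesis .
    qed
    moreover have "card (G (S \<union> N)) = ?o + card (G S)"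
    proof -
      have "G (S \<union> N) = G N \<union> G S" unfolding G_def by auto
      moreover have "G N \<inter> G S = {}"
      proof (rule ccontr)
        assume "G N \<inter> G S \<noteq> {}"
        then obtain e where e: "e \<in> G N" "e \<in> G S" by blast
        obtain i c where ic: "e = pr i c" "i \<in> N" using e(1) unfolding G_def by auto
        obtain i' c' where "e = pr i' c'" "i' \<in> S" "c' \<in> B i'" using e(2) unfolding G_def by auto
        thus False using ic NV BSZ[of i'] V(3) by (auto simp: pr_eq_iff)
      qed
      moreover have "finite (G N)" "finite (G S)" using fG[of N] fG[of S] NV S by auto
      ultimately show ?thesis using cG[OF NV] by (simp add: card_Un_disjoint)
    qed
    moreover have "?k \<le> card T \<or> ?k \<le> card T + 1 \<and> 2 * ?k \<le> (\<Sum>i\<in>V. card (B i)) + 1"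
      using many unfolding T_def B_def .
    \<comment> \<open>If \<open>card T \<ge> k\<close>, then
      \<open>?o + card (G S) \<ge> 2 * ?r + ?t = ?r + card T\<close> suffices. Otherwise \<open>2 *
      (?o + card (G S)) \<ge> ?o + (?o + ?s) \<ge> 2 * ?r + 2 * ?k - 1\<close>, and integrality
      supplies the missing half.\<close>
    ultimately have "?k + card N \<le> card (G (S \<union> N))" by linarith
    moreover have "card N \<le> ?k" using False unfolding N_def by simp
    ultimately show ?thesis using NV by (intro main[of N]) auto
  qed
qed

section \<open>Solutions of large support\<close>

lemma rowsum_symmetric:
  assumes "finite V"
  shows "(\<Sum>i\<in>V. rowsum f V w i * w' i) = (\<Sum>i\<in>V. rowsum f V w' i * w i)"
proof -
  have "(\<Sum>i\<in>V. rowsum f V w i * w' i) = (\<Sum>i\<in>V. \<Sum>j\<in>V. of_bool (adj f i j) * w j * w' i)"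
    by (simp add: rowsum_mult sum_distrib_right)
  also have "\<dots> = (\<Sum>j\<in>V. \<Sum>i\<in>V. of_bool (adj f i j) * w j * w' i)" by (rule sum.swap)
  also have "\<dots> = (\<Sum>j\<in>V. \<Sum>i\<in>V. of_bool (adj f j i) * w' i * w j)"
    by (simp add: adj_commute[of f] mult_ac)
  also have "\<dots> = (\<Sum>i\<in>V. rowsum f V w' i * w i)" by (simp add: rowsum_mult sum_distrib_right)
  finally show ?thesis .
qed

text \<open>If the quadratic form of a symmetric matrix vanishes on the four vertices of a parallelogram in
  its image, its polar form vanishes on the two edges.\<close>

lemma rowsum_parallelogram:
  fixes a00 a10 a01 a11 w00 w10 w01 w11 w :: "nat \<Rightarrow> real"
  assumes V: "finite V"
    and w: "\<forall>i\<in>V. rowsum g V w00 i = a00 i" "\<forall>i\<in>V. rowsum g V w10 i = a10 i"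
      "\<forall>i\<in>V. rowsum g V w01 i = a01 i" "\<forall>i\<in>V. rowsum g V w11 i = a11 i"
      "\<forall>i\<in>V. rowsum g V w i = a00 i - a10 i"
    and q: "(\<Sum>i\<in>V. a00 i * w00 i) = 0" "(\<Sum>i\<in>V. a10 i * w10 i) = 0"
      "(\<Sum>i\<in>V. a01 i * w01 i) = 0" "(\<Sum>i\<in>V. a11 i * w11 i) = 0"
    and para: "\<forall>i\<in>V. a11 i = a10 i + a01 i - a00 i"
  shows "(\<Sum>i\<in>V. (a00 i - a01 i) * w i) = 0"
proof -
  define B where "B a z = (\<Sum>i\<in>V. a i * z i)" for a z :: "nat \<Rightarrow> real"
  have B: "(\<Sum>i\<in>V. rowsum g V z i * z' i) = B a z'" if "\<forall>i\<in>V. rowsum g V z i = a i" for z z' a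
    unfolding B_def using that by simp
  have sym: "B a z' = B a' z" if "\<forall>i\<in>V. rowsum g V z i = a i" "\<forall>i\<in>V. rowsum g V z' i = a' i" for a z a' z'
    using rowsum_symmetric[OF V, of g z z'] B[OF that(1)] B[OF that(2)] by simp
  have lin: "B a11 z = B a10 z + B a01 z - B a00 z" for z
    unfolding B_def sum.distrib[symmetric] sum_subtractf[symmetric]
  proof (intro sum.cong refl)
    fix i assume "i \<in> V"
    hence "a11 i = a10 i + a01 i - a00 i" using para by blast
    thus "a11 i * z i = a10 i * z i + a01 i * z i - a00 i * z i"
      by (simp only: left_diff_distrib distrib_right)
  qed
  have linw: "B (\<lambda>i. a00 i - a10 i) z = B a00 z - B a10 z" for z
    unfolding B_def by (simp add: left_diff_distrib sum_subtractf)
  have q': "B a00 w00 = 0" "B a10 w10 = 0" "B a01 w01 = 0" "B a11 w11 = 0" unfolding B_def using q by auto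
  have "B a00 w = B (\<lambda>i. a00 i - a10 i) w00" "B a01 w = B (\<lambda>i. a00 i - a10 i) w01"
    using sym[OF w(1,5)] sym[OF w(3,5)] by auto
  moreover have "B a10 w11 = B a11 w10" "B a01 w11 = B a11 w01" "B a00 w11 = B a11 w00"
    "B a10 w00 = B a00 w10" "B a01 w00 = B a00 w01" "B a10 w01 = B a01 w10"
    using sym[OF w(2,4)] sym[OF w(3,4)] sym[OF w(1,4)] sym[OF w(2,1)] sym[OF w(3,1)] sym[OF w(2,3)] by auto
  \<comment> \<open>The form at \<open>a11\<close> expands into the three other values, which are
    zero, and twice a sum of mixed terms; that sum is the difference on the left.\<close>
  ultimately have "B a00 w - B a01 w = 0"
    using q' lin[of w11] lin[of w10] lin[of w01] lin[of w00] linw[of w00] linw[of w01] by linarith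
  thus ?thesis unfolding B_def by (simp add: left_diff_distrib sum_subtractf)
qed

section \<open>Sparse solutions of the decoupled linear system\<close>

lemma prob_pair_split_le:
  assumes "measure_pmf.prob M {x. B x} \<le> \<beta>"
    and "\<And>x. x \<in> set_pmf M \<Longrightarrow> \<not> B x \<Longrightarrow> measure_pmf.prob N {y. (x, y) \<in> E} \<le> \<eta>"
    and "0 \<le> \<eta>"
  shows "measure_pmf.prob (pair_pmf M N) E \<le> \<beta> + \<eta>"
proof -
  have "measure_pmf.prob (pair_pmf M N) E
      \<le> measure_pmf.expectation M (\<lambda>x. indicator {x. B x} x + \<eta>)"
    unfolding prob_pair_pmf
  proof (rule integral_mono_AE)
    show "integrable (measure_pmf M) (\<lambda>x. indicator {x. B x} x + \<eta>)"
      by (rule measure_pmf.integrable_const_bound[of _ "1 + \<eta>"]) (use assms(3) in \<open>auto simp: indicator_def\<close>)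
    have "measure_pmf.prob N {y. (x, y) \<in> E} \<le> indicator {x. B x} x + \<eta>" if "x \<in> set_pmf M" for x
    proof (cases "B x")
      case True
      have "measure_pmf.prob N {y. (x, y) \<in> E} \<le> 1" by simp
      thus ?thesis using True assms(3) by (simp add: add_increasing2)
    qed (use assms(2) that in auto)
    thus "AE x in M. measure_pmf.prob N {y. (x, y) \<in> E} \<le> indicator {x. B x} x + \<eta>"
      by (simp add: AE_measure_pmf_iff)
  qed simp
  also have "\<dots> = measure_pmf.prob M {x. B x} + \<eta>"
    by (subst Bochner_Integration.integral_add) (auto intro: measure_pmf.integrable_const_bound[of _ 1])
  finally show ?thesis using assms(1) by simp
qed

lemma coins_reindex:
  assumes "finite U" "inj h"
  shows "coins p U = map_pmf (\<lambda>f i. f (h i)) (coins p (h ` U))"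
  using Pi_pmf_bij_betw[of U h "h ` U" False "bernoulli_pmf p"] assms
  by (auto simp: bij_betw_def inj_on_def inj_def comp_def inj_image_mem_iff)

lemma prob_coins_pair:
  assumes "finite I" "finite J" "finite J'" "I \<inter> (J \<union> J') = {}" "J \<inter> J' = {}"
  shows "measure_pmf.prob (coins p (I \<union> (J \<union> J'))) E
    = measure_pmf.prob (pair_pmf (coins p I) (pair_pmf (coins p J) (coins p J')))
        {(g, h, h'). override_on g (override_on h h' J') (J \<union> J') \<in> E}"
  using assms by (simp add: coins_Un prob_pair_pmf vimage_def case_prod_unfold)

text \<open>Appending the columns \<open>z\<close> and \<open>z'\<close> with coefficients -1 and 1
  makes the system homogeneous, so a row with exactly one entry would annihilate a nonzero
  coefficient. The columns in \<open>S\<close> are independent, since a kernel vector could be used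
  to cancel an entry of \<open>w\<close>; hence there are \<open>k\<close> nonzero rows, one more
  than a dependency guarantees.\<close>

lemma minimal_solution_small_event:
  fixes w :: "nat \<Rightarrow> real" and p K :: real
  assumes V: "finite V" "U \<subseteq> V" and z: "z \<notin> V" "z' \<notin> V" "z \<noteq> z'"
    and S: "S \<subseteq> V" "S \<noteq> {}" "card S * p \<le> K"
    and sol: "\<forall>i\<in>V. rowsum g S w i = of_bool (i \<in> U \<and> x i) - of_bool (i \<in> U \<and> x' i)"
    and full: "\<And>w'. (\<forall>i\<in>V. rowsum g S w' i = of_bool (i \<in> U \<and> x i) - of_bool (i \<in> U \<and> x' i)) \<Longrightarrow> \<forall>j\<in>S. w' j \<noteq> 0"
    and f: "\<And>i j. i \<in> V \<Longrightarrow> j \<in> V \<Longrightarrow> f (pr i j) = g (pr i j)"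
      "\<And>i. i \<in> U \<Longrightarrow> f (pr z i) = x i" "\<And>i. i \<in> U \<Longrightarrow> f (pr z' i) = x' i"
  shows "small_event K p V {z, z'} (vpairs V \<union> (pr z ` U \<union> pr z' ` U)) f"
proof -
  let ?I = "vpairs V \<union> (pr z ` U \<union> pr z' ` U)"
  let ?A = "\<lambda>i. {c\<in>S \<union> {z, z'}. pr i c \<in> ?I \<and> f (pr i c)}"
  have fS: "finite S" using S V finite_subset by blast
  have A: "?A i = {c\<in>S. adj g i c} \<union> {c. c = z \<and> i \<in> U \<and> x i} \<union> {c. c = z' \<and> i \<in> U \<and> x' i}"
    if i: "i \<in> V" for i
  proof -
    have 1: "pr i c \<in> ?I \<and> f (pr i c) \<longleftrightarrow> adj g i c" if "c \<in> S" for c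
    proof -
      have "pr i c \<in> ?I \<longleftrightarrow> i \<noteq> c" using that S i z by (auto simp: pr_eq_iff)
      moreover have "f (pr i c) = g (pr i c)" using that S i by (intro f) auto
      ultimately show ?thesis by (auto simp: adj_def)
    qed
    have 2: "pr i z \<in> ?I \<and> f (pr i z) \<longleftrightarrow> i \<in> U \<and> x i"
    proof -
      have "pr i z \<in> ?I \<longleftrightarrow> i \<in> U" using i z V by (auto simp: pr_eq_iff)
      thus ?thesis using f(2)[of i] by (auto simp: pr_commute[of i])
    qed
    have 3: "pr i z' \<in> ?I \<and> f (pr i z') \<longleftrightarrow> i \<in> U \<and> x' i"
    proof -
      have "pr i z' \<in> ?I \<longleftrightarrow> i \<in> U" using i z V by (auto simp: pr_eq_iff)
      thus ?thesis using f(3)[of i] by (auto simp: pr_commute[of i])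
    qed
    show ?thesis using 1 2 3 by blast
  qed
  have rs: "rowsum g S y i = sum y {c\<in>S. adj g i c}" for y i
    unfolding rowsum_def using fS by (simp add: sum.inter_filter)
  have w0: "\<forall>j\<in>S. w j \<noteq> 0" using full[OF sol] .
  show ?thesis
  proof (rule small_eventI)
    fix i assume i: "i \<in> V"
    show "card (?A i) \<noteq> 1"
    proof
      assume "card (?A i) = 1"
      then obtain c where "?A i = {c}" using card_1_singletonE by blast
      hence c: "{c\<in>S. adj g i c} \<union> {c. c = z \<and> i \<in> U \<and> x i} \<union> {c. c = z' \<and> i \<in> U \<and> x' i} = {c}"
        (is "?a \<union> ?b \<union> ?b' = _") unfolding A[OF i] .
      have zS: "z \<notin> S" "z' \<notin> S" using z S by auto
      have 1: "i \<in> U \<and> x i \<longleftrightarrow> c = z"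
      proof
        assume "i \<in> U \<and> x i"
        hence "z \<in> ?a \<union> ?b \<union> ?b'" by simp
        thus "c = z" unfolding c by simp
      next
        assume "c = z"
        hence "z \<in> ?a \<union> ?b \<union> ?b'" using c by simp
        thus "i \<in> U \<and> x i" using zS z(3) by simp
      qed
      have 2: "i \<in> U \<and> x' i \<longleftrightarrow> c = z'"
      proof
        assume "i \<in> U \<and> x' i"
        hence "z' \<in> ?a \<union> ?b \<union> ?b'" by simp
        thus "c = z'" unfolding c by simp
      next
        assume "c = z'"
        hence "z' \<in> ?a \<union> ?b \<union> ?b'" using c by simp
        thus "i \<in> U \<and> x' i" using zS z(3) by simp
      qed
      have 3: "?a = (if c \<in> S then {c} else {})"
      proof (cases "c \<in> S")
        case True
        hence "c \<noteq> z" "c \<noteq> z'" using zS by auto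
        hence e: "?b = {}" "?b' = {}" using 1 2 by auto
        show ?thesis using c True unfolding e by simp
      next
        case False
        have "?a \<subseteq> {c}" using c by blast
        thus ?thesis using False by auto
      qed
      have sol': "rowsum g S w i = of_bool (c = z) - of_bool (c = z')"
      proof -
        have "rowsum g S w i = of_bool (i \<in> U \<and> x i) - of_bool (i \<in> U \<and> x' i)" using sol i by blast
        thus ?thesis unfolding 1 2 .
      qed
      have rw: "rowsum g S w i = (if c \<in> S then w c else 0)" unfolding rs 3 by simp
      have "c \<in> S \<union> {z, z'}" using c by blast
      moreover have False if "c \<in> S"
      proof -
        have "c \<noteq> z" "c \<noteq> z'" using that zS by auto
        hence "w c = 0" using sol' rw that by simp
        thus False using w0 that by blast
      qed
      ultimately have "c \<notin> S" "c = z \<or> c = z'" by auto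
      thus False using sol' rw z(3) by auto
    qed
  next
    let ?T = "{i\<in>V. ?A i \<noteq> {}}"
    have "card S \<le> card ?T"
    proof (rule ccontr)
      assume "\<not> card S \<le> card ?T"
      hence lt: "card ?T < card S" by simp
      have fT: "finite ?T" using V by simp
      obtain y where y: "\<exists>j\<in>S. y j \<noteq> 0" "\<forall>i\<in>?T. (\<Sum>j\<in>S. of_bool (adj g i j) * y j) = (0::real)"
        using nontrivial_kernel[OF fT fS lt, of "\<lambda>i j. of_bool (adj g i j)"] by (elim exE conjE) (rule that)
      then obtain j0 where j0: "j0 \<in> S" "y j0 \<noteq> 0" by (elim bexE)
      have ker: "rowsum g S y i = 0" if "i \<in> V" for i
      proof (cases "i \<in> ?T")
        case True
        thus ?thesis using y(2) unfolding rowsum_mult by (elim ballE) auto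
      next
        case False
        hence "?A i = {}" using that by simp
        hence e: "{c\<in>S. adj g i c} = {}" unfolding A[OF that] by blast
        show ?thesis unfolding rs e by simp
      qed
      define w' where "w' j = w j - w j0 / y j0 * y j" for j
      have "rowsum g S w' i = rowsum g S w i" if "i \<in> V" for i
      proof -
        have "rowsum g S (\<lambda>j. w j0 / y j0 * y j) i = w j0 / y j0 * rowsum g S y i"
          unfolding rowsum_mult by (simp add: sum_distrib_left mult_ac)
        thus ?thesis using ker[OF that] unfolding w'_def rowsum_diff by simp
      qed
      hence "\<forall>j\<in>S. w' j \<noteq> 0" using sol by (intro full) simp
      thus False using j0 unfolding w'_def by auto
    qed
    thus "card S \<le> card ?T \<or> card S \<le> card ?T + 1 \<and> 2 * card S \<le> (\<Sum>i\<in>V. card (?A i)) + 1" ..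
  qed (use V z S in auto)
qed

text \<open>A sparse solution has intermediate size (\<open>E1\<close>) or can be replaced by one of
  least support inside its own. If that support is empty, the two copies coincide on
  \<open>U\<close> (\<open>E2\<close>); otherwise no solution on it has a zero entry, and the copies
  act as the extra columns of the small event (\<open>E3\<close>).\<close>

lemma prob_sparse_solution_le:
  fixes p K \<delta> :: real
  assumes V: "finite V" "U \<subseteq> V" and z: "z \<notin> V" "z' \<notin> V" "z \<noteq> z'" and p: "0 \<le> p"
    and LO: "\<And>(I :: (nat \<times> nat) set) w c. finite I \<Longrightarrow> K \<le> real (card {i\<in>I. w i \<noteq> (0::real)}) * p \<Longrightarrow>
       measure_pmf.prob (coins p I) {f. (\<Sum>i\<in>I. if f i then w i else 0) = c} \<le> 1 / 1024"
    and LO_U: "\<And>c. measure_pmf.prob (coins p U) {x. (\<Sum>i\<in>U. if x i then 1 else 0) = (c::real)} \<le> \<delta>"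
    and small: "measure_pmf.prob (coins p (vpairs V \<union> (pr z ` U \<union> pr z' ` U)))
       {f. small_event K p V {z, z'} (vpairs V \<union> (pr z ` U \<union> pr z' ` U)) f} \<le> \<delta>"
    and n: "(1 / 8) ^ card V \<le> \<delta>"
  shows "measure_pmf.prob (pair_pmf (coins p (vpairs V)) (pair_pmf (coins p U) (coins p U)))
    {(g, x, x'). \<exists>S w. S \<subseteq> V \<and> 4 * card S \<le> card V \<and> (\<forall>j\<in>S. w j \<noteq> (0::real)) \<and>
       (\<forall>i\<in>V. rowsum g S w i = of_bool (i \<in> U \<and> x i) - of_bool (i \<in> U \<and> x' i))} \<le> 3 * \<delta>"
proof -
  let ?M = "coins p (vpairs V)" and ?X = "coins p U"
  define sol where "sol g x x' S w \<longleftrightarrow>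
    (\<forall>i\<in>V. rowsum g S w i = of_bool (i \<in> U \<and> x i) - of_bool (i \<in> U \<and> x' i))" for g S w and x x' :: "nat \<Rightarrow> bool"
  define E where "E = {(g, x, x'). \<exists>S w. S \<subseteq> V \<and> 4 * card S \<le> card V \<and> (\<forall>j\<in>S. w j \<noteq> (0::real)) \<and> sol g x x' S w}"
  define E1 where "E1 = {(g, x, x'). \<exists>S w. S \<subseteq> V \<and> 4 * card S \<le> card V \<and> K \<le> card S * p \<and>
      (\<forall>j\<in>S. w j \<noteq> 0) \<and> sol g x x' S w}"
  \<comment> \<open>Equality of the copies is relaxed to equal numbers of successes, a
    Littlewood--Offord event with unit weights.\<close>
  define E2 where "E2 = {(g :: nat \<times> nat \<Rightarrow> bool, x, x'). (\<Sum>i\<in>U. if x' i then 1 else 0) = (\<Sum>i\<in>U. if x i then 1 else (0::real))}"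
  define E3 where "E3 = {(g, x, x'). \<exists>S w. S \<subseteq> V \<and> S \<noteq> {} \<and> card S * p \<le> K \<and> sol g x x' S w \<and>
      (\<forall>w'. sol g x x' S w' \<longrightarrow> (\<forall>j\<in>S. w' j \<noteq> 0))}"
  have fU: "finite U" using V finite_subset by blast
  have "E \<subseteq> E1 \<union> (E2 \<union> E3)"
  proof
    fix t assume "t \<in> E"
    then obtain g x x' S w where t: "t = (g, x, x')" and S: "S \<subseteq> V" "4 * card S \<le> card V" "\<forall>j\<in>S. w j \<noteq> 0"
      and w: "sol g x x' S w" unfolding E_def by auto
    show "t \<in> E1 \<union> (E2 \<union> E3)"
    proof (cases "K \<le> card S * p")
      case True
      thus ?thesis using S w unfolding t E1_def by blast
    next
      case False
      let ?Q = "\<lambda>S'. S' \<subseteq> S \<and> (\<exists>w'. sol g x x' S' w')"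
      have "?Q S" using w by blast
      from ex_has_least_nat[of ?Q, OF this, of card]
      obtain S0 where S0: "S0 \<subseteq> S" "\<exists>w'. sol g x x' S0 w'"
        and least: "\<forall>S'. ?Q S' \<longrightarrow> card S0 \<le> card S'" by blast
      obtain w0 where w0: "sol g x x' S0 w0" using S0 by blast
      have fS: "finite S" "finite S0" using S S0 V finite_subset by metis+
      have full: "\<forall>j\<in>S0. w' j \<noteq> 0" if w': "sol g x x' S0 w'" for w'
      proof (rule ccontr)
        assume "\<not> ?thesis"
        then obtain j where j: "j \<in> S0" "w' j = 0" by blast
        have "rowsum g (S0 - {j}) w' i = rowsum g S0 w' i" for i
          unfolding rowsum_def using j fS by (intro sum.mono_neutral_left) auto
        hence "sol g x x' (S0 - {j}) w'" using w' unfolding sol_def by simp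
        hence "?Q (S0 - {j})" using S0(1) by blast
        hence "card S0 \<le> card (S0 - {j})" using least by blast
        thus False using j fS by (metis card_Diff1_less not_le)
      qed
      show ?thesis
      proof (cases "S0 = {}")
        case True
        hence "of_bool (i \<in> U \<and> x i) = (of_bool (i \<in> U \<and> x' i) :: real)" if "i \<in> V" for i
          using w0 that unfolding sol_def rowsum_def by auto
        hence "x i = x' i" if "i \<in> U" for i using that V by (force simp: of_bool_eq_iff)
        thus ?thesis unfolding t E2_def by simp
      next
        case False
        have "card S0 \<le> card S" using S0 fS by (intro card_mono) auto
        hence "card S0 * p \<le> card S * p" using p by (intro mult_right_mono) auto
        hence "card S0 * p \<le> K" using \<open>\<not> K \<le> card S * p\<close> by linarith
        thus ?thesis using False S0 S w0 full unfolding t E3_def by blast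
      qed
    qed
  qed
  hence "measure_pmf.prob (pair_pmf ?M (pair_pmf ?X ?X)) E \<le> measure_pmf.prob (pair_pmf ?M (pair_pmf ?X ?X)) (E1 \<union> (E2 \<union> E3))"
    by (intro measure_pmf.finite_measure_mono) auto
  also have "\<dots> \<le> measure_pmf.prob (pair_pmf ?M (pair_pmf ?X ?X)) E1 + measure_pmf.prob (pair_pmf ?M (pair_pmf ?X ?X)) (E2 \<union> E3)"
    by (rule measure_Un_le) auto
  also have "measure_pmf.prob (pair_pmf ?M (pair_pmf ?X ?X)) (E2 \<union> E3)
      \<le> measure_pmf.prob (pair_pmf ?M (pair_pmf ?X ?X)) E2 + measure_pmf.prob (pair_pmf ?M (pair_pmf ?X ?X)) E3"
    by (rule measure_Un_le) auto
  also have "measure_pmf.prob (pair_pmf ?M (pair_pmf ?X ?X)) E1 \<le> \<delta>"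
  proof -
    \<comment> \<open>The copies are drawn first, so that the right-hand side of the system is a
      fixed vector while \<open>g\<close> is random.\<close>
    have "measure_pmf.prob (pair_pmf (pair_pmf ?X ?X) ?M) {(y, x). (x, y) \<in> E1} \<le> (1 / 8) ^ card V"
    proof (rule prob_pair_pmf_le)
      fix xx :: "(nat \<Rightarrow> bool) \<times> (nat \<Rightarrow> bool)"
      obtain x x' where "xx = (x, x')" by (cases xx)
      thus "measure_pmf.prob ?M {g. (xx, g) \<in> {(y, x). (x, y) \<in> E1}} \<le> (1 / 8) ^ card V"
        using prob_midsize_solution_le[OF LO V(1), where u = "\<lambda>i. of_bool (i \<in> U \<and> x i) - of_bool (i \<in> U \<and> x' i)"]
        unfolding E1_def sol_def by simp
    qed
    thus ?thesis using n by (subst prob_pair_pmf_swap) simp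
  qed
  also have "measure_pmf.prob (pair_pmf ?M (pair_pmf ?X ?X)) E2 \<le> \<delta>"
  proof (rule prob_pair_pmf_le)
    fix g
    show "measure_pmf.prob (pair_pmf ?X ?X) {y. (g, y) \<in> E2} \<le> \<delta>"
    proof (rule prob_pair_pmf_le)
      fix x
      show "measure_pmf.prob ?X {x'. (x, x') \<in> {y. (g, y) \<in> E2}} \<le> \<delta>"
        using LO_U unfolding E2_def by simp
    qed
  qed
  also have "measure_pmf.prob (pair_pmf ?M (pair_pmf ?X ?X)) E3 \<le> \<delta>"
  proof -
    \<comment> \<open>Placing the copies on the pairs of \<open>U\<close> with two vertices outside
      \<open>V\<close> turns the triple into a single family of coins.\<close>
    let ?J = "pr z ` U" and ?J' = "pr z' ` U"
    let ?N = "pair_pmf ?M (pair_pmf (coins p ?J) (coins p ?J'))"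
    have inj: "inj (pr z)" "inj (pr z')" by auto
    have dj: "vpairs V \<inter> (?J \<union> ?J') = {}" "?J \<inter> ?J' = {}" using z V by (auto simp: pr_eq_iff)
    have "measure_pmf.prob (pair_pmf ?M (pair_pmf ?X ?X)) E3
        = measure_pmf.prob ?N {(g, h, h'). (g, (\<lambda>i. h (pr z i)), (\<lambda>i. h' (pr z' i))) \<in> E3}"
      by (subst (2) coins_reindex[OF fU inj(2)], subst coins_reindex[OF fU inj(1)])
         (simp add: prob_pair_pmf vimage_def case_prod_unfold)
    also have "\<dots> \<le> measure_pmf.prob ?N {(g, h, h'). override_on g (override_on h h' ?J') (?J \<union> ?J') \<in>
        {f. small_event K p V {z, z'} (vpairs V \<union> (?J \<union> ?J')) f}}"
    proof (rule measure_pmf.finite_measure_mono, rule subsetI)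
      fix t assume "t \<in> {(g, h, h'). (g, (\<lambda>i. h (pr z i)), (\<lambda>i. h' (pr z' i))) \<in> E3}"
      then obtain g h h' where t: "t = (g, h, h')" and "(g, (\<lambda>i. h (pr z i)), (\<lambda>i. h' (pr z' i))) \<in> E3"
        by (cases t) auto
      hence "\<exists>S w. S \<subseteq> V \<and> S \<noteq> {} \<and> card S * p \<le> K \<and> sol g (\<lambda>i. h (pr z i)) (\<lambda>i. h' (pr z' i)) S w \<and>
          (\<forall>w'. sol g (\<lambda>i. h (pr z i)) (\<lambda>i. h' (pr z' i)) S w' \<longrightarrow> (\<forall>j\<in>S. w' j \<noteq> 0))"
        unfolding E3_def by simp
      then obtain S w where S: "S \<subseteq> V" "S \<noteq> {}" "card S * p \<le> K"
        and w: "sol g (\<lambda>i. h (pr z i)) (\<lambda>i. h' (pr z' i)) S w"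
        and full: "\<forall>w'. sol g (\<lambda>i. h (pr z i)) (\<lambda>i. h' (pr z' i)) S w' \<longrightarrow> (\<forall>j\<in>S. w' j \<noteq> 0)"
        by (elim exE conjE)
      let ?f = "override_on g (override_on h h' ?J') (?J \<union> ?J')"
      have "small_event K p V {z, z'} (vpairs V \<union> (?J \<union> ?J')) ?f"
      proof (rule minimal_solution_small_event[OF V z S w[unfolded sol_def]])
        fix w' assume "\<forall>i\<in>V. rowsum g S w' i =
          of_bool (i \<in> U \<and> h (pr z i)) - of_bool (i \<in> U \<and> h' (pr z' i))"
        thus "\<forall>j\<in>S. w' j \<noteq> 0" using full unfolding sol_def by blast
      next
        fix i j assume "i \<in> V" "j \<in> V"
        hence "pr i j \<notin> ?J \<union> ?J'" using z by (auto simp: pr_eq_iff)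
        thus "?f (pr i j) = g (pr i j)" by (simp add: override_on_def)
      next
        fix i assume i: "i \<in> U"
        hence "pr z i \<notin> ?J'" using z V by (auto simp: pr_eq_iff)
        thus "?f (pr z i) = h (pr z i)" using i by (simp add: override_on_def)
        show "?f (pr z' i) = h' (pr z' i)" using i by (simp add: override_on_def)
      qed
      thus "t \<in> {(g, h, h'). override_on g (override_on h h' ?J') (?J \<union> ?J') \<in>
        {f. small_event K p V {z, z'} (vpairs V \<union> (?J \<union> ?J')) f}}" unfolding t by simp
    qed simp
    also have "\<dots> = measure_pmf.prob (coins p (vpairs V \<union> (?J \<union> ?J')))
        {f. small_event K p V {z, z'} (vpairs V \<union> (?J \<union> ?J')) f}"
      using V fU dj by (intro prob_coins_pair[symmetric]) auto
    also have "\<dots> \<le> \<delta>" by (rule small)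
    finally show ?thesis .
  qed
  finally show ?thesis unfolding E_def sol_def by simp
qed

section \<open>The bilinear condition at one vertex\<close>

lemma vpairs_insert: "vpairs (insert v V) = vpairs V \<union> pr v ` (V - {v})"
proof (intro equalityI subsetI)
  fix e assume "e \<in> vpairs (insert v V)"
  then obtain i j where e: "e = (i, j)" "i < j" "i \<in> insert v V" "j \<in> insert v V" by (auto simp: vpairs_def)
  hence "e = pr i j" "i \<noteq> j" by (auto simp: pr_def)
  thus "e \<in> vpairs V \<union> pr v ` (V - {v})" using e(3,4) pr_commute by auto
next
  fix e assume "e \<in> vpairs V \<union> pr v ` (V - {v})"
  thus "e \<in> vpairs (insert v V)" using vpairs_mono[of V "insert v V"] by auto
qed

text \<open>The solution \<open>w\<close> of the linear system must be fixed before \<open>y\<close>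
  and \<open>y'\<close> are drawn. It is taken from one admissible \<open>y0\<close>, and the
  parallelogram identity applies to it whatever the solutions at the four corners are. Outside the
  sparse event its support exceeds a quarter of \<open>V\<close>, so orthogonality to the difference
  of \<open>y\<close> and \<open>y'\<close> is rare already in \<open>y'\<close> alone.\<close>

lemma prob_kernel_entry_le_bilinear:
  fixes p \<beta> \<eta> :: real
  assumes V: "finite V" "v \<notin> V" "U \<subseteq> V" and \<eta>: "0 \<le> \<eta>"
    and sparse: "measure_pmf.prob (pair_pmf (coins p (vpairs V)) (pair_pmf (coins p U) (coins p U)))
      {(g, x, x'). \<exists>S w. S \<subseteq> V \<and> 4 * card S \<le> card V \<and> (\<forall>j\<in>S. w j \<noteq> (0::real)) \<and>
         (\<forall>i\<in>V. rowsum g S w i = of_bool (i \<in> U \<and> x i) - of_bool (i \<in> U \<and> x' i))} \<le> \<beta>"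
    and LO: "\<And>w c. card V < 4 * card {j\<in>V. w j \<noteq> (0::real)} \<Longrightarrow>
      measure_pmf.prob (coins p (V - U)) {y. (\<Sum>i\<in>V - U. if y i then w i else 0) = c} \<le> \<eta>"
  shows "measure_pmf.prob (coins p (vpairs (insert v V)))
      {f. \<exists>w. (\<forall>i\<in>insert v V. rowsum f (insert v V) w i = 0) \<and> w v \<noteq> 0} ^ 4 \<le> \<beta> + \<eta>"
proof -
  let ?W = "insert v V" and ?U' = "V - U" and ?J = "pr v ` V"
  let ?M = "coins p (vpairs V)" and ?X = "coins p U" and ?Y = "coins p (V - U)"
  define Q where "Q g x \<longleftrightarrow> (\<exists>w. (\<forall>i\<in>V. rowsum g V w i = of_bool (x i)) \<and> (\<Sum>i\<in>V. of_bool (x i) * w i) = 0)"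
    for g and x :: "nat \<Rightarrow> bool"
  define E where "E = {(g, x, x'). \<exists>S w. S \<subseteq> V \<and> 4 * card S \<le> card V \<and> (\<forall>j\<in>S. w j \<noteq> (0::real)) \<and>
         (\<forall>i\<in>V. rowsum g S w i = of_bool (i \<in> U \<and> x i) - of_bool (i \<in> U \<and> x' i))}"
  have fU: "finite U" using V finite_subset by blast
  have Vv: "V - {v} = V" using V by auto
  have dj: "vpairs V \<inter> ?J = {}" using V by (auto simp: pr_eq_iff)
  have cW: "coins p (vpairs ?W) = map_pmf (\<lambda>(g, h). override_on g h ?J) (pair_pmf ?M (coins p ?J))"
    unfolding vpairs_insert Vv using V dj by (intro coins_Un) auto
  have cV: "coins p V = map_pmf (\<lambda>(x, y). override_on x y ?U') (pair_pmf ?X ?Y)"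
    using coins_Un[of U ?U' p] V fU by (simp add: Un_absorb1)
  have "measure_pmf.prob (coins p (vpairs ?W)) {f. \<exists>w. (\<forall>i\<in>?W. rowsum f ?W w i = 0) \<and> w v \<noteq> 0}
      = measure_pmf.prob (pair_pmf ?M (coins p ?J)) {(g, h). \<exists>w. (\<forall>i\<in>?W. rowsum (override_on g h ?J) ?W w i = 0) \<and> w v \<noteq> 0}"
    unfolding cW by (simp add: vimage_def case_prod_unfold)
  also have "\<dots> \<le> measure_pmf.prob (pair_pmf ?M (coins p ?J)) {(g, h). Q g (\<lambda>i. h (pr v i))}"
  proof (rule measure_pmf.finite_measure_mono, rule subsetI)
    fix t assume "t \<in> {(g, h). \<exists>w. (\<forall>i\<in>?W. rowsum (override_on g h ?J) ?W w i = 0) \<and> w v \<noteq> 0}"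
    then obtain g h w where t: "t = (g, h)" and ker: "\<forall>i\<in>?W. rowsum (override_on g h ?J) ?W w i = 0" and wv: "w v \<noteq> 0"
      by auto
    let ?f = "override_on g h ?J"
    have fV: "adj ?f i j = adj g i j" if "i \<in> V" "j \<in> V" for i j
    proof -
      have "pr i j \<notin> ?J" using that V by (auto simp: pr_eq_iff)
      thus ?thesis by (simp add: adj_def override_on_def)
    qed
    have fv: "adj ?f v i = h (pr v i)" if "i \<in> V" for i
      using that V by (auto simp: adj_def override_on_def)
    define w' where "w' i = - w i / w v" for i
    have w': "rowsum g V w' i = - rowsum g V w i / w v" for i
      unfolding rowsum_mult w'_def by (simp add: sum_divide_distrib sum_negf)
    have "rowsum g V w' i = of_bool (h (pr v i))" if i: "i \<in> V" for i
    proof -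
      have "rowsum ?f ?W w i = of_bool (adj ?f i v) * w v + (\<Sum>j\<in>V. of_bool (adj ?f i j) * w j)"
        unfolding rowsum_mult using V by simp
      also have "(\<Sum>j\<in>V. of_bool (adj ?f i j) * w j) = rowsum g V w i"
        unfolding rowsum_mult using fV[OF i] by (intro sum.cong) auto
      finally have "of_bool (h (pr v i)) * w v + rowsum g V w i = 0"
        using ker i fv[OF i] by (simp add: adj_commute[of ?f i v])
      hence "rowsum g V w i = - (of_bool (h (pr v i)) * w v)" by linarith
      thus ?thesis unfolding w' using wv by simp
    qed
    moreover have "(\<Sum>i\<in>V. of_bool (h (pr v i)) * w' i) = 0"
    proof -
      have "0 = rowsum ?f ?W w v" using ker by simp
      also have "\<dots> = (\<Sum>j\<in>V. of_bool (adj ?f v j) * w j)"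
      proof -
        have "\<not> adj ?f v v" by (simp add: adj_def)
        thus ?thesis unfolding rowsum_mult using V by simp
      qed
      also have "\<dots> = (\<Sum>j\<in>V. of_bool (h (pr v j)) * w j)" using fv by (intro sum.cong) auto
      finally have "(\<Sum>j\<in>V. of_bool (h (pr v j)) * w j) = 0" by simp
      moreover have "(\<Sum>i\<in>V. of_bool (h (pr v i)) * w' i) = - (\<Sum>j\<in>V. of_bool (h (pr v j)) * w j) / w v"
        unfolding w'_def by (simp only: sum_divide_distrib sum_negf[symmetric] mult_minus_right times_divide_eq_right minus_divide_left)
      ultimately show ?thesis by simp
    qed
    ultimately have "Q g (\<lambda>i. h (pr v i))" unfolding Q_def by (intro exI[of _ w'] conjI ballI)
    thus "t \<in> {(g, h). Q g (\<lambda>i. h (pr v i))}" unfolding t by simp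
  qed simp
  also have "\<dots> = measure_pmf.prob (pair_pmf ?M (coins p V)) {(g, x). Q g x}"
    using coins_reindex[of V "pr v" p] V by (simp add: prob_pair_pmf vimage_def)
  also have "\<dots> = measure_pmf.prob (pair_pmf ?M (pair_pmf ?X ?Y)) {(g, x, y). Q g (override_on x y ?U')}"
    by (simp add: cV prob_pair_pmf vimage_def case_prod_unfold)
  finally have "measure_pmf.prob (coins p (vpairs ?W)) {f. \<exists>w. (\<forall>i\<in>?W. rowsum f ?W w i = 0) \<and> w v \<noteq> 0} ^ 4
      \<le> measure_pmf.prob (pair_pmf ?M (pair_pmf ?X ?Y)) {(g, x, y). Q g (override_on x y ?U')} ^ 4"
    by (intro power_mono) auto
  also have "\<dots> \<le> measure_pmf.prob (pair_pmf (pair_pmf ?M (pair_pmf ?X ?X)) (pair_pmf ?Y ?Y))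
      {((g, x, x'), (y, y')). Q g (override_on x y ?U') \<and> Q g (override_on x' y ?U') \<and>
         Q g (override_on x y' ?U') \<and> Q g (override_on x' y' ?U')}" (is "_ \<le> measure_pmf.prob _ ?F")
    by (rule prob_decouple)
  also have "\<dots> \<le> \<beta> + \<eta>"
  proof (rule prob_pair_split_le[where B = "\<lambda>t. t \<in> E"])
    show "measure_pmf.prob (pair_pmf ?M (pair_pmf ?X ?X)) {t. t \<in> E} \<le> \<beta>" using sparse unfolding E_def by simp
    fix t assume "t \<notin> E"
    obtain g x x' where t: "t = (g, x, x')" by (cases t) auto
    define a :: "(nat \<Rightarrow> bool) \<Rightarrow> (nat \<Rightarrow> bool) \<Rightarrow> nat \<Rightarrow> real"
      where "a x y i = of_bool (override_on x y ?U' i)" for x y i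
    have a: "a x y i = (if i \<in> U then of_bool (x i) else of_bool (y i))" if "i \<in> V" for x y i
      using that by (auto simp: a_def override_on_def)
    show "measure_pmf.prob (pair_pmf ?Y ?Y) {yy. (t, yy) \<in> ?F} \<le> \<eta>"
    proof (cases "\<exists>y y'. (t, y, y') \<in> ?F")
      case False
      hence "{yy. (t, yy) \<in> ?F} = {}" by auto
      thus ?thesis using \<eta> by (simp only: measure_empty)
    next
      case True
      \<comment> \<open>If no pair of copies is admissible there is nothing to bound. The two
        corners share \<open>y0\<close>, so the difference of their solutions has a right-hand side
        supported on \<open>U\<close>.\<close>
      then obtain y0 where "Q g (override_on x y0 ?U')" "Q g (override_on x' y0 ?U')" unfolding t by auto
      then obtain w1 w2 where w12: "\<forall>i\<in>V. rowsum g V w1 i = a x y0 i" "\<forall>i\<in>V. rowsum g V w2 i = a x' y0 i"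
        unfolding Q_def a_def by blast
      define w where "w i = w1 i - w2 i" for i
      have w: "\<forall>i\<in>V. rowsum g V w i = of_bool (i \<in> U \<and> x i) - of_bool (i \<in> U \<and> x' i)"
        unfolding w_def rowsum_diff using w12 by (auto simp: a)
      let ?S = "{j\<in>V. w j \<noteq> 0}"
      have rs: "rowsum g ?S w i = rowsum g V w i" for i
        unfolding rowsum_def using V by (intro sum.mono_neutral_left) auto
      have big: "card V < 4 * card ?S"
      proof (rule ccontr)
        assume "\<not> ?thesis"
        hence "4 * card ?S \<le> card V" by simp
        moreover have "\<forall>i\<in>V. rowsum g ?S w i = of_bool (i \<in> U \<and> x i) - of_bool (i \<in> U \<and> x' i)"
          unfolding rs by (rule w)
        ultimately have "\<exists>S w. S \<subseteq> V \<and> 4 * card S \<le> card V \<and> (\<forall>j\<in>S. w j \<noteq> (0::real)) \<and>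
            (\<forall>i\<in>V. rowsum g S w i = of_bool (i \<in> U \<and> x i) - of_bool (i \<in> U \<and> x' i))"
          by (intro exI[of _ ?S] exI[of _ w] conjI) auto
        thus False using \<open>t \<notin> E\<close> unfolding t E_def mem_Collect_eq case_prod_conv by (rule notE[rotated])
      qed
      let ?L = "\<lambda>y. \<Sum>i\<in>?U'. if y i then w i else 0"
      have "{yy. (t, yy) \<in> ?F} \<subseteq> {(y, y'). ?L y' = ?L y}"
      proof
        fix yy assume "yy \<in> {yy. (t, yy) \<in> ?F}"
        then obtain y y' where yy: "yy = (y, y')" and Q: "Q g (override_on x y ?U')" "Q g (override_on x' y ?U')"
          "Q g (override_on x y' ?U')" "Q g (override_on x' y' ?U')" unfolding t by auto
        have Qa: "\<exists>w. (\<forall>i\<in>V. rowsum g V w i = a x y i) \<and> (\<Sum>i\<in>V. a x y i * w i) = 0"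
          if "Q g (override_on x y ?U')" for x y
          using that unfolding Q_def a_def .
        obtain w00 where w00: "\<forall>i\<in>V. rowsum g V w00 i = a x y i" "(\<Sum>i\<in>V. a x y i * w00 i) = 0"
          using Qa[OF Q(1)] by (elim exE conjE) (rule that)
        obtain w10 where w10: "\<forall>i\<in>V. rowsum g V w10 i = a x' y i" "(\<Sum>i\<in>V. a x' y i * w10 i) = 0"
          using Qa[OF Q(2)] by (elim exE conjE) (rule that)
        obtain w01 where w01: "\<forall>i\<in>V. rowsum g V w01 i = a x y' i" "(\<Sum>i\<in>V. a x y' i * w01 i) = 0"
          using Qa[OF Q(3)] by (elim exE conjE) (rule that)
        obtain w11 where w11: "\<forall>i\<in>V. rowsum g V w11 i = a x' y' i" "(\<Sum>i\<in>V. a x' y' i * w11 i) = 0"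
          using Qa[OF Q(4)] by (elim exE conjE) (rule that)
        have "(\<Sum>i\<in>V. (a x y i - a x y' i) * w i) = 0"
        proof (rule rowsum_parallelogram[OF V(1) w00(1) w10(1) w01(1) w11(1) _ w00(2) w10(2) w01(2) w11(2)])
          show "\<forall>i\<in>V. rowsum g V w i = a x y i - a x' y i" using w by (auto simp: a)
          show "\<forall>i\<in>V. a x' y' i = a x' y i + a x y' i - a x y i" by (auto simp: a)
        qed
        also have "(\<Sum>i\<in>V. (a x y i - a x y' i) * w i) = (\<Sum>i\<in>?U'. (a x y i - a x y' i) * w i)"
          using V by (intro sum.mono_neutral_right) (auto simp: a)
        also have "\<dots> = ?L y - ?L y'"
          unfolding sum_subtractf[symmetric] by (intro sum.cong) (auto simp: a)
        finally show "yy \<in> {(y, y'). ?L y' = ?L y}" unfolding yy by simp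
      qed
      hence "measure_pmf.prob (pair_pmf ?Y ?Y) {yy. (t, yy) \<in> ?F} \<le> measure_pmf.prob (pair_pmf ?Y ?Y) {(y, y'). ?L y' = ?L y}"
        by (intro measure_pmf.finite_measure_mono) auto
      also have "\<dots> \<le> \<eta>"
        using LO[OF big] by (intro prob_pair_pmf_le) simp
      finally show ?thesis .
    qed
  qed (rule \<eta>)
  finally show ?thesis .
qed

text \<open>\<open>U\<close> takes about an eighth of the vertices: enough for the number of
  successes on \<open>U\<close> to spread out, yet a vector with more than a quarter of its entries
  nonzero keeps an eighth of them off \<open>U\<close>. The value of \<open>\<delta>\<close> makes
  \<open>3 * \<delta> + \<delta>\<close> equal to \<open>\<epsilon> ^ 4\<close>.\<close>

lemma kernel_entry_rare:
  fixes \<epsilon> :: real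
  assumes "0 < \<epsilon>"
  obtains D :: real where "\<And>W v (p::real). finite W \<Longrightarrow> v \<in> W \<Longrightarrow> 0 < p \<Longrightarrow> p \<le> 1 / 2 \<Longrightarrow> D \<le> real (card W) * p \<Longrightarrow>
    measure_pmf.prob (coins p (vpairs W)) {f. \<exists>w. (\<forall>i\<in>W. rowsum f W w i = 0) \<and> w v \<noteq> 0} \<le> \<epsilon>"
proof -
  define \<delta> where "\<delta> = \<epsilon> ^ 4 / 4"
  have \<delta>: "0 < \<delta>" unfolding \<delta>_def using assms by simp
  have eta0: "(0::real) < 1 / 1024" by simp
  obtain K0 where K0: "0 < K0" "\<And>(I :: (nat \<times> nat) set) w c (p :: real). finite I \<Longrightarrow> 0 < p \<Longrightarrow> p \<le> 1 / 2 \<Longrightarrow>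
      K0 \<le> real (card {i\<in>I. w i \<noteq> (0::real)}) * p \<Longrightarrow>
      measure_pmf.prob (coins p I) {f. (\<Sum>i\<in>I. if f i then w i else 0) = c} \<le> 1 / 1024"
    by (rule littlewood_offord[where ?'a = "nat \<times> nat", OF eta0]) (rule that)
  obtain K1 where K1: "0 < K1" "\<And>(I :: nat set) w c (p :: real). finite I \<Longrightarrow> 0 < p \<Longrightarrow> p \<le> 1 / 2 \<Longrightarrow>
      K1 \<le> real (card {i\<in>I. w i \<noteq> (0::real)}) * p \<Longrightarrow>
      measure_pmf.prob (coins p I) {f. (\<Sum>i\<in>I. if f i then w i else 0) = c} \<le> \<delta>"
    by (rule littlewood_offord[where ?'a = nat, OF \<delta>]) (rule that)
  obtain D0 where D0: "\<And>V Z I (p::real). finite V \<Longrightarrow> finite Z \<Longrightarrow> V \<inter> Z = {} \<Longrightarrow> card Z \<le> 2 \<Longrightarrow> finite I \<Longrightarrow> vpairs V \<subseteq> I \<Longrightarrow>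
      0 < p \<Longrightarrow> p \<le> 1 / 2 \<Longrightarrow> D0 \<le> real (card V) * p \<Longrightarrow> measure_pmf.prob (coins p I) {f. small_event K0 p V Z I f} \<le> \<delta>"
    by (rule small_event_rare[OF \<delta>, of K0]) (rule that)
  obtain n0 :: nat where n0: "(1 / 8 :: real) ^ n0 \<le> \<delta>"
    using real_arch_pow_inv[OF \<delta>, of "1 / 8"] by (auto intro: less_imp_le)
  show ?thesis
  \<comment> \<open>The \<open>+ 8\<close> covers the rounding in the size of \<open>U\<close>, the
    last \<open>+ 1\<close> the removal of \<open>v\<close>; as \<open>p \<le> 1\<close>, the bound
    by \<open>n0\<close> also makes \<open>(1 / 8) ^ card V\<close> small.\<close>
  proof (rule that[of "max D0 (max n0 (8 * K1 + 8)) + 1"])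
    fix W :: "nat set" and v and p :: real
    assume W: "finite W" "v \<in> W" and p: "0 < p" "p \<le> 1 / 2" and D: "max D0 (max n0 (8 * K1 + 8)) + 1 \<le> card W * p"
    define V where "V = W - {v}"
    let ?n = "card V"
    have V: "finite V" "v \<notin> V" "W = insert v V" using W unfolding V_def by auto
    have "card W * p = ?n * p + p" using V by (simp add: algebra_simps)
    hence np: "D0 \<le> ?n * p" "n0 \<le> ?n * p" "8 * K1 + 8 \<le> ?n * p" using D p by auto
    have "?n * p \<le> ?n" using p by (intro mult_left_le) auto
    hence nn0: "n0 \<le> ?n" using np by linarith
    have "?n div 8 \<le> card V" by simp
    then obtain U where U: "U \<subseteq> V" "card U = ?n div 8" "finite U" by (rule obtain_subset_with_card_n)
    have nU: "real ?n / 8 - 1 \<le> card U" "real (card U) \<le> real ?n / 8" unfolding U(2) by linarith+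
    have small: "K1 \<le> card U * p"
    proof -
      have "K1 \<le> (real ?n / 8 - 1) * p" using np p by (simp add: algebra_simps)
      also have "\<dots> \<le> card U * p" using nU p by (intro mult_right_mono) auto
      finally show ?thesis .
    qed
    \<comment> \<open>The deleted vertex \<open>v\<close> serves as one extra column, a fresh number
      as the other.\<close>
    obtain z' where z': "z' \<notin> insert v V" using V ex_new_if_finite[of "insert v V"] infinite_UNIV_nat by blast
    have "measure_pmf.prob (coins p (vpairs (insert v V)))
      {f. \<exists>w. (\<forall>i\<in>insert v V. rowsum f (insert v V) w i = 0) \<and> w v \<noteq> 0} ^ 4 \<le> 3 * \<delta> + \<delta>"
    proof (rule prob_kernel_entry_le_bilinear[OF V(1,2) U(1)])
      show "measure_pmf.prob (pair_pmf (coins p (vpairs V)) (pair_pmf (coins p U) (coins p U)))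
      {(g, x, x'). \<exists>S w. S \<subseteq> V \<and> 4 * card S \<le> card V \<and> (\<forall>j\<in>S. w j \<noteq> (0::real)) \<and>
         (\<forall>i\<in>V. rowsum g S w i = of_bool (i \<in> U \<and> x i) - of_bool (i \<in> U \<and> x' i))} \<le> 3 * \<delta>"
      proof (rule prob_sparse_solution_le[OF V(1) U(1), of v z' p K0])
        show "measure_pmf.prob (coins p U) {x. (\<Sum>i\<in>U. if x i then 1 else 0) = c} \<le> \<delta>" for c :: real
          using K1(2)[of U p "\<lambda>_. 1" c] U p small by simp
        show "measure_pmf.prob (coins p (vpairs V \<union> (pr v ` U \<union> pr z' ` U)))
          {f. small_event K0 p V {v, z'} (vpairs V \<union> (pr v ` U \<union> pr z' ` U)) f} \<le> \<delta>"
          using V z' U p np by (intro D0) (auto simp: card_insert_if)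
        show "(1 / 8) ^ card V \<le> \<delta>"
          by (rule order_trans[OF power_decreasing n0]) (use nn0 in auto)
      qed (use V z' p K0 in auto)
    next
      fix w :: "nat \<Rightarrow> real" and c
      assume "card V < 4 * card {j\<in>V. w j \<noteq> 0}"
      moreover have "card {j\<in>V. w j \<noteq> 0} \<le> card U + card {i\<in>V - U. w i \<noteq> 0}"
      proof -
        have "card {j\<in>V. w j \<noteq> 0} \<le> card (U \<union> {i\<in>V - U. w i \<noteq> 0})" using V U by (intro card_mono) auto
        also have "\<dots> \<le> card U + card {i\<in>V - U. w i \<noteq> 0}" by (rule card_Un_le)
        finally show ?thesis .
      qed
      ultimately have "real ?n / 8 \<le> card {i\<in>V - U. w i \<noteq> 0}" using nU by linarith
      hence "(real ?n / 8) * p \<le> card {i\<in>V - U. w i \<noteq> 0} * p" using p by (intro mult_right_mono) auto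
      hence "K1 \<le> card {i\<in>V - U. w i \<noteq> 0} * p" using np by linarith
      thus "measure_pmf.prob (coins p (V - U)) {y. (\<Sum>i\<in>V - U. if y i then w i else 0) = c} \<le> \<delta>"
        using V p by (intro K1) auto
    qed (use \<delta> in auto)
    hence "measure_pmf.prob (coins p (vpairs W)) {f. \<exists>w. (\<forall>i\<in>W. rowsum f W w i = 0) \<and> w v \<noteq> 0} ^ 4 \<le> \<epsilon> ^ 4"
      unfolding V(3)[symmetric] \<delta>_def by simp
    thus "measure_pmf.prob (coins p (vpairs W)) {f. \<exists>w. (\<forall>i\<in>W. rowsum f W w i = 0) \<and> w v \<noteq> 0} \<le> \<epsilon>"
      using assms power_mono_iff[of "measure_pmf.prob (coins p (vpairs W)) {f. \<exists>w. (\<forall>i\<in>W. rowsum f W w i = 0) \<and> w v \<noteq> 0}" \<epsilon> 4]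
      by simp
  qed
qed

text \<open>Markov's inequality for the number of vertices that occur in some kernel vector: on the
  event this number exceeds a quarter of \<open>card W\<close>, while each vertex occurs with
  probability at most \<open>\<delta> / 4\<close>.\<close>

lemma large_kernel_rare:
  fixes \<delta> :: real
  assumes "0 < \<delta>"
  obtains D :: real where "\<And>W (p::real). finite W \<Longrightarrow> 0 < p \<Longrightarrow> p \<le> 1 / 2 \<Longrightarrow> D \<le> real (card W) * p \<Longrightarrow>
    measure_pmf.prob (coins p (vpairs W))
      {f. \<exists>w. (\<forall>i\<in>W. rowsum f W w i = 0) \<and> card W < 4 * card {j\<in>W. w j \<noteq> 0}} \<le> \<delta>"
proof -
  have "0 < \<delta> / 4" using assms by simp
  then obtain D where D: "\<And>W v (p::real). finite W \<Longrightarrow> v \<in> W \<Longrightarrow> 0 < p \<Longrightarrow> p \<le> 1 / 2 \<Longrightarrow> D \<le> real (card W) * p \<Longrightarrow>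
    measure_pmf.prob (coins p (vpairs W)) {f. \<exists>w. (\<forall>i\<in>W. rowsum f W w i = 0) \<and> w v \<noteq> 0} \<le> \<delta> / 4"
    by (rule kernel_entry_rare) (rule that)
  show ?thesis
  proof (rule that[of D])
    fix W :: "nat set" and p :: real
    assume W: "finite W" and p: "0 < p" "p \<le> 1 / 2" "D \<le> real (card W) * p"
    let ?M = "coins p (vpairs W)"
    define A where "A = {f. \<exists>w. (\<forall>i\<in>W. rowsum f W w i = 0) \<and> card W < 4 * card {j\<in>W. w j \<noteq> 0}}"
    define E where "E v = {f. \<exists>w. (\<forall>i\<in>W. rowsum f W w i = 0) \<and> w v \<noteq> 0}" for v
    have int: "integrable (measure_pmf ?M) (indicator B :: _ \<Rightarrow> real)" for B
      by (rule measure_pmf.integrable_const_bound[of _ 1]) auto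
    have pt: "real (card W) * indicator A f \<le> 4 * (\<Sum>v\<in>W. indicator (E v) f)" for f
    proof (cases "f \<in> A")
      case True
      then obtain w where w: "\<forall>i\<in>W. rowsum f W w i = 0" "card W < 4 * card {j\<in>W. w j \<noteq> 0}" unfolding A_def by blast
      have "real (card {j\<in>W. w j \<noteq> 0}) = (\<Sum>v\<in>{j\<in>W. w j \<noteq> 0}. 1)" by simp
      also have "\<dots> \<le> (\<Sum>v\<in>{j\<in>W. w j \<noteq> 0}. indicator (E v) f)"
        using w(1) by (intro sum_mono) (auto simp: indicator_def E_def)
      also have "\<dots> \<le> (\<Sum>v\<in>W. indicator (E v) f)" using W by (intro sum_mono2) auto
      finally show ?thesis using w(2) True by simp
    qed (auto intro: sum_nonneg)
    have "real (card W) * measure_pmf.prob ?M A = measure_pmf.expectation ?M (\<lambda>f. real (card W) * indicator A f)"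
      by simp
    also have "\<dots> \<le> measure_pmf.expectation ?M (\<lambda>f. 4 * (\<Sum>v\<in>W. indicator (E v) f))"
      using pt int by (intro integral_mono) auto
    also have "\<dots> = 4 * (\<Sum>v\<in>W. measure_pmf.prob ?M (E v))"
      using int by simp
    also have "\<dots> \<le> 4 * (\<Sum>v\<in>W. \<delta> / 4)"
      unfolding E_def using D W p by (intro mult_left_mono sum_mono) auto
    also have "\<dots> = real (card W) * \<delta>" by simp
    finally have le: "real (card W) * measure_pmf.prob ?M A \<le> real (card W) * \<delta>" .
    show "measure_pmf.prob ?M A \<le> \<delta>"
    proof (cases "card W = 0")
      case True
      hence "W = {}" using W by simp
      hence "A = {}" unfolding A_def by simp
      thus ?thesis using assms by simp
    next
      case False
      thus ?thesis using le by simp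
    qed
  qed
qed

section \<open>Non-tree dependencies\<close>

lemma col_submatrix_random_sym_mat:
  fixes f :: "nat \<times> nat \<Rightarrow> bool"
  defines "A \<equiv> \<lambda>n. mat n n (\<lambda>(i, j). if i = j then 0 else of_bool (f (min i j, max i j)) :: real)"
  assumes S: "S \<subseteq> {..<n}"
  shows "dim_row (col_submatrix (A n) S) = n" "dim_col (col_submatrix (A n) S) = card S"
    "bij_betw (pick S) {..<card S} S"
    "\<And>i j. i < n \<Longrightarrow> j < card S \<Longrightarrow> col_submatrix (A n) S $$ (i, j) = of_bool (adj f i (pick S j))"
proof -
  have "{j. j < n \<and> j \<in> S} = S" using S by auto
  hence c: "card {j. j < dim_col (A n) \<and> j \<in> S} = card S" by (simp add: A_def)
  have r: "card {i. i < dim_row (A n) \<and> i \<in> UNIV} = n" by (simp add: A_def)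
  show "dim_row (col_submatrix (A n) S) = n" "dim_col (col_submatrix (A n) S) = card S"
    unfolding col_submatrix_def dim_submatrix c r by auto
  have fS: "finite S" using S finite_subset by blast
  have inS: "pick S j \<in> S" if "j < card S" for j using pick_in_set_le[OF that] .
  have inj: "inj_on (pick S) {..<card S}"
    by (rule linorder_inj_onI) (use pick_mono_le in \<open>force+\<close>)
  moreover have "pick S ` {..<card S} = S"
    using inS inj fS by (intro card_subset_eq) (auto simp: card_image)
  ultimately show "bij_betw (pick S) {..<card S} S" unfolding bij_betw_def by simp
  fix i j assume ij: "i < n" "j < card S"
  have "col_submatrix (A n) S $$ (i, j) = A n $$ (pick UNIV i, pick S j)"
    unfolding col_submatrix_def using ij c r by (intro submatrix_index) auto
  also have "\<dots> = A n $$ (i, pick S j)" by (simp add: pick_UNIV)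
  also have "\<dots> = of_bool (adj f i (pick S j))"
    using ij inS[OF ij(2)] S by (auto simp: A_def adj_def pr_def)
  finally show "col_submatrix (A n) S $$ (i, j) = of_bool (adj f i (pick S j))" .
qed

text \<open>The deterministic half, split by the size of \<open>S\<close>. Trees are told apart in
  the small range; in the other two, kernel vectors of such support are excluded altogether.\<close>

lemma non_tree_dependency_cases:
  fixes f :: "nat \<times> nat \<Rightarrow> bool" and p K :: real
  defines "A \<equiv> \<lambda>n. mat n n (\<lambda>(i, j). if i = j then 0 else of_bool (f (min i j, max i j)) :: real)"
  assumes S: "S \<subseteq> {..<n}" "S \<noteq> {}"
    and dep: "minimal_dependency (col_submatrix (A n) S)"
    and nt: "col_submatrix (A n) S \<notin> tree_dependencies (card S)"
  shows "small_event K p {..<n} {} (vpairs {..<n}) f \<or>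
    (\<exists>S w. S \<subseteq> {..<n} \<and> 4 * card S \<le> card {..<n} \<and> K \<le> card S * p \<and> (\<forall>j\<in>S. w j \<noteq> 0) \<and> (\<forall>i\<in>{..<n}. rowsum f S w i = 0)) \<or>
    (\<exists>w. (\<forall>i\<in>{..<n}. rowsum f {..<n} w i = 0) \<and> card {..<n} < 4 * card {j\<in>{..<n}. w j \<noteq> 0})"
proof -
  let ?M = "col_submatrix (A n) S" and ?k = "card S" and ?\<sigma> = "pick S"
  have An: "A n = mat n n (\<lambda>(i, j). if i = j then 0 else of_bool (f (min i j, max i j)))"
    by (simp only: A_def)
  note M = col_submatrix_random_sym_mat(1,2)[OF S(1), where f = f, folded An]
    col_submatrix_random_sym_mat(3)[OF S(1)]
    col_submatrix_random_sym_mat(4)[OF S(1), where f = f, folded An]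
  have fS: "finite S" using S finite_subset by blast
  have bin: "elements_mat ?M \<subseteq> {0, 1}"
    using M unfolding elements_mat_def by auto
  obtain x where x: "\<And>j. j < ?k \<Longrightarrow> x j \<noteq> (0::real)" "\<And>i. i < n \<Longrightarrow> (\<Sum>j<?k. ?M $$ (i, j) * x j) = 0"
    using minimal_dependency_kernel[OF dep] unfolding M(1,2) by metis
  \<comment> \<open>Extended by zero, the vector is also a kernel vector of the whole matrix, as the
    large range requires.\<close>
  define w where "w c = (if c \<in> S then x (inv_into {..<?k} ?\<sigma> c) else 0)" for c
  have w_pick: "w (?\<sigma> j) = x j" if "j < ?k" for j
    using that M(3) unfolding w_def bij_betw_def by (auto simp: inv_into_f_f)
  have S_pick: "\<exists>j<?k. c = ?\<sigma> j" if "c \<in> S" for c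
    using that M(3) unfolding bij_betw_def by auto
  have w0: "\<forall>j\<in>S. w j \<noteq> 0" using S_pick w_pick x(1) by metis
  have ker: "rowsum f S w i = 0" if i: "i < n" for i
  proof -
    have "rowsum f S w i = (\<Sum>j<?k. of_bool (adj f i (?\<sigma> j)) * w (?\<sigma> j))"
      unfolding rowsum_mult by (rule sum.reindex_bij_betw[OF M(3), symmetric])
    also have "\<dots> = (\<Sum>j<?k. ?M $$ (i, j) * x j)"
      using M(4)[OF i] w_pick by (intro sum.cong) auto
    finally show ?thesis using x(2)[OF i] by simp
  qed
  have deg: "card {j. j < ?k \<and> ?M $$ (i, j) = 1} = card {c\<in>S. adj f i c}" if i: "i < n" for i
  proof -
    have "{c\<in>S. adj f i c} = ?\<sigma> ` {j. j < ?k \<and> ?M $$ (i, j) = 1}"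
    proof (intro equalityI subsetI)
      fix c assume c: "c \<in> {c\<in>S. adj f i c}"
      then obtain j where "j < ?k" "c = ?\<sigma> j" using S_pick by blast
      thus "c \<in> ?\<sigma> ` {j. j < ?k \<and> ?M $$ (i, j) = 1}" using c M(4)[OF i] by auto
    next
      fix c assume "c \<in> ?\<sigma> ` {j. j < ?k \<and> ?M $$ (i, j) = 1}"
      then obtain j where "j < ?k" "?M $$ (i, j) = 1" "c = ?\<sigma> j" by blast
      thus "c \<in> {c\<in>S. adj f i c}" using M(4)[OF i] bij_betwE[OF M(3)] by auto
    qed
    moreover have "inj_on ?\<sigma> {j. j < ?k \<and> ?M $$ (i, j) = 1}"
      using M(3) unfolding bij_betw_def by (auto intro: inj_on_subset)
    ultimately show ?thesis by (simp add: card_image)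
  qed
  show ?thesis
  proof (cases "?k * p \<le> K")
    case True
    note dich = minimal_dependency_tree_or_dense[OF dep bin, unfolded M(1,2)]
    have adj: "{c\<in>S \<union> {}. pr i c \<in> vpairs {..<n} \<and> f (pr i c)} = {c\<in>S. adj f i c}" if "i < n" for i
      using that S by (auto simp: adj_def)
    have "small_event K p {..<n} {} (vpairs {..<n}) f"
    proof (rule small_eventI)
      fix i assume "i \<in> {..<n}"
      thus "card {c\<in>S \<union> {}. pr i c \<in> vpairs {..<n} \<and> f (pr i c)} \<noteq> 1"
        using dich(1)[of i] deg[of i] adj[of i] by simp
    next
      have "{i. i < n \<and> card {j. j < ?k \<and> ?M $$ (i, j) = 1} \<noteq> 0}
          = {i\<in>{..<n}. {c\<in>S \<union> {}. pr i c \<in> vpairs {..<n} \<and> f (pr i c)} \<noteq> {}}"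
      proof (intro Collect_cong)
        fix i
        show "(i < n \<and> card {j. j < ?k \<and> ?M $$ (i, j) = 1} \<noteq> 0) \<longleftrightarrow>
          (i \<in> {..<n} \<and> {c\<in>S \<union> {}. pr i c \<in> vpairs {..<n} \<and> f (pr i c)} \<noteq> {})"
        proof (cases "i < n")
          case i: True
          show ?thesis unfolding deg[OF i] adj[OF i] using fS i by (simp only: lessThan_iff) (simp add: card_eq_0_iff)
        qed simp
      qed
      moreover have "(\<Sum>i<n. card {j. j < ?k \<and> ?M $$ (i, j) = 1})
          = (\<Sum>i\<in>{..<n}. card {c\<in>S \<union> {}. pr i c \<in> vpairs {..<n} \<and> f (pr i c)})"
        using deg adj by (intro sum.cong) auto
      ultimately show "card S \<le> card {i\<in>{..<n}. {c\<in>S \<union> {}. pr i c \<in> vpairs {..<n} \<and> f (pr i c)} \<noteq> {}} \<or>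
          card S \<le> card {i\<in>{..<n}. {c\<in>S \<union> {}. pr i c \<in> vpairs {..<n} \<and> f (pr i c)} \<noteq> {}} + 1 \<and>
          2 * card S \<le> (\<Sum>i\<in>{..<n}. card {c\<in>S \<union> {}. pr i c \<in> vpairs {..<n} \<and> f (pr i c)}) + 1"
        using dich(2,3) nt by (simp only:) blast
    qed (use S True in auto)
    thus ?thesis by blast
  next
    case False
    show ?thesis
    proof (cases "4 * ?k \<le> n")
      case True
      thus ?thesis using False S w0 ker by (intro disjI2 disjI1 exI[of _ S] exI[of _ w]) auto
    next
      case big: False
      have "rowsum f {..<n} w i = rowsum f S w i" for i
        unfolding rowsum_def using S by (intro sum.mono_neutral_right) (auto simp: w_def)
      moreover have "{j\<in>{..<n}. w j \<noteq> 0} = S" using S w0 by (auto simp: w_def)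
      ultimately show ?thesis using ker big by (intro disjI2 exI[of _ w]) auto
    qed
  qed
qed

lemma non_tree_dependency_rare:
  fixes \<epsilon> :: real
  assumes "0 < \<epsilon>"
  obtains D :: real where "\<And>n (p::real). 0 < p \<Longrightarrow> p \<le> 1 / 2 \<Longrightarrow> D \<le> real n * p \<Longrightarrow>
    measure_pmf.prob (random_sym_mat n p)
            {A. \<forall>k \<ge> 1. \<forall>S \<subseteq> {..<n}. card S = k \<longrightarrow>
                  minimal_dependency (col_submatrix A S) \<longrightarrow>
                  col_submatrix A S \<in> tree_dependencies k} \<ge> 1 - \<epsilon>"
proof -
  define \<delta> where "\<delta> = \<epsilon> / 3"
  have \<delta>: "0 < \<delta>" unfolding \<delta>_def using assms by simp
  have eta0: "(0::real) < 1 / 1024" by simp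
  obtain K where K: "0 < K" "\<And>(I :: (nat \<times> nat) set) w c (p :: real). finite I \<Longrightarrow> 0 < p \<Longrightarrow> p \<le> 1 / 2 \<Longrightarrow>
      K \<le> real (card {i\<in>I. w i \<noteq> (0::real)}) * p \<Longrightarrow>
      measure_pmf.prob (coins p I) {f. (\<Sum>i\<in>I. if f i then w i else 0) = c} \<le> 1 / 1024"
    by (rule littlewood_offord[where ?'a = "nat \<times> nat", OF eta0]) (rule that)
  obtain D0 where D0: "\<And>V Z I (p::real). finite V \<Longrightarrow> finite Z \<Longrightarrow> V \<inter> Z = {} \<Longrightarrow> card Z \<le> 2 \<Longrightarrow> finite I \<Longrightarrow> vpairs V \<subseteq> I \<Longrightarrow>
      0 < p \<Longrightarrow> p \<le> 1 / 2 \<Longrightarrow> D0 \<le> real (card V) * p \<Longrightarrow> measure_pmf.prob (coins p I) {f. small_event K p V Z I f} \<le> \<delta>"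
    by (rule small_event_rare[OF \<delta>, of K]) (rule that)
  obtain D1 where D1: "\<And>W (p::real). finite W \<Longrightarrow> 0 < p \<Longrightarrow> p \<le> 1 / 2 \<Longrightarrow> D1 \<le> real (card W) * p \<Longrightarrow>
    measure_pmf.prob (coins p (vpairs W))
      {f. \<exists>w. (\<forall>i\<in>W. rowsum f W w i = 0) \<and> card W < 4 * card {j\<in>W. w j \<noteq> 0}} \<le> \<delta>"
    by (rule large_kernel_rare[OF \<delta>]) (rule that)
  obtain n0 :: nat where n0: "(1 / 8 :: real) ^ n0 \<le> \<delta>"
    using real_arch_pow_inv[OF \<delta>, of "1 / 8"] by (auto intro: less_imp_le)
  show ?thesis
  proof (rule that[of "max n0 (max D0 D1)"])
    fix n :: nat and p :: real
    assume p: "0 < p" "p \<le> 1 / 2" and "max n0 (max D0 D1) \<le> real n * p"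
    hence np: "n0 \<le> real n * p" "D0 \<le> real n * p" "D1 \<le> real n * p" by auto
    have "real n * p \<le> n" using p by (intro mult_left_le) auto
    hence nn0: "n0 \<le> n" using np by linarith
    let ?M = "coins p (vpairs {..<n})" and ?P = "measure_pmf.prob (coins p (vpairs {..<n}))"
    let ?A = "\<lambda>f. mat n n (\<lambda>(i, j). if i = j then 0 else of_bool (f (min i j, max i j)) :: real)"
    let ?G = "{A. \<forall>k \<ge> 1. \<forall>S \<subseteq> {..<n}. card S = k \<longrightarrow> minimal_dependency (col_submatrix A S) \<longrightarrow>
                  col_submatrix A S \<in> tree_dependencies k}"
    have "{(i, j). i < j \<and> j < n} = vpairs {..<n}" by (auto simp: vpairs_def)
    hence "random_sym_mat n p = map_pmf ?A ?M" unfolding random_sym_mat_def by simp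
    hence eq: "measure_pmf.prob (random_sym_mat n p) (- ?G) = ?P {f. ?A f \<notin> ?G}"
      by (simp add: vimage_def)
    define E1 where "E1 = {f. small_event K p {..<n} {} (vpairs {..<n}) f}"
    define E2 where "E2 = {f. \<exists>S w. S \<subseteq> {..<n} \<and> 4 * card S \<le> card {..<n} \<and> K \<le> card S * p \<and>
        (\<forall>j\<in>S. w j \<noteq> 0) \<and> (\<forall>i\<in>{..<n}. rowsum f S w i = 0)}"
    define E3 where "E3 = {f. \<exists>w. (\<forall>i\<in>{..<n}. rowsum f {..<n} w i = 0) \<and> card {..<n} < 4 * card {j\<in>{..<n}. w j \<noteq> 0}}"
    have "{f. ?A f \<notin> ?G} \<subseteq> E1 \<union> (E2 \<union> E3)"
    proof
      fix f assume "f \<in> {f. ?A f \<notin> ?G}"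
      then obtain S where "1 \<le> card S" "S \<subseteq> {..<n}" "minimal_dependency (col_submatrix (?A f) S)"
        "col_submatrix (?A f) S \<notin> tree_dependencies (card S)" by blast
      moreover from this have "S \<noteq> {}" by auto
      ultimately show "f \<in> E1 \<union> (E2 \<union> E3)"
        using non_tree_dependency_cases[of S n f K p] unfolding E1_def E2_def E3_def by simp
    qed
    hence "?P {f. ?A f \<notin> ?G} \<le> ?P (E1 \<union> (E2 \<union> E3))" by (intro measure_pmf.finite_measure_mono) auto
    also have "\<dots> \<le> ?P E1 + ?P (E2 \<union> E3)" by (rule measure_Un_le) auto
    also have "?P (E2 \<union> E3) \<le> ?P E2 + ?P E3" by (rule measure_Un_le) auto
    also have "?P E1 \<le> \<delta>" unfolding E1_def using p np by (intro D0) auto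
    also have "?P E2 \<le> (1 / 8) ^ card {..<n}"
      unfolding E2_def using K(2) p by (intro prob_midsize_solution_le) auto
    also have "(1 / 8 :: real) ^ card {..<n} \<le> \<delta>"
      by (rule order_trans[OF power_decreasing n0]) (use nn0 in auto)
    also have "?P E3 \<le> \<delta>" unfolding E3_def using p np by (intro D1) auto
    finally have "?P {f. ?A f \<notin> ?G} \<le> \<epsilon>" unfolding \<delta>_def by simp
    moreover have "measure_pmf.prob (random_sym_mat n p) (- ?G) = 1 - measure_pmf.prob (random_sym_mat n p) ?G"
      using measure_pmf.prob_compl[of ?G "random_sym_mat n p"] by (simp add: Compl_eq_Diff_UNIV)
    ultimately show "measure_pmf.prob (random_sym_mat n p) ?G \<ge> 1 - \<epsilon>" using eq by linarith
  qed
qed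

theorem theorem1p6:
  fixes p :: "nat \<Rightarrow> real"
  assumes "\<And>n. 0 \<le> p n" and "\<And>n. p n \<le> 1 / 2"
    and "p \<in> \<omega>(\<lambda>n. 1 / real n)"
  shows "(\<lambda>n. measure_pmf.prob (random_sym_mat n (p n))
            {A. \<forall>k \<ge> 1. \<forall>S \<subseteq> {..<n}. card S = k \<longrightarrow>
                  minimal_dependency (col_submatrix A S) \<longrightarrow>
                  col_submatrix A S \<in> tree_dependencies k})
         \<longlonglongrightarrow> 1"
proof (rule LIMSEQ_I)
  fix r :: real assume r: "0 < r"
  hence "0 < r / 2" by simp
  then obtain D where D: "\<And>n (p::real). 0 < p \<Longrightarrow> p \<le> 1 / 2 \<Longrightarrow> D \<le> real n * p \<Longrightarrow>
    measure_pmf.prob (random_sym_mat n p)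
            {A. \<forall>k \<ge> 1. \<forall>S \<subseteq> {..<n}. card S = k \<longrightarrow>
                  minimal_dependency (col_submatrix A S) \<longrightarrow>
                  col_submatrix A S \<in> tree_dependencies k} \<ge> 1 - r / 2"
    by (rule non_tree_dependency_rare) (rule that)
  \<comment> \<open>The 1 forces \<open>p n\<close> to be positive for large \<open>n\<close>;
    \<open>D\<close> by itself might be zero or negative.\<close>
  let ?c = "max 1 D"
  have "\<forall>\<^sub>F n in sequentially. ?c * norm (1 / real n) \<le> norm (p n)"
    using landau_omega.smallD[OF assms(3), of ?c] by simp
  then obtain N where N: "\<And>n. N \<le> n \<Longrightarrow> ?c * norm (1 / real n) \<le> norm (p n)"
    unfolding eventually_sequentially by blast
  show "\<exists>no. \<forall>n\<ge>no. norm (measure_pmf.prob (random_sym_mat n (p n))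
            {A. \<forall>k \<ge> 1. \<forall>S \<subseteq> {..<n}. card S = k \<longrightarrow>
                  minimal_dependency (col_submatrix A S) \<longrightarrow>
                  col_submatrix A S \<in> tree_dependencies k} - 1) < r"
  proof (intro exI[of _ "max 1 N"] allI impI)
    fix n assume n: "max 1 N \<le> n"
    hence n0: "0 < real n" by simp
    have "?c / real n \<le> p n" using N[of n] n assms(1)[of n] by simp
    hence c: "?c \<le> real n * p n" using n0 by (simp add: field_simps)
    have "0 < p n"
    proof (rule ccontr)
      assume "\<not> 0 < p n"
      hence "p n = 0" using assms(1)[of n] by linarith
      thus False using c by simp
    qed
    hence "1 - r / 2 \<le> measure_pmf.prob (random_sym_mat n (p n))
            {A. \<forall>k \<ge> 1. \<forall>S \<subseteq> {..<n}. card S = k \<longrightarrow>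
                  minimal_dependency (col_submatrix A S) \<longrightarrow>
                  col_submatrix A S \<in> tree_dependencies k}"
      using c assms(2) by (intro D) auto
    moreover have "measure_pmf.prob (random_sym_mat n (p n))
            {A. \<forall>k \<ge> 1. \<forall>S \<subseteq> {..<n}. card S = k \<longrightarrow>
                  minimal_dependency (col_submatrix A S) \<longrightarrow>
                  col_submatrix A S \<in> tree_dependencies k} \<le> 1" by simp
    ultimately show "norm (measure_pmf.prob (random_sym_mat n (p n))
            {A. \<forall>k \<ge> 1. \<forall>S \<subseteq> {..<n}. card S = k \<longrightarrow>
                  minimal_dependency (col_submatrix A S) \<longrightarrow>
                  col_submatrix A S \<in> tree_dependencies k} - 1) < r"
      using r unfolding real_norm_def by linarith
  qed
qed

end
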